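(* Let $K=\mathbb{C}(t)$ and let $X\subset \mathbb{P}^n_K$ be an irreducible projective variety of degree $d\geq 2$ and dimension $m$ defined over $K$. Then for every integer $b\geq 1$, $$\dim X(b)\leq mb.$$
   Context: Every point of $\mathbb{P}^n(K)$ can be written as $x=(x_0:\ldots:x_n)$ with $x_i\in\mathbb{C}[t]$ coprime; its height is $h(x)=\max_i\deg x_i$. For a quasi-projective variety $X\subset\mathbb{P}^n_K$ and an integer $b\ge 1$, put $X(b)=\{x\in X(K): h(x)<b\}$. Identifying $(n+1)$-tuples of polynomials of degree $<b$, up to $\mathbb{C}^\times$, with points of $\mathbb{P}^{b(n+1)-1}_{\mathbb{C}}$ (coordinates being the coefficients), and representing points by coprime tuples, $X(b)$ is naturally a quasi-projective variety over $\mathbb{C}$ in $\mathbb{P}^{b(n+1)-1}_{\mathbb{C}}$; its equations are obtained by expanding the equations of $X$ in powers of $t$. The dimension is that of this variety over $\mathbb{C}$. *)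

theory Defs
  imports
    "HOL-Analysis.Analysis"
    "HOL-Library.Poly_Mapping"
    "HOL-Computational_Algebra.Polynomial_Factorial"
    "HOL-Algebra.Ideal"
begin

section \<open>Multivariate polynomials\<close>

text \<open>A polynomial is a finitely supported map from exponent vectors to coefficients.
  The ring of polynomials in the variables \<open>V\<close> is carved out of this type by a condition
  on the exponents.\<close>

type_synonym ('v, 'k) mpoly = "('v \<Rightarrow>\<^sub>0 nat) \<Rightarrow>\<^sub>0 'k"

definition mpolys :: "'v set \<Rightarrow> ('v, 'k::zero) mpoly set" where
  "mpolys V = {f. \<forall>\<alpha>\<in>Poly_Mapping.keys f. Poly_Mapping.keys \<alpha> \<subseteq> V}"

definition mpoly_ring :: "'v set \<Rightarrow> ('v, 'k::comm_ring_1) mpoly ring" where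
  "mpoly_ring V = \<lparr>carrier = mpolys V, mult = (*), one = 1, zero = 0, add = (+)\<rparr>"

definition mon_degree :: "('v \<Rightarrow>\<^sub>0 nat) \<Rightarrow> nat" where
  "mon_degree \<alpha> = (\<Sum>v\<in>Poly_Mapping.keys \<alpha>. Poly_Mapping.lookup \<alpha> v)"

definition homogeneous :: "nat \<Rightarrow> ('v, 'k::zero) mpoly \<Rightarrow> bool" where
  "homogeneous s f \<longleftrightarrow> (\<forall>\<alpha>\<in>Poly_Mapping.keys f. mon_degree \<alpha> = s)"

definition hom_part :: "nat \<Rightarrow> ('v, 'k::comm_monoid_add) mpoly \<Rightarrow> ('v, 'k) mpoly" where
  "hom_part s f = (\<Sum>\<alpha> | \<alpha> \<in> Poly_Mapping.keys f \<and> mon_degree \<alpha> = s.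
     Poly_Mapping.single \<alpha> (Poly_Mapping.lookup f \<alpha>))"

definition mon_eval :: "('v \<Rightarrow>\<^sub>0 nat) \<Rightarrow> ('v \<Rightarrow> 'k::comm_semiring_1) \<Rightarrow> 'k" where
  "mon_eval \<alpha> x = (\<Prod>v\<in>Poly_Mapping.keys \<alpha>. x v ^ Poly_Mapping.lookup \<alpha> v)"

definition mpoly_eval :: "('v, 'k::comm_semiring_1) mpoly \<Rightarrow> ('v \<Rightarrow> 'k) \<Rightarrow> 'k" where
  "mpoly_eval f x = (\<Sum>\<alpha>\<in>Poly_Mapping.keys f. Poly_Mapping.lookup f \<alpha> * mon_eval \<alpha> x)"

definition mpoly_scale :: "'k::comm_semiring_1 \<Rightarrow> ('v, 'k) mpoly \<Rightarrow> ('v, 'k) mpoly" where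
  "mpoly_scale c f = Poly_Mapping.single 0 c * f"

lemma mpolys_zero: "0 \<in> mpolys V"
  by (auto simp: mpolys_def)

lemma mpolys_add: "f \<in> mpolys V \<Longrightarrow> g \<in> mpolys V \<Longrightarrow> f + g \<in> mpolys V"
  using keys_add[of f g] unfolding mpolys_def by blast

lemma mpolys_one: "1 \<in> mpolys V"
  by (auto simp: mpolys_def)

lemma mpolys_mult: "f \<in> mpolys V \<Longrightarrow> g \<in> mpolys V \<Longrightarrow> f * g \<in> mpolys V"
  for f g :: "('v, 'k::comm_semiring_1) mpoly"
  unfolding mpolys_def
proof (intro CollectI ballI)
  fix \<gamma> assume f: "f \<in> {f. \<forall>\<alpha>\<in>Poly_Mapping.keys f. Poly_Mapping.keys \<alpha> \<subseteq> V}"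
    and g: "g \<in> {f. \<forall>\<alpha>\<in>Poly_Mapping.keys f. Poly_Mapping.keys \<alpha> \<subseteq> V}"
    and "\<gamma> \<in> Poly_Mapping.keys (f * g)"
  then obtain \<alpha> \<beta> where "\<gamma> = \<alpha> + \<beta>" "\<alpha> \<in> Poly_Mapping.keys f" "\<beta> \<in> Poly_Mapping.keys g"
    using keys_mult[of f g] by blast
  then show "Poly_Mapping.keys \<gamma> \<subseteq> V"
    using f g keys_add[of \<alpha> \<beta>] by blast
qed

lemma cring_mpoly_ring: "cring (mpoly_ring V :: ('v, 'k::comm_ring_1) mpoly ring)"
proof (rule cringI)
  show "abelian_group (mpoly_ring V :: ('v, 'k) mpoly ring)"
  proof (rule abelian_groupI)
    fix f :: "('v, 'k) mpoly" assume "f \<in> carrier (mpoly_ring V)"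
    then have "- f \<in> mpolys V" "- f + f = 0"
      by (auto simp: mpoly_ring_def mpolys_def in_keys_iff)
    then show "\<exists>g\<in>carrier (mpoly_ring V). g \<oplus>\<^bsub>mpoly_ring V\<^esub> f = \<zero>\<^bsub>mpoly_ring V\<^esub>"
      by (auto simp: mpoly_ring_def intro!: bexI[of _ "- f"])
  qed (auto simp: mpoly_ring_def mpolys_add mpolys_zero add.assoc add.commute)
  show "comm_monoid (mpoly_ring V :: ('v, 'k) mpoly ring)"
    by (rule comm_monoidI) (auto simp: mpoly_ring_def mpolys_one mpolys_mult mult.assoc mult.commute)
qed (simp add: mpoly_ring_def distrib_right)

lemma vector_space_mpoly_scale:
  "vector_space (mpoly_scale :: 'k::field \<Rightarrow> ('v, 'k) mpoly \<Rightarrow> _)"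
  by unfold_locales
    (simp_all add: mpoly_scale_def single_add distrib_left distrib_right mult_single mult.assoc[symmetric])

lemma mon_degree_superset:
  "finite A \<Longrightarrow> Poly_Mapping.keys \<alpha> \<subseteq> A \<Longrightarrow> mon_degree \<alpha> = (\<Sum>v\<in>A. Poly_Mapping.lookup \<alpha> v)"
  unfolding mon_degree_def by (rule sum.mono_neutral_left) (auto simp: in_keys_iff)

lemma mon_degree_add: "mon_degree (\<alpha> + \<beta>) = mon_degree \<alpha> + mon_degree \<beta>"
  using keys_add[of \<alpha> \<beta>]
  by (simp add: mon_degree_superset[where A = "Poly_Mapping.keys \<alpha> \<union> Poly_Mapping.keys \<beta>"]
      lookup_add sum.distrib)

lemma homogeneous_mult: "homogeneous s f \<Longrightarrow> homogeneous r g \<Longrightarrow> homogeneous (s + r) (f * g)"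
  for f g :: "('v, 'k::comm_semiring_1) mpoly"
  unfolding homogeneous_def
proof
  fix \<gamma> assume f: "\<forall>\<alpha>\<in>Poly_Mapping.keys f. mon_degree \<alpha> = s"
    and g: "\<forall>\<alpha>\<in>Poly_Mapping.keys g. mon_degree \<alpha> = r"
    and "\<gamma> \<in> Poly_Mapping.keys (f * g)"
  then obtain \<alpha> \<beta> where "\<gamma> = \<alpha> + \<beta>" "\<alpha> \<in> Poly_Mapping.keys f" "\<beta> \<in> Poly_Mapping.keys g"
    using keys_mult[of f g] by blast
  then show "mon_degree \<gamma> = s + r"
    using f g by (simp add: mon_degree_add)
qed

lemma mon_eval_superset:
  "finite A \<Longrightarrow> Poly_Mapping.keys \<alpha> \<subseteq> A \<Longrightarrow> mon_eval \<alpha> x = (\<Prod>v\<in>A. x v ^ Poly_Mapping.lookup \<alpha> v)"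
  unfolding mon_eval_def by (rule prod.mono_neutral_left) (auto simp: in_keys_iff)

lemma mon_eval_add: "mon_eval (\<alpha> + \<beta>) x = mon_eval \<alpha> x * mon_eval \<beta> x"
  using keys_add[of \<alpha> \<beta>]
  by (simp add: mon_eval_superset[where A = "Poly_Mapping.keys \<alpha> \<union> Poly_Mapping.keys \<beta>"]
      lookup_add power_add prod.distrib)

lemma mpoly_eval_superset:
  "finite A \<Longrightarrow> Poly_Mapping.keys f \<subseteq> A \<Longrightarrow>
    mpoly_eval f x = (\<Sum>\<alpha>\<in>A. Poly_Mapping.lookup f \<alpha> * mon_eval \<alpha> x)"
  unfolding mpoly_eval_def by (rule sum.mono_neutral_left) (auto simp: in_keys_iff)

lemma mpoly_eval_add: "mpoly_eval (f + g) x = mpoly_eval f x + mpoly_eval g x"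
  using keys_add[of f g]
  by (simp add: mpoly_eval_superset[where A = "Poly_Mapping.keys f \<union> Poly_Mapping.keys g"]
      lookup_add sum.distrib algebra_simps)

lemma mpoly_eval_0: "mpoly_eval 0 x = 0"
  by (simp add: mpoly_eval_def)

lemma mpoly_eval_single: "mpoly_eval (Poly_Mapping.single \<alpha> c) x = c * mon_eval \<alpha> x"
  by (simp add: mpoly_eval_def)

lemma mpoly_eval_sum: "mpoly_eval (sum f A) x = (\<Sum>a\<in>A. mpoly_eval (f a) x)"
  by (induction A rule: infinite_finite_induct) (auto simp: mpoly_eval_0 mpoly_eval_add)

lemma mpoly_as_sum:
  "f = (\<Sum>\<alpha>\<in>Poly_Mapping.keys f. Poly_Mapping.single \<alpha> (Poly_Mapping.lookup f \<alpha>))"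
  by (rule poly_mapping_eqI)
    (auto simp: lookup_sum lookup_single when_def in_keys_iff sum.delta)

lemma mpoly_eval_mult: "mpoly_eval (f * g) x = mpoly_eval f x * mpoly_eval g x"
proof -
  have "f * g = (\<Sum>\<alpha>\<in>Poly_Mapping.keys f. \<Sum>\<beta>\<in>Poly_Mapping.keys g.
      Poly_Mapping.single (\<alpha> + \<beta>) (Poly_Mapping.lookup f \<alpha> * Poly_Mapping.lookup g \<beta>))"
    by (subst (1) mpoly_as_sum[of f], subst (1) mpoly_as_sum[of g]) (simp add: sum_product mult_single)
  then show ?thesis
    by (simp add: mpoly_eval_sum mpoly_eval_single mon_eval_add)
      (simp add: mpoly_eval_def sum_product mult_ac)
qed


section \<open>Irreducibility and dimension of topological spaces\<close>

definition irreducible_space :: "'a topology \<Rightarrow> bool" where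
  "irreducible_space T \<longleftrightarrow> topspace T \<noteq> {} \<and>
     (\<forall>C D. closedin T C \<and> closedin T D \<and> C \<union> D = topspace T \<longrightarrow>
        C = topspace T \<or> D = topspace T)"

text \<open>The supremum of the lengths of chains \<open>Z\<^sub>0 \<subset> \<dots> \<subset> Z\<^sub>r\<close> of irreducible closed
  subsets; the empty space has dimension \<open>-\<infinity>\<close>.\<close>

definition krull_dim :: "'a topology \<Rightarrow> ereal" where
  "krull_dim T = Sup {ereal (real r) | r. \<exists>Z :: nat \<Rightarrow> 'a set.
     (\<forall>i\<le>r. closedin T (Z i) \<and> irreducible_space (subtopology T (Z i))) \<and>
     (\<forall>i<r. Z i \<subset> Z (Suc i))}"


section \<open>Projective space over a field as a scheme, and its subvarieties\<close>

text \<open>The underlying space of \<open>Proj k[V]\<close>. Its points are the homogeneous prime ideals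
  of \<open>k[V]\<close> that do not contain the irrelevant ideal.\<close>

definition irrelevant_ideal :: "'v set \<Rightarrow> ('v, 'k::zero) mpoly set" where
  "irrelevant_ideal V = {f \<in> mpolys V. Poly_Mapping.lookup f 0 = 0}"

definition Proj_points :: "'v set \<Rightarrow> ('v, 'k::field) mpoly set set" where
  "Proj_points V = {\<pp>. primeideal \<pp> (mpoly_ring V) \<and>
     (\<forall>f\<in>\<pp>. \<forall>s. hom_part s f \<in> \<pp>) \<and> \<not> irrelevant_ideal V \<subseteq> \<pp>}"

definition Proj :: "'v set \<Rightarrow> ('v, 'k::field) mpoly set topology" where
  "Proj V = topology_generated_by
     {{\<pp> \<in> Proj_points V. f \<notin> \<pp>} | f s. f \<in> mpolys V \<and> homogeneous s f}"

definition irreducible_projective_variety :: "'v set \<Rightarrow> ('v, 'k::field) mpoly set set \<Rightarrow> bool" where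
  "irreducible_projective_variety V X \<longleftrightarrow>
     closedin (Proj V) X \<and> irreducible_space (subtopology (Proj V) X)"

definition vanishing_ideal :: "'v set \<Rightarrow> ('v, 'k::field) mpoly set set \<Rightarrow> ('v, 'k) mpoly set" where
  "vanishing_ideal V X = {f \<in> mpolys V. \<forall>\<pp>\<in>X. f \<in> \<pp>}"

text \<open>The dimension over \<open>k\<close> of the degree-\<open>s\<close> part of the homogeneous coordinate ring
  \<open>k[V]/I(X)\<close>, where \<open>X\<close> carries its reduced structure.\<close>

definition hilbert_function :: "'v set \<Rightarrow> ('v, 'k::field) mpoly set set \<Rightarrow> nat \<Rightarrow> nat" where
  "hilbert_function V X s =
     vector_space.dim mpoly_scale {f :: ('v, 'k) mpoly. f \<in> mpolys V \<and> homogeneous s f} -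
     vector_space.dim mpoly_scale {f \<in> vanishing_ideal V X. homogeneous s f}"

definition is_hilbert_polynomial :: "'v set \<Rightarrow> ('v, 'k::field) mpoly set set \<Rightarrow> rat poly \<Rightarrow> bool" where
  "is_hilbert_polynomial V X P \<longleftrightarrow>
     (\<forall>\<^sub>F s in sequentially. of_nat (hilbert_function V X s) = poly P (of_nat s))"

text \<open>The degree of \<open>X\<close> is \<open>r!\<close> times the leading coefficient of the Hilbert polynomial of
  \<open>X\<close>, where \<open>r\<close> is the degree of that polynomial. The Hilbert polynomial is unique, so this is
  a functional relation.\<close>

definition has_degree :: "'v set \<Rightarrow> ('v, 'k::field) mpoly set set \<Rightarrow> nat \<Rightarrow> bool" where
  "has_degree V X d \<longleftrightarrow> (\<exists>P. is_hilbert_polynomial V X P \<and>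
     of_nat d = fact (Polynomial.degree P) * Polynomial.lead_coeff P)"


section \<open>Points of projective space over a field\<close>

text \<open>A point with homogeneous coordinates \<open>x\<close> is the set of all its coordinate vectors.
  Coordinates outside \<open>V\<close> are zero.\<close>

definition proj_point :: "('v \<Rightarrow> 'k::field) \<Rightarrow> ('v \<Rightarrow> 'k) set" where
  "proj_point x = {\<lambda>v. c * x v | c. c \<noteq> 0}"

definition proj_space :: "'v set \<Rightarrow> ('v \<Rightarrow> 'k::field) set set" where
  "proj_space V = {proj_point x | x. (\<exists>v. x v \<noteq> 0) \<and> (\<forall>v. v \<notin> V \<longrightarrow> x v = 0)}"

definition zariski :: "'v set \<Rightarrow> ('v \<Rightarrow> 'k::field) set topology" where
  "zariski V = topology_generated_by
     {{p \<in> proj_space V. \<forall>x\<in>p. mpoly_eval f x \<noteq> 0} | f s. f \<in> mpolys V \<and> homogeneous s f}"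

text \<open>The homogeneous prime ideal of a rational point, generated by the homogeneous polynomials
  vanishing at it.\<close>

definition point_ideal :: "'v set \<Rightarrow> ('v \<Rightarrow> 'k::field) set \<Rightarrow> ('v, 'k) mpoly set" where
  "point_ideal V p = {f \<in> mpolys V. \<forall>s. \<forall>x\<in>p. mpoly_eval (hom_part s f) x = 0}"

definition rational_points ::
    "'v set \<Rightarrow> ('v, 'k::field) mpoly set set \<Rightarrow> ('v \<Rightarrow> 'k) set set" where
  "rational_points V X = {p \<in> proj_space V. point_ideal V p \<in> X}"

lemma topology_generated_by_basis_closedin:
  fixes B :: "'i \<Rightarrow> 'a set"
  assumes top: "e \<in> I" "B e = P" and sub: "\<And>i. i \<in> I \<Longrightarrow> B i \<subseteq> P"
    and int: "\<And>i j. i \<in> I \<Longrightarrow> j \<in> I \<Longrightarrow> \<exists>k\<in>I. B i \<inter> B j = B k"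
  shows "closedin (topology_generated_by (B ` I)) C \<longleftrightarrow> (\<exists>S\<subseteq>I. C = P - (\<Union>i\<in>S. B i))"
proof -
  have topsp: "topspace (topology_generated_by (B ` I)) = P"
    using top sub by (auto simp: topology_generated_by_topspace)
  have open1: "\<exists>S\<subseteq>I. U = (\<Union>i\<in>S. B i)" if "generate_topology_on (B ` I) U" for U
    using that
  proof induction
    case Empty
    then show ?case by (intro exI[of _ "{}"]) auto
  next
    case (Int a b)
    then obtain S T where S: "S \<subseteq> I" "a = (\<Union>i\<in>S. B i)" and T: "T \<subseteq> I" "b = (\<Union>i\<in>T. B i)"
      by auto
    have "a \<inter> b = (\<Union>k\<in>{k\<in>I. B k \<subseteq> a \<inter> b}. B k)"
    proof
      show "a \<inter> b \<subseteq> (\<Union>k\<in>{k\<in>I. B k \<subseteq> a \<inter> b}. B k)"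
      proof
        fix p assume "p \<in> a \<inter> b"
        then obtain i j where ij: "i \<in> S" "p \<in> B i" "j \<in> T" "p \<in> B j"
          using S T by auto
        then obtain k where "k \<in> I" "B i \<inter> B j = B k"
          using int S T by blast
        then show "p \<in> (\<Union>k\<in>{k\<in>I. B k \<subseteq> a \<inter> b}. B k)"
          using ij S T by blast
      qed
    qed auto
    then show ?case by (intro exI[of _ "{k\<in>I. B k \<subseteq> a \<inter> b}"]) auto
  next
    case (UN K)
    then have "\<forall>k\<in>K. \<exists>S. S \<subseteq> I \<and> k = (\<Union>i\<in>S. B i)"
      by blast
    then obtain S where S: "\<forall>k\<in>K. S k \<subseteq> I \<and> k = (\<Union>i\<in>S k. B i)"
      by (rule bchoice[THEN exE])
    then have "(\<Union>k\<in>K. k) = (\<Union>k\<in>K. \<Union>i\<in>S k. B i)"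
      by (intro SUP_cong) simp_all
    then have "\<Union>K = (\<Union>i\<in>(\<Union>k\<in>K. S k). B i)"
      by simp
    moreover have "(\<Union>k\<in>K. S k) \<subseteq> I" using S by blast
    ultimately show ?case by blast
  next
    case (Basis s)
    then obtain i where "i \<in> I" "s = B i" by auto
    then show ?case by (intro exI[of _ "{i}"]) auto
  qed
  have open2: "openin (topology_generated_by (B ` I)) (\<Union>i\<in>S. B i)" if "S \<subseteq> I" for S
    using that by (intro openin_Union) (auto intro!: topology_generated_by_Basis)
  show ?thesis
  proof
    assume "closedin (topology_generated_by (B ` I)) C"
    then have C: "C \<subseteq> P" "openin (topology_generated_by (B ` I)) (P - C)"
      unfolding closedin_def topsp by (rule conjunct1, rule conjunct2)
    from open1[OF openin_topology_generated_by[OF C(2)]]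
    obtain S where S: "S \<subseteq> I" "P - C = (\<Union>i\<in>S. B i)" by (elim exE conjE)
    have "C = P - (P - C)" using C(1) by blast
    then have "S \<subseteq> I \<and> C = P - (\<Union>i\<in>S. B i)" using S by simp
    then show "\<exists>S\<subseteq>I. C = P - (\<Union>i\<in>S. B i)" by blast
  next
    assume "\<exists>S\<subseteq>I. C = P - (\<Union>i\<in>S. B i)"
    then obtain S where S: "S \<subseteq> I" "C = P - (\<Union>i\<in>S. B i)" by blast
    have "P - C = (\<Union>i\<in>S. B i)" using S sub by blast
    then have "openin (topology_generated_by (B ` I)) (P - C)" using open2[OF S(1)] by simp
    moreover have "C \<subseteq> P" using S(2) by blast
    ultimately show "closedin (topology_generated_by (B ` I)) C"
      unfolding closedin_def topsp by blast
  qed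
qed

lemma homogeneous_one: "homogeneous 0 (1 :: ('v, 'k::zero_neq_one) mpoly)"
  by (auto simp: homogeneous_def mon_degree_def)

lemma primeideal_mpoly_ringD:
  fixes \<pp> :: "('v, 'k::field) mpoly set"
  assumes "primeideal \<pp> (mpoly_ring V)"
  shows "1 \<notin> \<pp>" and "\<lbrakk>f \<in> mpolys V; g \<in> mpolys V\<rbrakk> \<Longrightarrow> f * g \<in> \<pp> \<longleftrightarrow> f \<in> \<pp> \<or> g \<in> \<pp>"
proof -
  interpret primeideal \<pp> "mpoly_ring V" by fact
  have [simp]: "carrier (mpoly_ring V :: ('v, 'k) mpoly ring) = mpolys V"
    "mult (mpoly_ring V :: ('v, 'k) mpoly ring) = (*)" "one (mpoly_ring V :: ('v, 'k) mpoly ring) = 1"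
    by (simp_all add: mpoly_ring_def)
  show "1 \<notin> \<pp>"
    using one_imp_carrier I_notcarr by auto
  show "f * g \<in> \<pp> \<longleftrightarrow> f \<in> \<pp> \<or> g \<in> \<pp>" if "f \<in> mpolys V" "g \<in> mpolys V"
    using I_prime[of f g] I_l_closed[of g f] I_r_closed[of f g] that by auto
qed

text \<open>The closed sets are the common zero loci of sets of homogeneous polynomials.\<close>

lemma closedin_Proj:
  fixes C :: "('v, 'k::field) mpoly set set"
  shows "closedin (Proj V) C \<longleftrightarrow>
    (\<exists>S \<subseteq> {f \<in> mpolys V. \<exists>s. homogeneous s f}. C = {\<pp> \<in> Proj_points V. S \<subseteq> \<pp>})"
proof -
  define I :: "('v, 'k) mpoly set" where "I = {f \<in> mpolys V. \<exists>s. homogeneous s f}"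
  define B :: "('v, 'k) mpoly \<Rightarrow> _" where "B f = {\<pp> \<in> Proj_points V. f \<notin> \<pp>}" for f
  have *: "Proj V = topology_generated_by (B ` I)"
    unfolding Proj_def I_def B_def by (rule arg_cong[of _ _ topology_generated_by]) blast
  have "closedin (topology_generated_by (B ` I)) C \<longleftrightarrow>
      (\<exists>S\<subseteq>I. C = Proj_points V - (\<Union>i\<in>S. B i))"
  proof (rule topology_generated_by_basis_closedin[of 1])
    show "1 \<in> I" using mpolys_one homogeneous_one by (auto simp: I_def)
    show "B 1 = Proj_points V"
      using primeideal_mpoly_ringD(1) by (auto simp: B_def Proj_points_def)
    fix f g assume fg: "f \<in> I" "g \<in> I"
    show "\<exists>h\<in>I. B f \<inter> B g = B h"
    proof
      show "f * g \<in> I" using fg homogeneous_mult mpolys_mult unfolding I_def by blast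
      have "f * g \<in> \<pp> \<longleftrightarrow> f \<in> \<pp> \<or> g \<in> \<pp>" if "\<pp> \<in> Proj_points V" for \<pp>
        using that fg primeideal_mpoly_ringD(2)[of \<pp> V f g] by (auto simp: Proj_points_def I_def)
      then show "B f \<inter> B g = B (f * g)" by (auto simp: B_def)
    qed
  qed (auto simp: B_def)
  moreover have "Proj_points V - (\<Union>i\<in>S. B i) = {\<pp> \<in> Proj_points V. S \<subseteq> \<pp>}" for S
    by (auto simp: B_def)
  ultimately show ?thesis by (simp add: * I_def)
qed

lemma mpoly_eval_homogeneous_scale:
  assumes "homogeneous s f"
  shows "mpoly_eval f (\<lambda>v. c * x v) = c ^ s * mpoly_eval f x"
proof -
  have "mon_eval \<alpha> (\<lambda>v. c * x v) = c ^ mon_degree \<alpha> * mon_eval \<alpha> x" for \<alpha>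
    by (simp add: mon_eval_def mon_degree_def power_mult_distrib prod.distrib power_sum)
  then show ?thesis
    using assms by (auto simp: mpoly_eval_def homogeneous_def sum_distrib_left mult_ac intro!: sum.cong)
qed

lemma closedin_zariski:
  fixes C :: "('v \<Rightarrow> 'k::field) set set"
  shows "closedin (zariski V) C \<longleftrightarrow> (\<exists>S \<subseteq> {f \<in> mpolys V. \<exists>s. homogeneous s f}.
    C = {p \<in> proj_space V. \<forall>f\<in>S. \<forall>x\<in>p. mpoly_eval f x = 0})"
proof -
  define I :: "('v, 'k) mpoly set" where "I = {f \<in> mpolys V. \<exists>s. homogeneous s f}"
  define B :: "('v, 'k) mpoly \<Rightarrow> _"
    where "B f = {p \<in> proj_space V. \<forall>x\<in>p. mpoly_eval f x \<noteq> 0}" for f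
  have *: "zariski V = topology_generated_by (B ` I)"
    unfolding zariski_def I_def B_def by (rule arg_cong[of _ _ topology_generated_by]) blast
  have basis: "closedin (topology_generated_by (B ` I)) C \<longleftrightarrow>
      (\<exists>S\<subseteq>I. C = proj_space V - (\<Union>i\<in>S. B i))"
  proof (rule topology_generated_by_basis_closedin[of 1])
    show "1 \<in> I" using mpolys_one homogeneous_one by (auto simp: I_def)
    show "B 1 = proj_space V"
      by (auto simp: B_def mpoly_eval_def mon_eval_def)
    fix f g assume fg: "f \<in> I" "g \<in> I"
    show "\<exists>h\<in>I. B f \<inter> B g = B h"
    proof
      show "f * g \<in> I" using fg homogeneous_mult mpolys_mult unfolding I_def by blast
      show "B f \<inter> B g = B (f * g)" by (auto simp: B_def mpoly_eval_mult)
    qed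
  qed (auto simp: B_def)
  have loci: "proj_space V - (\<Union>i\<in>S. B i) =
      {p \<in> proj_space V. \<forall>f\<in>S. \<forall>x\<in>p. mpoly_eval f x = 0}" if "S \<subseteq> I" for S
  proof -
    have *: "(\<forall>x\<in>p. mpoly_eval f x = 0) \<longleftrightarrow> (\<exists>x\<in>p. mpoly_eval f x = 0)"
      if "p \<in> proj_space V" "f \<in> S" for p f
    proof -
      obtain s where "homogeneous s f" using \<open>f \<in> S\<close> \<open>S \<subseteq> I\<close> by (auto simp: I_def)
      moreover obtain x where "p = proj_point x" using \<open>p \<in> proj_space V\<close>
        by (auto simp: proj_space_def)
      moreover have "\<exists>c::'k. c \<noteq> 0" by (rule exI[of _ 1]) simp
      ultimately show ?thesis
        by (auto simp: proj_point_def mpoly_eval_homogeneous_scale)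
    qed
    have "p \<in> proj_space V - (\<Union>i\<in>S. B i) \<longleftrightarrow>
        p \<in> proj_space V \<and> (\<forall>f\<in>S. \<forall>x\<in>p. mpoly_eval f x = 0)" for p
      using *[of p] by (cases "p \<in> proj_space V") (simp_all add: B_def)
    then show ?thesis by blast
  qed
  have "(\<exists>S\<subseteq>I. C = proj_space V - (\<Union>i\<in>S. B i)) \<longleftrightarrow>
      (\<exists>S\<subseteq>I. C = {p \<in> proj_space V. \<forall>f\<in>S. \<forall>x\<in>p. mpoly_eval f x = 0})"
    by (intro ex_cong1 conj_cong refl) (simp add: loci)
  with basis show ?thesis unfolding * I_def[symmetric] by (rule trans)
qed


section \<open>Points of bounded height over the rational function field\<close>

text \<open>Tuples \<open>(x\<^sub>0, \<dots>, x\<^sub>n)\<close> of coprime polynomials over the complex numbers with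
  \<open>p = (x\<^sub>0 : \<dots> : x\<^sub>n)\<close>. Such a tuple exists and is unique up to a nonzero constant.\<close>

definition coprime_rep ::
    "nat \<Rightarrow> (nat \<Rightarrow> complex poly fract) set \<Rightarrow> (nat \<Rightarrow> complex poly) \<Rightarrow> bool" where
  "coprime_rep n p x \<longleftrightarrow> (\<forall>i>n. x i = 0) \<and> (\<forall>q. (\<forall>i\<le>n. q dvd x i) \<longrightarrow> is_unit q) \<and>
     p = proj_point (\<lambda>i. to_fract (x i))"

definition height :: "nat \<Rightarrow> (nat \<Rightarrow> complex poly fract) set \<Rightarrow> nat" where
  "height n p = (THE h. \<exists>x. coprime_rep n p x \<and> h = Max ((\<lambda>i. Polynomial.degree (x i)) ` {..n}))"

text \<open>The coefficient of \<open>t\<^sup>j\<close> in \<open>x\<^sub>i\<close> is the coordinate with index \<open>(i, j)\<close>, so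
  projective space of dimension \<open>b(n+1)-1\<close> has the coordinates \<open>{..n} \<times> {..<b}\<close>.\<close>

definition coeff_vector :: "nat \<Rightarrow> nat \<Rightarrow> (nat \<Rightarrow> complex poly) \<Rightarrow> nat \<times> nat \<Rightarrow> complex" where
  "coeff_vector n b x = (\<lambda>(i, j). if i \<le> n \<and> j < b then Polynomial.coeff (x i) j else 0)"

definition bounded_points ::
    "nat \<Rightarrow> (nat, complex poly fract) mpoly set set \<Rightarrow> nat \<Rightarrow> (nat \<times> nat \<Rightarrow> complex) set set" where
  "bounded_points n X b = {proj_point (coeff_vector n b x) | x p.
     p \<in> rational_points {..n} X \<and> height n p < b \<and> coprime_rep n p x}"

end

theory Submission
  imports
    Defs
    "HOL-Computational_Algebra.Fundamental_Theorem_Algebra"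
    "HOL-Computational_Algebra.Field_as_Ring"
begin

text \<open>Let \<open>P\<close> be the homogeneous prime ideal of \<open>X\<close>. By Noether normalisation there are
  \<open>q \<le> m + 1\<close> linear forms with complex coefficients without common zero on \<open>X\<close>. As \<open>d \<ge> 2\<close>,
  after a generic choice of the forms some coordinate is not a linear combination of them
  modulo \<open>P\<close>, hence satisfies a monic integral equation of minimal degree at least \<open>2\<close> over them.
  If every line \<open>A + B t\<close> with \<open>A\<close>, \<open>B\<close> in \<open>\<complex>\<^sup>q\<close> carried a rational point of \<open>X\<close>, Hensel's lemma in
  the direction of the line would give a polynomial root of this equation, contradicting
  minimality; this replaces the Hilbert irreducibility theorem over \<open>\<complex>(t)\<close>. So some line carries
  no point. Proportionality of the forms to \<open>A + B t\<close> is expressed by few enough linear conditions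
  on the coefficients of a point, and the origin is their only common solution in the affine cone
  over the closure of \<open>X(b)\<close>. Counting monomials then bounds the length of chains of irreducible
  closed subsets.\<close>

text \<open>Let q be the least number of complex linear forms without common zero on X, so that q -
  1 <= m. Asking all q forms u_j, each of degree below b in t, to vanish costs q b conditions on the
  coefficients and yields only the bound (m + 1) b - 1, which linear subspaces over C attain. Fixing
  the ratio of the forms to a constant point A costs (q - 1) b conditions, but this can fail: if X
  comes from a variety over C, complex points A lie under rational points. A line A + B t is the
  next choice. Proportionality to it costs (q - 1) b + 1 <= m b + 1 conditions, the extra one
  because a relation of degree 1 in t has b + 1 coefficients; passing from the cone to projective
  space leaves m b. The degree enters through the Hilbert function: if all coordinates were
  combinations of the forms modulo P, that function would be the one of a projective space. In the
  Hensel argument t counts as one more coordinate beside the q forms; complex lines in dimension q +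
  1 on which t is not constant then become lines A + B t.\<close>

definition ring_map :: "('a::comm_ring_1 \<Rightarrow> 'b::comm_ring_1) \<Rightarrow> bool" where
  "ring_map h \<longleftrightarrow> h 0 = 0 \<and> h 1 = 1 \<and> (\<forall>a b. h (a + b) = h a + h b) \<and> (\<forall>a b. h (a * b) = h a * h b)"

lemma ring_mapI:
  assumes "h 0 = 0" "h 1 = 1" "\<And>a b. h (a + b) = h a + h b" "\<And>a b. h (a * b) = h a * h b"
  shows "ring_map h"
  using assms by (simp add: ring_map_def)

lemma ring_mapD:
  assumes "ring_map h"
  shows "h 0 = 0" "h 1 = 1" "h (a + b) = h a + h b" "h (a * b) = h a * h b"
  using assms by (simp_all add: ring_map_def)

lemma ring_map_uminus: "ring_map h \<Longrightarrow> h (- a) = - h a"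
  using ring_mapD(1)[of h] ring_mapD(3)[of h a "- a"] by (simp add: minus_unique)

lemma ring_map_diff: "ring_map h \<Longrightarrow> h (a - b) = h a - h b"
  using ring_mapD(3)[of h a "- b"] by (simp add: ring_map_uminus)

lemma ring_map_sum: "ring_map h \<Longrightarrow> h (sum f A) = (\<Sum>a\<in>A. h (f a))"
  by (induction A rule: infinite_finite_induct) (simp_all add: ring_mapD)

lemma ring_map_prod: "ring_map h \<Longrightarrow> h (prod f A) = (\<Prod>a\<in>A. h (f a))"
  by (induction A rule: infinite_finite_induct) (simp_all add: ring_mapD)

lemma ring_map_power: "ring_map h \<Longrightarrow> h (a ^ n) = h a ^ n"
  by (induction n) (simp_all add: ring_mapD)

lemma ring_map_comp: "ring_map g \<Longrightarrow> ring_map h \<Longrightarrow> ring_map (g \<circ> h)"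
  by (simp add: ring_map_def)

lemma ring_map_id: "ring_map (\<lambda>x. x)"
  by (simp add: ring_map_def)

lemma ring_map_poly: "ring_map (\<lambda>p. poly p x)"
  by (simp add: ring_map_def)

lemma ring_map_const_poly: "ring_map (\<lambda>c. [:c:])"
  by (simp add: ring_map_def)

lemma coeff_map_poly_ring: "ring_map h \<Longrightarrow> poly.coeff (map_poly h p) i = h (poly.coeff p i)"
  by (simp add: coeff_map_poly ring_mapD)

lemma ring_map_map_poly: "ring_map h \<Longrightarrow> ring_map (map_poly h)"
  by (intro ring_mapI)
    (simp_all add: poly_eq_iff coeff_map_poly_ring ring_mapD coeff_mult ring_map_sum coeff_1)

lemma ring_map_map_poly_poly: "ring_map h \<Longrightarrow> h (poly p x) = poly (map_poly h p) (h x)"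
  by (induction p) (simp_all add: ring_mapD map_poly_pCons)

lemma map_poly_comp: "ring_map g \<Longrightarrow> ring_map h \<Longrightarrow> map_poly g (map_poly h p) = map_poly (\<lambda>x. g (h x)) p"
  using ring_map_comp[of g h] by (simp add: poly_eq_iff coeff_map_poly_ring o_def)

lemma ring_map_mon_eval: "ring_map h \<Longrightarrow> h (mon_eval \<alpha> x) = mon_eval \<alpha> (\<lambda>v. h (x v))"
  by (simp add: mon_eval_def ring_map_prod ring_map_power)

lemma ring_map_to_fract: "ring_map to_fract"
  by (simp add: ring_map_def)

lemma mon_eval_0: "mon_eval 0 x = 1"
  by (simp add: mon_eval_def)

lemma mon_eval_single: "mon_eval (Poly_Mapping.single v k) x = x v ^ k"
  by (simp add: mon_eval_def)

section \<open>Polynomial rings: constants, variables and substitution\<close>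

definition Const :: "'k::zero \<Rightarrow> ('v, 'k) mpoly" where
  "Const c = Poly_Mapping.single 0 c"

definition Var :: "'v \<Rightarrow> ('v, 'k::zero_neq_one) mpoly" where
  "Var v = Poly_Mapping.single (Poly_Mapping.single v 1) 1"

lemma ring_map_Const: "ring_map (Const :: 'k::comm_ring_1 \<Rightarrow> ('v, 'k) mpoly)"
  by (simp add: ring_map_def Const_def single_add mult_single)

lemmas Const_simps = ring_mapD[OF ring_map_Const] ring_map_uminus[OF ring_map_Const]
  ring_map_diff[OF ring_map_Const] ring_map_power[OF ring_map_Const]

lemma Const_eq_0_iff: "Const c = 0 \<longleftrightarrow> c = 0"
  by (metis Const_def lookup_single_eq lookup_zero single_zero)

lemma Const_inverse: "c \<noteq> 0 \<Longrightarrow> Const (inverse c) * (Const c * f) = f" for c :: "'k::field"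
  by (simp add: mult.assoc[symmetric] Const_simps(4)[symmetric] Const_simps(2))

lemma Var_power: "(Var v :: ('v, 'k::comm_ring_1) mpoly) ^ k = Poly_Mapping.single (Poly_Mapping.single v k) 1"
  by (induction k) (simp_all add: Var_def mult_single single_add[symmetric])

lemma mon_eval_Var: "mon_eval \<alpha> (Var :: 'v \<Rightarrow> ('v, 'k::comm_ring_1) mpoly) = Poly_Mapping.single \<alpha> 1"
proof -
  have *: "(\<Prod>v\<in>A. Poly_Mapping.single (Poly_Mapping.single v (f v)) (1::'k)) =
      Poly_Mapping.single (\<Sum>v\<in>A. Poly_Mapping.single v (f v)) 1" for f and A :: "'v set"
    by (induction A rule: infinite_finite_induct) (simp_all add: mult_single)
  have "(\<Sum>v\<in>Poly_Mapping.keys \<alpha>. Poly_Mapping.single v (Poly_Mapping.lookup \<alpha> v)) = \<alpha>"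
    using mpoly_as_sum[of \<alpha>]
    by (intro poly_mapping_eqI)
      (auto simp: lookup_sum lookup_single when_def in_keys_iff sum.delta)
  then show ?thesis
    by (simp add: mon_eval_def Var_power *)
qed

text \<open>The substitution homomorphism: \<open>h\<close> acts on the coefficients,
  \<open>x\<close> replaces the variables. With \<open>h = Const\<close> it composes polynomials,
  with \<open>h\<close> the identity it is \<open>mpoly_eval\<close>. Expressing changes of ring
  through it lets \<open>peval_comp\<close> handle composites.\<close>

definition peval :: "('k::comm_ring_1 \<Rightarrow> 'r::comm_ring_1) \<Rightarrow> ('v \<Rightarrow> 'r) \<Rightarrow> ('v, 'k) mpoly \<Rightarrow> 'r" where
  "peval h x f = (\<Sum>\<alpha>\<in>Poly_Mapping.keys f. h (Poly_Mapping.lookup f \<alpha>) * mon_eval \<alpha> x)"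

lemma mpoly_eval_eq_peval: "mpoly_eval f x = peval (\<lambda>c. c) x f"
  by (simp add: mpoly_eval_def peval_def)

lemma peval_superset:
  "ring_map h \<Longrightarrow> finite A \<Longrightarrow> Poly_Mapping.keys f \<subseteq> A \<Longrightarrow>
    peval h x f = (\<Sum>\<alpha>\<in>A. h (Poly_Mapping.lookup f \<alpha>) * mon_eval \<alpha> x)"
  unfolding peval_def by (rule sum.mono_neutral_left) (auto simp: in_keys_iff ring_mapD)

lemma peval_single: "ring_map h \<Longrightarrow> peval h x (Poly_Mapping.single \<alpha> c) = h c * mon_eval \<alpha> x"
  by (simp add: peval_def ring_mapD)

lemma peval_add: "ring_map h \<Longrightarrow> peval h x (f + g) = peval h x f + peval h x g"
  using keys_add[of f g]
  by (simp add: peval_superset[where A = "Poly_Mapping.keys f \<union> Poly_Mapping.keys g"]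
      lookup_add sum.distrib algebra_simps ring_mapD)

lemma peval_sum: "ring_map h \<Longrightarrow> peval h x (sum f A) = (\<Sum>a\<in>A. peval h x (f a))"
  by (induction A rule: infinite_finite_induct) (auto simp: peval_def[of _ _ 0] peval_add)

lemma peval_mult: "ring_map h \<Longrightarrow> peval h x (f * g) = peval h x f * peval h x g"
proof -
  assume h: "ring_map h"
  have "f * g = (\<Sum>\<alpha>\<in>Poly_Mapping.keys f. \<Sum>\<beta>\<in>Poly_Mapping.keys g.
      Poly_Mapping.single (\<alpha> + \<beta>) (Poly_Mapping.lookup f \<alpha> * Poly_Mapping.lookup g \<beta>))"
    by (subst (1) mpoly_as_sum[of f], subst (1) mpoly_as_sum[of g]) (simp add: sum_product mult_single)
  then show ?thesis using h
    by (simp add: peval_sum peval_single mon_eval_add ring_mapD)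
      (simp add: peval_def sum_product mult_ac)
qed

lemma ring_map_peval: "ring_map h \<Longrightarrow> ring_map (peval h x)"
  by (rule ring_mapI) (simp_all add: peval_add peval_mult peval_def[of _ _ 0]
      peval_single[of h x 0 1, simplified] mon_eval_0 ring_mapD)

lemma ring_map_mpoly_eval: "ring_map (\<lambda>f. mpoly_eval f x)"
  unfolding mpoly_eval_eq_peval by (rule ring_map_peval[OF ring_map_id])

lemma peval_Const: "ring_map h \<Longrightarrow> peval h x (Const c) = h c"
  by (simp add: Const_def peval_single mon_eval_0)

lemma peval_Var: "ring_map h \<Longrightarrow> peval h x (Var v) = x v"
  by (simp add: Var_def peval_single mon_eval_single ring_mapD)

lemma mpoly_eval_Const: "mpoly_eval (Const c) x = (c :: 'k::comm_ring_1)"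
  by (simp add: mpoly_eval_eq_peval peval_Const ring_map_id)

lemma mpoly_eval_Var: "mpoly_eval (Var v) x = (x v :: 'k::comm_ring_1)"
  by (simp add: mpoly_eval_eq_peval peval_Var ring_map_id)

lemma peval_comp: "ring_map g \<Longrightarrow> g (peval h x f) = peval (\<lambda>c. g (h c)) (\<lambda>v. g (x v)) f"
  by (simp add: peval_def ring_map_sum ring_mapD ring_map_mon_eval)

lemma peval_Const_Var: "peval Const Var f = f"
  by (subst (3) mpoly_as_sum) (simp add: peval_def mon_eval_Var Const_def mult_single)

lemma mon_eval_cong: "(\<And>v. v \<in> Poly_Mapping.keys \<alpha> \<Longrightarrow> x v = y v) \<Longrightarrow> mon_eval \<alpha> x = mon_eval \<alpha> y"
  by (simp add: mon_eval_def)

lemma peval_cong: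
  assumes "f \<in> mpolys V" "\<And>v. v \<in> V \<Longrightarrow> x v = y v"
  shows "peval h x f = peval h y f"
  unfolding peval_def
proof (rule sum.cong[OF refl])
  fix \<alpha> assume "\<alpha> \<in> Poly_Mapping.keys f"
  then have "mon_eval \<alpha> x = mon_eval \<alpha> y"
    using assms by (intro mon_eval_cong) (auto simp: mpolys_def)
  then show "h (Poly_Mapping.lookup f \<alpha>) * mon_eval \<alpha> x = h (Poly_Mapping.lookup f \<alpha>) * mon_eval \<alpha> y"
    by simp
qed

text \<open>\<open>S\<close> plays the part of a subring. It will be a ring of polynomials in fewer
  variables, or of univariate polynomials whose coefficients involve only some variables; neither is
  a type.\<close>

lemma peval_in:
  fixes h :: "'k::comm_ring_1 \<Rightarrow> 'r::comm_ring_1"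
  assumes "0 \<in> S" "\<And>a b. a \<in> S \<Longrightarrow> b \<in> S \<Longrightarrow> a + b \<in> S" "\<And>a b. a \<in> S \<Longrightarrow> b \<in> S \<Longrightarrow> a * b \<in> S"
    "1 \<in> S" "\<And>c. h c \<in> S" "\<And>v. v \<in> V \<Longrightarrow> x v \<in> S" "(f :: ('v, 'k) mpoly) \<in> mpolys V"
  shows "peval h x f \<in> S"
proof -
  have S: "sum g A \<in> S" if "\<And>a. a \<in> A \<Longrightarrow> g a \<in> S" for g :: "('v \<Rightarrow>\<^sub>0 nat) \<Rightarrow> 'r" and A
    using that by (induction A rule: infinite_finite_induct) (auto simp: assms)
  have P: "prod g A \<in> S" if "\<And>a. a \<in> A \<Longrightarrow> g a \<in> S" for g :: "'v \<Rightarrow> 'r" and A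
    using that by (induction A rule: infinite_finite_induct) (auto simp: assms)
  have W: "a ^ k \<in> S" if "a \<in> S" for a k
    using that by (induction k) (auto simp: assms)
  show ?thesis
    unfolding peval_def mon_eval_def using assms(6,7)
    by (intro S assms P W) (auto simp: mpolys_def)
qed

lemma Const_in_mpolys: "Const c \<in> mpolys V"
  by (simp add: Const_def mpolys_def)

lemma Var_in_mpolys_iff: "(Var v :: ('v, 'k::zero_neq_one) mpoly) \<in> mpolys V \<longleftrightarrow> v \<in> V"
  by (simp add: Var_def mpolys_def)

lemma peval_in_mpolys:
  fixes h :: "'k::comm_ring_1 \<Rightarrow> ('w, 'l::comm_ring_1) mpoly"
  assumes "f \<in> mpolys V" "\<And>c. h c \<in> mpolys W" "\<And>v. v \<in> V \<Longrightarrow> x v \<in> mpolys W"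
  shows "peval h x f \<in> mpolys W"
  by (rule peval_in[where V = V]) (auto simp: mpolys_zero mpolys_add mpolys_mult mpolys_one assms)

lemma mpolys_mono: "V \<subseteq> W \<Longrightarrow> f \<in> mpolys V \<Longrightarrow> f \<in> mpolys W"
  by (auto simp: mpolys_def)

lemma mpolys_UNIV: "f \<in> mpolys UNIV"
  by (auto simp: mpolys_def)

lemma mpolys_minus: "f \<in> mpolys V \<Longrightarrow> - f \<in> mpolys V" for f :: "('v, 'k::comm_ring_1) mpoly"
  by (simp add: mpolys_def in_keys_iff)

lemma mpolys_diff: "f \<in> mpolys V \<Longrightarrow> g \<in> mpolys V \<Longrightarrow> f - g \<in> mpolys V" for f :: "('v, 'k::comm_ring_1) mpoly"
  using mpolys_add[OF _ mpolys_minus, of f V g] by simp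

lemma mpolys_sum: "(\<And>a. a \<in> A \<Longrightarrow> f a \<in> mpolys V) \<Longrightarrow> sum f A \<in> mpolys V"
  by (induction A rule: infinite_finite_induct) (auto simp: mpolys_zero mpolys_add)

lemma finite_vars: "\<exists>A. finite A \<and> f \<in> mpolys A"
  by (rule exI[of _ "\<Union>\<alpha>\<in>Poly_Mapping.keys f. Poly_Mapping.keys \<alpha>"]) (auto simp: mpolys_def)

text \<open>The isomorphism of k[x] with the polynomials in x_a over the other variables. It drives
  inductions on the number of variables and isolates the last element in an algebraic
  relation.\<close>

definition unpack :: "'v \<Rightarrow> ('v, 'k::comm_ring_1) mpoly \<Rightarrow> ('v, 'k) mpoly poly" where
  "unpack a = peval (\<lambda>c. [:Const c:]) (\<lambda>v. if v = a then [:0, 1:] else [:Var v:])"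

lemma ring_map_Const_poly: "ring_map (\<lambda>c. [:Const c:])"
  using ring_map_comp[OF ring_map_const_poly ring_map_Const] by (simp add: o_def)

lemma poly_unpack: "ring_map h \<Longrightarrow> poly (map_poly (peval h x) (unpack a f)) y = peval h (x(a := y)) f"
proof -
  assume h: "ring_map h"
  have "ring_map (\<lambda>p. poly (map_poly (peval h x) p) y)"
    using ring_map_comp[OF ring_map_poly ring_map_map_poly[OF ring_map_peval[OF h]]] by (simp add: o_def)
  note comp = peval_comp[OF this, of "\<lambda>c. [:Const c:]" "\<lambda>v. if v = a then [:0, 1:] else [:Var v:]" f]
  have 1: "(\<lambda>c. poly (map_poly (peval h x) [:Const c:]) y) = h"
    using h by (intro ext) (simp add: map_poly_pCons ring_mapD[OF ring_map_peval[OF h]] peval_Const)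
  have 2: "(\<lambda>v. poly (map_poly (peval h x) (if v = a then [:0, 1:] else [:Var v:])) y) = x(a := y)"
    using h by (intro ext) (simp add: map_poly_pCons ring_mapD[OF ring_map_peval[OF h]] peval_Var)
  show ?thesis using comp unfolding unpack_def 1 2 .
qed

text \<open>Substituting x_a back for the polynomial variable returns \<open>f\<close>.\<close>

lemma unpack_inj: "unpack a f = 0 \<Longrightarrow> f = 0"
  using poly_unpack[OF ring_map_Const, of Var a f "Var a"] by (simp add: peval_Const_Var)

lemma coeff_unpack_in_mpolys:
  assumes "f \<in> mpolys (insert a A)"
  shows "poly.coeff (unpack a f) i \<in> mpolys A"
proof -
  let ?S = "{p :: ('a, 'b) mpoly poly. \<forall>i. poly.coeff p i \<in> mpolys A}"
  have "unpack a f \<in> ?S"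
    unfolding unpack_def
  proof (rule peval_in[OF _ _ _ _ _ _ assms])
    fix p q assume "p \<in> ?S" "q \<in> ?S"
    then show "p * q \<in> ?S"
      by (auto simp: coeff_mult intro!: mpolys_sum mpolys_mult)
  qed (auto simp: mpolys_zero mpolys_one mpolys_add coeff_1 coeff_pCons Const_in_mpolys Var_in_mpolys_iff
      split: nat.splits)
  then show ?thesis by simp
qed

text \<open>Values come from a prescribed infinite set because generic choices over C(t) have to be
  made with complex constants. Some coefficient with respect to x_a is nonzero; the induction keeps
  it nonzero, and then x_a has only finitely many roots to avoid.\<close>

lemma mpoly_nonvanishing:
  fixes f :: "('v, 'k::idom) mpoly"
  assumes "infinite D" "f \<noteq> 0"
  shows "\<exists>c. (\<forall>v. c v \<in> D) \<and> mpoly_eval f c \<noteq> 0"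
proof -
  obtain A where A: "finite A" "f \<in> mpolys A" using finite_vars by blast
  then show ?thesis using assms(2)
  proof (induction A arbitrary: f rule: finite_induct)
    case empty
    have "Poly_Mapping.lookup f \<alpha> = 0" if "\<alpha> \<noteq> 0" for \<alpha>
    proof (rule ccontr)
      assume "Poly_Mapping.lookup f \<alpha> \<noteq> 0"
      then have "Poly_Mapping.keys \<alpha> = {}" using empty(1) by (simp add: mpolys_def in_keys_iff)
      then show False using that by simp
    qed
    then have f: "f = Const (Poly_Mapping.lookup f 0)"
      by (intro poly_mapping_eqI) (simp add: Const_def lookup_single when_def)
    then have "Poly_Mapping.lookup f 0 \<noteq> 0" using empty(2) by (metis Const_simps(1))
    then have "mpoly_eval f c \<noteq> 0" for c by (subst f) (simp add: mpoly_eval_Const)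
    moreover have "D \<noteq> {}" using assms(1) by auto
    then obtain d where "d \<in> D" by blast
    ultimately show ?case by (intro exI[of _ "\<lambda>_. d"]) simp
  next
    case (insert a A)
    have "unpack a f \<noteq> 0" using insert.prems(2) unpack_inj[of a f] by (rule contrapos_nn)
    then obtain i where i: "poly.coeff (unpack a f) i \<noteq> 0"
      by (metis leading_coeff_0_iff)
    from insert.IH[OF coeff_unpack_in_mpolys[OF insert.prems(1)] this] obtain c where
      c: "\<forall>v. c v \<in> D" "mpoly_eval (poly.coeff (unpack a f) i) c \<noteq> 0" by (elim exE conjE)
    define q where "q = map_poly (peval (\<lambda>c. c) c) (unpack a f)"
    have "poly.coeff q i \<noteq> 0" using c(2)
      by (simp add: q_def coeff_map_poly_ring ring_map_peval ring_map_id mpoly_eval_eq_peval)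
    then have "q \<noteq> 0" by auto
    then have "finite {x. poly q x = 0}" by (rule poly_roots_finite)
    then have "\<not> D \<subseteq> {x. poly q x = 0}" using assms(1) finite_subset by blast
    then obtain y where "y \<in> D" "poly q y \<noteq> 0" by blast
    moreover have "poly q y = mpoly_eval f (c(a := y))"
      unfolding q_def mpoly_eval_eq_peval by (rule poly_unpack[OF ring_map_id])
    ultimately have "(\<forall>v. (c(a := y)) v \<in> D) \<and> mpoly_eval f (c(a := y)) \<noteq> 0"
      using c(1) by simp
    then show ?case by (rule exI[of _ "c(a := y)"])
  qed
qed

text \<open>Gaussian elimination, with index sets for unknowns and equations since these will be
  sets of exponents.\<close>

lemma more_unknowns_than_equations:
  fixes c :: "'d \<Rightarrow> 'b \<Rightarrow> 'k::field"
  assumes "finite B" "finite D" "card B < card D"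
  shows "\<exists>l. (\<exists>d\<in>D. l d \<noteq> 0) \<and> (\<forall>b\<in>B. (\<Sum>d\<in>D. l d * c d b) = 0)"
  using assms
proof (induction B arbitrary: D c rule: finite_induct)
  case empty
  then have "D \<noteq> {}" by auto
  then show ?case by (intro exI[of _ "\<lambda>_. 1"]) auto
next
  case (insert b B)
  show ?case
  proof (cases "\<forall>d\<in>D. c d b = 0")
    case True
    have "card B < card D" using insert by simp
    from insert.IH[OF insert.prems(1) this] obtain l where
      "\<exists>d\<in>D. l d \<noteq> 0" "\<forall>b\<in>B. (\<Sum>d\<in>D. l d * c d b) = 0" by blast
    then show ?thesis using True by (intro exI[of _ l]) auto
  next
    case False
    then obtain p where p: "p \<in> D" "c p b \<noteq> 0" by blast
    \<comment> \<open>Unknown \<open>p\<close> is the pivot for equation \<open>b\<close>, and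
      \<open>c'\<close> is the system after eliminating it. Up to sign, \<open>m\<close> is the
      value that equation \<open>b\<close> forces on the pivot.\<close>
    define c' where "c' d e = c d e - c d b / c p b * c p e" for d e
    have "card B < card (D - {p})" using insert p by simp
    from insert.IH[OF _ this, of c'] insert.prems obtain l where
      l: "\<exists>d\<in>D - {p}. l d \<noteq> 0" "\<forall>b\<in>B. (\<Sum>d\<in>D - {p}. l d * c' d b) = 0" by auto
    define m where "m = (\<Sum>d\<in>D - {p}. l d * c d b) / c p b"
    define l' where "l' = l(p := - m)"
    have s: "(\<Sum>d\<in>D. l' d * c d e) = (\<Sum>d\<in>D - {p}. l d * c d e) - m * c p e" for e
    proof -
      have "(\<Sum>d\<in>D. l' d * c d e) = l' p * c p e + (\<Sum>d\<in>D - {p}. l' d * c d e)"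
        using insert.prems p by (simp add: sum.remove)
      also have "(\<Sum>d\<in>D - {p}. l' d * c d e) = (\<Sum>d\<in>D - {p}. l d * c d e)"
        by (rule sum.cong) (auto simp: l'_def)
      finally show ?thesis by (simp add: l'_def)
    qed
    have "(\<Sum>d\<in>D - {p}. l d * c d e) - m * c p e = (\<Sum>d\<in>D - {p}. l d * c' d e)" for e
      by (simp add: m_def c'_def algebra_simps sum_subtractf sum_distrib_left sum_distrib_right sum_divide_distrib)
    with s l(2) have "\<forall>e\<in>B. (\<Sum>d\<in>D. l' d * c d e) = 0" by simp
    moreover have "(\<Sum>d\<in>D. l' d * c d b) = 0" using p by (simp add: s m_def)
    moreover have "\<exists>d\<in>D. l' d \<noteq> 0" using l(1) by (auto simp: l'_def)
    ultimately show ?thesis by blast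
  qed
qed

subsection \<open>Homogeneous components and ideals\<close>

lemma mon_eval_scale: "mon_eval \<alpha> (\<lambda>v. c * x v) = c ^ mon_degree \<alpha> * mon_eval \<alpha> x"
  by (simp add: mon_eval_def mon_degree_def power_mult_distrib prod.distrib power_sum)

text \<open>Replacing each x_v by T x_v puts the component of degree s in front of T^s. Since this
  is a ring homomorphism, the rules for \<open>hom_part\<close> of sums and products are those for
  coefficients.\<close>

definition gradation :: "('v, 'k::comm_ring_1) mpoly \<Rightarrow> ('v, 'k) mpoly poly" where
  "gradation = peval (\<lambda>c. [:Const c:]) (\<lambda>v. [:0, 1:] * [:Var v:])"

lemma ring_map_gradation: "ring_map gradation"
  unfolding gradation_def by (rule ring_map_peval[OF ring_map_Const_poly])

lemma pX_power: "[:0, 1:] ^ n = Polynomial.monom (1 :: 'a::comm_ring_1) n"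
  by (simp add: monom_altdef)

lemma coeff_gradation: "poly.coeff (gradation f) s = hom_part s f"
proof -
  have m: "mon_eval \<alpha> (\<lambda>v. [:0, 1:] * [:Var v:]) =
      Polynomial.monom (Poly_Mapping.single \<alpha> (1::'b)) (mon_degree \<alpha>)" for \<alpha> :: "'a \<Rightarrow>\<^sub>0 nat"
  proof -
    have "mon_eval \<alpha> (\<lambda>v. [:Var v:]) = [:Poly_Mapping.single \<alpha> (1::'b):]"
      using ring_map_mon_eval[OF ring_map_const_poly, of \<alpha> "Var :: _ \<Rightarrow> ('a, 'b) mpoly"]
      by (simp add: mon_eval_Var)
    then show ?thesis unfolding mon_eval_scale pX_power by (simp only: mult.commute[of "Polynomial.monom 1 _"]) (simp add: smult_monom)
  qed
  have t: "poly.coeff ([:Const c:] * Polynomial.monom (Poly_Mapping.single \<alpha> 1) k) s =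
      (if k = s then Poly_Mapping.single \<alpha> c else 0)" for c :: 'b and \<alpha> :: "'a \<Rightarrow>\<^sub>0 nat" and k
    by (simp add: Const_def mult_single)
  have "poly.coeff (gradation f) s = (\<Sum>\<alpha>\<in>Poly_Mapping.keys f. if mon_degree \<alpha> = s
      then Poly_Mapping.single \<alpha> (Poly_Mapping.lookup f \<alpha>) else 0)"
    unfolding gradation_def peval_def m coeff_sum t ..
  also have "\<dots> = hom_part s f"
    unfolding hom_part_def by (subst sum.inter_filter[symmetric]) simp_all
  finally show ?thesis .
qed

lemma hom_part_add: "hom_part s (f + g) = hom_part s f + hom_part s g"
  for f g :: "('v, 'k::comm_ring_1) mpoly"
  by (simp add: coeff_gradation[symmetric] ring_mapD[OF ring_map_gradation])

lemma hom_part_diff: "hom_part s (f - g) = hom_part s f - hom_part s g"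
  for f g :: "('v, 'k::comm_ring_1) mpoly"
  by (simp add: coeff_gradation[symmetric] ring_map_diff[OF ring_map_gradation])

lemma hom_part_0: "hom_part s (0 :: ('v, 'k::comm_ring_1) mpoly) = 0"
  by (simp add: coeff_gradation[symmetric] ring_mapD[OF ring_map_gradation])

lemma hom_part_sum: "hom_part s (sum f A) = (\<Sum>a\<in>A. hom_part s (f a :: ('v, 'k::comm_ring_1) mpoly))"
  by (simp add: coeff_gradation[symmetric] ring_map_sum[OF ring_map_gradation] coeff_sum)

lemma hom_part_mult: "hom_part s (f * g) = (\<Sum>i\<le>s. hom_part i f * hom_part (s - i) g)"
  for f g :: "('v, 'k::comm_ring_1) mpoly"
  by (simp add: coeff_gradation[symmetric] ring_mapD[OF ring_map_gradation] coeff_mult)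

lemma lookup_hom_part:
  "Poly_Mapping.lookup (hom_part s f) \<alpha> = (if mon_degree \<alpha> = s then Poly_Mapping.lookup f \<alpha> else 0)"
proof -
  have "Poly_Mapping.lookup (hom_part s f) \<alpha> = (\<Sum>\<beta> | \<beta> \<in> Poly_Mapping.keys f \<and> mon_degree \<beta> = s.
      if \<beta> = \<alpha> then Poly_Mapping.lookup f \<alpha> else 0)"
    unfolding hom_part_def lookup_sum by (rule sum.cong) (auto simp: lookup_single when_def)
  then show ?thesis by (auto simp: sum.delta in_keys_iff)
qed

lemma keys_hom_part: "Poly_Mapping.keys (hom_part s f) = {\<alpha> \<in> Poly_Mapping.keys f. mon_degree \<alpha> = s}"
  by (auto simp: in_keys_iff lookup_hom_part split: if_splits)

lemma homogeneous_hom_part: "homogeneous s (hom_part s f)"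
  by (simp add: homogeneous_def keys_hom_part)

lemma hom_part_in_mpolys: "f \<in> mpolys V \<Longrightarrow> hom_part s f \<in> mpolys V"
  by (simp add: mpolys_def keys_hom_part)

lemma hom_part_homogeneous: "homogeneous d f \<Longrightarrow> hom_part s f = (if s = d then f else 0)"
  by (rule poly_mapping_eqI) (auto simp: lookup_hom_part homogeneous_def in_keys_iff)

lemma hom_part_mult_homogeneous:
  fixes f g :: "('v, 'k::comm_ring_1) mpoly"
  assumes "homogeneous d g"
  shows "hom_part s (f * g) = (if d \<le> s then hom_part (s - d) f * g else 0)"
proof -
  have "hom_part s (f * g) = (\<Sum>i\<le>s. if i = s - d \<and> d \<le> s then hom_part (s - d) f * g else 0)"
    unfolding hom_part_mult by (rule sum.cong) (auto simp: hom_part_homogeneous[OF assms])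
  then show ?thesis by (auto simp: sum.delta)
qed

text \<open>Setting T = 1 in \<open>gradation f\<close> returns \<open>f\<close>.\<close>

lemma sum_hom_part:
  fixes f :: "('v, 'k::comm_ring_1) mpoly"
  obtains N where "f = (\<Sum>s\<le>N. hom_part s f)"
proof
  let ?h = "\<lambda>p. poly p (1 :: ('v, 'k) mpoly)"
  have "?h (gradation f) = f"
    unfolding gradation_def peval_comp[OF ring_map_poly]
    by (simp add: peval_Const_Var)
  then show "f = (\<Sum>s\<le>degree (gradation f). hom_part s f)"
    by (simp add: poly_altdef coeff_gradation)
qed

lemma hom_part_nonzero: "f \<noteq> 0 \<Longrightarrow> \<exists>s. hom_part s f \<noteq> 0" for f :: "('v, 'k::comm_ring_1) mpoly"
  by (metis sum_hom_part sum.neutral)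

lemma homogeneous_add: "homogeneous d f \<Longrightarrow> homogeneous d g \<Longrightarrow> homogeneous d (f + g)"
  using keys_add[of f g] by (auto simp: homogeneous_def)

lemma homogeneous_0: "homogeneous d 0"
  by (simp add: homogeneous_def)

lemma homogeneous_sum: "(\<And>a. a \<in> A \<Longrightarrow> homogeneous d (f a)) \<Longrightarrow> homogeneous d (sum f A)"
  by (induction A rule: infinite_finite_induct) (auto simp: homogeneous_0 homogeneous_add)

lemma homogeneous_Const: "homogeneous 0 (Const c)"
  by (simp add: homogeneous_def Const_def mon_degree_def)

lemma mon_degree_single: "mon_degree (Poly_Mapping.single v k) = k"
  by (simp add: mon_degree_def)

lemma homogeneous_Var: "homogeneous 1 (Var v :: ('v, 'k::zero_neq_one) mpoly)"
  by (simp add: homogeneous_def Var_def mon_degree_single)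

lemma homogeneous_Const_mult: "homogeneous d f \<Longrightarrow> homogeneous d (Const c * f)"
  for f :: "('v, 'k::comm_ring_1) mpoly"
  using homogeneous_mult[OF homogeneous_Const, of d f c] by simp

lemma homogeneous_diff: "homogeneous d f \<Longrightarrow> homogeneous d g \<Longrightarrow> homogeneous d (f - g)"
  for f g :: "('v, 'k::comm_ring_1) mpoly"
  using homogeneous_add[OF _ homogeneous_Const_mult, of d f g "-1"]
  by (simp add: Const_simps)

lemma homogeneous_power: "homogeneous d f \<Longrightarrow> homogeneous (d * k) (f ^ k)"
  for f :: "('v, 'k::comm_ring_1) mpoly"
  by (induction k) (auto simp: homogeneous_one homogeneous_mult)

lemma homogeneous_mon_eval:
  assumes "\<And>v. v \<in> Poly_Mapping.keys \<alpha> \<Longrightarrow> homogeneous 1 (x v :: ('v, 'k::comm_ring_1) mpoly)"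
  shows "homogeneous (mon_degree \<alpha>) (mon_eval \<alpha> x)"
proof -
  have "homogeneous (\<Sum>v\<in>A. k v) (\<Prod>v\<in>A. x v ^ k v)" if "A \<subseteq> Poly_Mapping.keys \<alpha>" for A k
  proof -
    have "finite A" using that finite_subset finite_keys by blast
    then show ?thesis using that
      by (induction A rule: finite_induct)
        (auto simp: homogeneous_one intro!: homogeneous_mult homogeneous_power[of 1, simplified] assms[unfolded One_nat_def])
  qed
  then show ?thesis by (simp add: mon_eval_def mon_degree_def)
qed

lemma homogeneous_peval:
  fixes x :: "'w \<Rightarrow> ('v, 'k::comm_ring_1) mpoly"
  assumes "homogeneous d f" "f \<in> mpolys V" "\<And>v. v \<in> V \<Longrightarrow> homogeneous 1 (x v)" "\<And>c. homogeneous 0 (h c)"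
  shows "homogeneous d (peval h x f)"
  unfolding peval_def
proof (rule homogeneous_sum)
  fix \<alpha> assume \<alpha>: "\<alpha> \<in> Poly_Mapping.keys f"
  have "homogeneous (mon_degree \<alpha>) (mon_eval \<alpha> x)"
    using \<alpha> assms(2,3) by (intro homogeneous_mon_eval) (auto simp: mpolys_def)
  with homogeneous_mult[OF assms(4) this] show "homogeneous d (h (Poly_Mapping.lookup f \<alpha>) * mon_eval \<alpha> x)"
    using \<alpha> assms(1) by (auto simp: homogeneous_def)
qed

text \<open>Linear substitutions preserve degrees. This is what makes relations between linear forms
  homogeneous.\<close>

lemma hom_part_peval:
  fixes x :: "'w \<Rightarrow> ('v, 'k::comm_ring_1) mpoly"
  assumes "f \<in> mpolys V" "\<And>v. v \<in> V \<Longrightarrow> homogeneous 1 (x v)" "\<And>c. homogeneous 0 (h c)" "ring_map h"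
  shows "hom_part s (peval h x f) = peval h x (hom_part s f)"
proof -
  obtain N where N: "f = (\<Sum>s\<le>N. hom_part s f)" by (rule sum_hom_part)
  have hh: "homogeneous t (peval h x (hom_part t f))" for t
    by (rule homogeneous_peval[OF homogeneous_hom_part hom_part_in_mpolys[OF assms(1)] assms(2,3)])
  have "hom_part s (peval h x f) = (\<Sum>t\<le>N. hom_part s (peval h x (hom_part t f)))"
    by (subst N) (simp add: peval_sum assms hom_part_sum)
  also have "\<dots> = (\<Sum>t\<le>N. peval h x (hom_part s (hom_part t f)))"
    by (rule sum.cong[OF refl])
      (auto simp: hom_part_homogeneous[OF hh] hom_part_homogeneous[OF homogeneous_hom_part]
        ring_mapD[OF ring_map_peval[OF assms(4)]])
  also have "\<dots> = peval h x (hom_part s f)"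
    by (subst (2) N) (simp add: peval_sum assms hom_part_sum)
  finally show ?thesis .
qed

definition is_ideal :: "'a::comm_ring_1 set \<Rightarrow> bool" where
  "is_ideal I \<longleftrightarrow> 0 \<in> I \<and> (\<forall>a\<in>I. \<forall>b\<in>I. a + b \<in> I) \<and> (\<forall>a\<in>I. \<forall>r. r * a \<in> I)"

definition is_prime :: "'a::comm_ring_1 set \<Rightarrow> bool" where
  "is_prime I \<longleftrightarrow> is_ideal I \<and> 1 \<notin> I \<and> (\<forall>a b. a * b \<in> I \<longrightarrow> a \<in> I \<or> b \<in> I)"

definition hom_ideal :: "('v, 'k::comm_ring_1) mpoly set \<Rightarrow> bool" where
  "hom_ideal I \<longleftrightarrow> is_ideal I \<and> (\<forall>f\<in>I. \<forall>s. hom_part s f \<in> I)"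

lemma is_idealI:
  "0 \<in> I \<Longrightarrow> (\<And>a b. a \<in> I \<Longrightarrow> b \<in> I \<Longrightarrow> a + b \<in> I) \<Longrightarrow> (\<And>a r. a \<in> I \<Longrightarrow> r * a \<in> I) \<Longrightarrow> is_ideal I"
  by (simp add: is_ideal_def)

lemma is_idealD:
  assumes "is_ideal I"
  shows "0 \<in> I" "a \<in> I \<Longrightarrow> b \<in> I \<Longrightarrow> a + b \<in> I" "a \<in> I \<Longrightarrow> r * a \<in> I" "a \<in> I \<Longrightarrow> a * r \<in> I"
    "a \<in> I \<Longrightarrow> - a \<in> I" "a \<in> I \<Longrightarrow> b \<in> I \<Longrightarrow> a - b \<in> I"
proof -
  show n: "- a \<in> I" if "a \<in> I" for a
    using assms that unfolding is_ideal_def by (metis mult_minus1)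
  show "a - b \<in> I" if "a \<in> I" "b \<in> I"
    using assms that n[OF that(2)] unfolding is_ideal_def by (metis uminus_add_conv_diff add.commute)
qed (use assms in \<open>auto simp: is_ideal_def mult.commute[of _ r]\<close>)

lemma ideal_sum: "is_ideal I \<Longrightarrow> (\<And>a. a \<in> A \<Longrightarrow> f a \<in> I) \<Longrightarrow> sum f A \<in> I"
  by (induction A rule: infinite_finite_induct) (auto simp: is_idealD)

lemma ideal_cong_trans: "is_ideal I \<Longrightarrow> a - b \<in> I \<Longrightarrow> b - c \<in> I \<Longrightarrow> a - c \<in> I"
  using is_idealD(2)[of I "a - b" "b - c"] by simp

lemma ideal_cong_mem: "is_ideal I \<Longrightarrow> a - b \<in> I \<Longrightarrow> a \<in> I \<longleftrightarrow> b \<in> I"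
  using is_idealD(2)[of I "a - b" b] is_idealD(6)[of I a "a - b"] by auto

lemma ideal_cong_add: "is_ideal I \<Longrightarrow> a - b \<in> I \<Longrightarrow> c - d \<in> I \<Longrightarrow> (a + c) - (b + d) \<in> I"
  using is_idealD(2)[of I "a - b" "c - d"] by (simp add: algebra_simps)

lemma ideal_cong_mult:
  assumes "is_ideal I" "a - b \<in> I" "c - d \<in> I" shows "a * c - b * d \<in> I"
proof -
  have "a * c - b * d = c * (a - b) + b * (c - d)" by (simp add: algebra_simps)
  then show ?thesis using assms by (simp add: is_idealD)
qed

lemma ideal_cong_power: "is_ideal I \<Longrightarrow> a - b \<in> I \<Longrightarrow> a ^ n - b ^ n \<in> I"
  by (induction n) (simp_all add: is_idealD ideal_cong_mult)

lemma ideal_cong_prod: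
  "is_ideal I \<Longrightarrow> (\<And>i. i \<in> A \<Longrightarrow> f i - g i \<in> I) \<Longrightarrow> prod f A - prod g A \<in> I"
  by (induction A rule: infinite_finite_induct) (simp_all add: is_idealD ideal_cong_mult)

lemma ideal_cong_peval:
  assumes "is_ideal I" "f \<in> mpolys V" "\<And>v. v \<in> V \<Longrightarrow> x v - y v \<in> I"
  shows "peval h x f - peval h y f \<in> I"
  unfolding peval_def mon_eval_def sum_subtractf[symmetric] right_diff_distrib[symmetric]
  using assms(2)
  by (intro ideal_sum is_idealD(3) ideal_cong_prod ideal_cong_power assms) (auto simp: mpolys_def)

lemma is_primeD:
  assumes "is_prime P"
  shows "is_ideal P" "1 \<notin> P" "a * b \<in> P \<Longrightarrow> a \<in> P \<or> b \<in> P"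
  using assms by (auto simp: is_prime_def)

lemma is_prime_power: "is_prime P \<Longrightarrow> a ^ n \<in> P \<Longrightarrow> a \<in> P"
  by (induction n) (auto simp: is_prime_def)

lemma hom_idealD:
  assumes "hom_ideal I" shows "is_ideal I" "f \<in> I \<Longrightarrow> hom_part s f \<in> I"
  using assms by (auto simp: hom_ideal_def)

lemma hom_ideal_mem_iff:
  assumes "hom_ideal I" shows "f \<in> I \<longleftrightarrow> (\<forall>s. hom_part s f \<in> I)"
proof
  assume *: "\<forall>s. hom_part s f \<in> I"
  obtain N where "f = (\<Sum>s\<le>N. hom_part s f)" by (rule sum_hom_part)
  then show "f \<in> I" using ideal_sum[OF hom_idealD(1)[OF assms], of "{..N}" "\<lambda>s. hom_part s f"] * by simp
qed (use assms in \<open>auto simp: hom_ideal_def\<close>)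

text \<open>If neither factor lies in \<open>I\<close>, take the lowest components outside
  \<open>I\<close>, of degrees s and r. In degree s + r of the product every other term has a factor
  of lower degree lying in \<open>I\<close>, so the product of these two components lies in
  \<open>I\<close>.\<close>

lemma hom_ideal_is_primeI:
  assumes I: "hom_ideal I" and "1 \<notin> I"
    and prime: "\<And>f g s r. homogeneous s f \<Longrightarrow> homogeneous r g \<Longrightarrow> f * g \<in> I \<Longrightarrow> f \<in> I \<or> g \<in> I"
  shows "is_prime I"
  unfolding is_prime_def
proof (intro conjI allI impI)
  fix f g assume fg: "f * g \<in> I"
  show "f \<in> I \<or> g \<in> I"
  proof (rule ccontr)
    assume "\<not> (f \<in> I \<or> g \<in> I)"
    then have ex: "\<exists>s. hom_part s f \<notin> I" "\<exists>s. hom_part s g \<notin> I"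
      using hom_ideal_mem_iff[OF I, of f] hom_ideal_mem_iff[OF I, of g] by blast+
    define s where "s = (LEAST s. hom_part s f \<notin> I)"
    define r where "r = (LEAST s. hom_part s g \<notin> I)"
    have s: "hom_part s f \<notin> I" "\<And>i. i < s \<Longrightarrow> hom_part i f \<in> I"
      unfolding s_def using LeastI_ex[OF ex(1)] not_less_Least[of _ "\<lambda>s. hom_part s f \<notin> I"] by blast+
    have r: "hom_part r g \<notin> I" "\<And>i. i < r \<Longrightarrow> hom_part i g \<in> I"
      unfolding r_def using LeastI_ex[OF ex(2)] not_less_Least[of _ "\<lambda>s. hom_part s g \<notin> I"] by blast+
    have "hom_part (s + r) (f * g) = hom_part s f * hom_part r g
        + (\<Sum>i\<in>{..s + r} - {s}. hom_part i f * hom_part (s + r - i) g)"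
      using sum.remove[of "{..s + r}" s "\<lambda>i. hom_part i f * hom_part (s + r - i) g"]
      by (simp add: hom_part_mult)
    moreover have "(\<Sum>i\<in>{..s + r} - {s}. hom_part i f * hom_part (s + r - i) g) \<in> I"
    proof (rule ideal_sum[OF hom_idealD(1)[OF I]])
      fix i assume "i \<in> {..s + r} - {s}"
      then have "i < s \<or> s + r - i < r" by auto
      then show "hom_part i f * hom_part (s + r - i) g \<in> I"
        by (auto intro: is_idealD(3,4)[OF hom_idealD(1)[OF I]] s(2) r(2))
    qed
    moreover have "hom_part (s + r) (f * g) \<in> I" using I fg by (rule hom_idealD(2))
    ultimately have "hom_part s f * hom_part r g \<in> I"
      using ideal_cong_mem[OF hom_idealD(1)[OF I], of "hom_part (s + r) (f * g)" "hom_part s f * hom_part r g"]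
      by simp
    from prime[OF homogeneous_hom_part homogeneous_hom_part this] show False
      using s(1) r(1) by simp
  qed
qed (use hom_idealD(1)[OF I] \<open>1 \<notin> I\<close> in simp_all)

text \<open>For an ideal \<open>I\<close>, the ideal I + (l a | a in A). Keeping \<open>I\<close>
  apart from the generators turns membership into one congruence modulo \<open>I\<close> from which
  the cofactors \<open>h\<close> can be read off.\<close>

definition gen_ideal :: "'a::comm_ring_1 set \<Rightarrow> ('i \<Rightarrow> 'a) \<Rightarrow> 'i set \<Rightarrow> 'a set" where
  "gen_ideal I l A = {f. \<exists>h. f - (\<Sum>a\<in>A. h a * l a) \<in> I}"

lemma gen_ideal_is_ideal: "is_ideal I \<Longrightarrow> is_ideal (gen_ideal I l A)"
proof (rule is_idealI)
  assume I: "is_ideal I"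
  show "0 \<in> gen_ideal I l A"
    using I by (auto simp: gen_ideal_def is_idealD intro!: exI[of _ "\<lambda>_. 0"])
  fix f g r assume "f \<in> gen_ideal I l A"
  then obtain h where h: "f - (\<Sum>a\<in>A. h a * l a) \<in> I" by (auto simp: gen_ideal_def)
  show "r * f \<in> gen_ideal I l A"
    unfolding gen_ideal_def
  proof (intro CollectI exI)
    show "r * f - (\<Sum>a\<in>A. (r * h a) * l a) \<in> I"
      using is_idealD(3)[OF I h, of r] by (simp add: right_diff_distrib sum_distrib_left mult.assoc)
  qed
  assume "g \<in> gen_ideal I l A"
  then obtain h' where h': "g - (\<Sum>a\<in>A. h' a * l a) \<in> I" by (auto simp: gen_ideal_def)
  show "f + g \<in> gen_ideal I l A"
    unfolding gen_ideal_def
  proof (intro CollectI exI)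
    show "f + g - (\<Sum>a\<in>A. (h a + h' a) * l a) \<in> I"
      using ideal_cong_add[OF I h h'] by (simp add: distrib_right sum.distrib)
  qed
qed

lemma subset_gen_ideal: "f \<in> I \<Longrightarrow> f \<in> gen_ideal I l A"
  by (auto simp: gen_ideal_def intro!: exI[of _ "\<lambda>_. 0"])

lemma gen_ideal_gen:
  assumes "is_ideal I" "finite A" "a \<in> A" shows "l a \<in> gen_ideal I l A"
proof -
  have "(\<Sum>i\<in>A. (if i = a then 1 else 0) * l i) = (\<Sum>i\<in>A. if i = a then l i else 0)"
    by (rule sum.cong) auto
  also have "\<dots> = l a" using assms(2,3) by simp
  finally have "l a - (\<Sum>i\<in>A. (if i = a then 1 else 0) * l i) \<in> I"
    using is_idealD(1)[OF assms(1)] by (simp only: diff_self)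
  then show ?thesis
    unfolding gen_ideal_def by (intro CollectI exI[of _ "\<lambda>i. if i = a then 1 else 0"])
qed

lemma gen_ideal_least:
  assumes "f \<in> gen_ideal I l A" "is_ideal J" "\<And>f. f \<in> I \<Longrightarrow> f \<in> J" "\<And>a. a \<in> A \<Longrightarrow> l a \<in> J"
  shows "f \<in> J"
proof -
  obtain h where "f - (\<Sum>a\<in>A. h a * l a) \<in> I" using assms(1) by (auto simp: gen_ideal_def)
  then have "f - (\<Sum>a\<in>A. h a * l a) \<in> J" by (rule assms)
  moreover have "(\<Sum>a\<in>A. h a * l a) \<in> J"
    using assms by (intro ideal_sum is_idealD(3)) auto
  ultimately show ?thesis using ideal_cong_mem[OF assms(2)] by blast
qed

lemma hom_ideal_gen_ideal:
  assumes I: "hom_ideal I" and l: "\<And>a. a \<in> A \<Longrightarrow> homogeneous 1 (l a)"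
  shows "hom_ideal (gen_ideal I l A)"
  unfolding hom_ideal_def
proof (intro conjI ballI allI)
  show J: "is_ideal (gen_ideal I l A)" using I by (simp add: gen_ideal_is_ideal hom_idealD)
  fix f s assume "f \<in> gen_ideal I l A"
  then obtain h where "f - (\<Sum>a\<in>A. h a * l a) \<in> I" by (auto simp: gen_ideal_def)
  then have "hom_part s f - (\<Sum>a\<in>A. hom_part s (h a * l a)) \<in> I"
    using hom_idealD(2)[OF I] by (metis hom_part_diff hom_part_sum)
  moreover have "(\<Sum>a\<in>A. hom_part s (h a * l a)) = (\<Sum>a\<in>A. (if 1 \<le> s then hom_part (s - 1) (h a) else 0) * l a)"
    by (rule sum.cong[OF refl]) (simp add: hom_part_mult_homogeneous[OF l])
  ultimately show "hom_part s f \<in> gen_ideal I l A"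
    by (auto simp: gen_ideal_def)
qed

lemma exists_maximal_disjoint_ideal:
  assumes "is_ideal I" "I \<inter> S = {}"
  shows "\<exists>M. is_ideal M \<and> I \<subseteq> M \<and> M \<inter> S = {} \<and> (\<forall>J. is_ideal J \<and> M \<subseteq> J \<and> J \<inter> S = {} \<longrightarrow> J = M)"
proof -
  let ?A = "{J. is_ideal J \<and> I \<subseteq> J \<and> J \<inter> S = {}}"
  have "\<exists>M\<in>?A. \<forall>X\<in>?A. M \<subseteq> X \<longrightarrow> X = M"
  proof (rule subset_Zorn_nonempty)
    show "?A \<noteq> {}" using assms by blast
    fix C assume C: "C \<noteq> {}" "subset.chain ?A C"
    then have sub: "C \<subseteq> ?A" and lin: "\<And>X Y. X \<in> C \<Longrightarrow> Y \<in> C \<Longrightarrow> X \<subseteq> Y \<or> Y \<subseteq> X"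
      by (auto simp: subset_chain_def)
    have id: "is_ideal X" if "X \<in> C" for X using sub that by auto
    have "is_ideal (\<Union>C)"
    proof (rule is_idealI)
      obtain X where "X \<in> C" using C(1) by blast
      then show "0 \<in> \<Union>C" using is_idealD(1)[OF id] by blast
      show "r * a \<in> \<Union>C" if a: "a \<in> \<Union>C" for a r
      proof -
        obtain X where X: "a \<in> X" "X \<in> C" using a by blast
        then show ?thesis using is_idealD(3)[OF id[OF X(2)] X(1), of r] by blast
      qed
      fix a b assume "a \<in> \<Union>C" "b \<in> \<Union>C"
      then obtain X Y where XY: "a \<in> X" "X \<in> C" "b \<in> Y" "Y \<in> C" by blast
      have "\<exists>Z. a \<in> Z \<and> b \<in> Z \<and> Z \<in> C" using lin[OF XY(2,4)] XY by auto
      then obtain Z where Z: "a \<in> Z" "b \<in> Z" "Z \<in> C" by auto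
      show "a + b \<in> \<Union>C" using is_idealD(2)[OF id[OF Z(3)] Z(1,2)] Z(3) by blast
    qed
    moreover have "I \<subseteq> \<Union>C" "\<Union>C \<inter> S = {}" using C(1) sub by auto
    ultimately show "\<Union>C \<in> ?A" by simp
  qed
  then obtain M where M: "M \<in> ?A" "\<And>X. X \<in> ?A \<Longrightarrow> M \<subseteq> X \<Longrightarrow> X = M" by auto
  show ?thesis
  proof (intro exI[of _ M] conjI allI impI)
    fix J assume "is_ideal J \<and> M \<subseteq> J \<and> J \<inter> S = {}"
    then show "J = M" using M(1) by (intro M(2)) auto
  qed (use M(1) in auto)
qed

lemma gen_ideal_single: "f \<in> gen_ideal I (\<lambda>_. a) {()} \<longleftrightarrow> (\<exists>h. f - h * a \<in> I)"
proof
  assume "\<exists>h. f - h * a \<in> I"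
  then obtain h where "f - h * a \<in> I" ..
  then show "f \<in> gen_ideal I (\<lambda>_. a) {()}"
    unfolding gen_ideal_def by (intro CollectI exI[of _ "\<lambda>_. h"]) simp
qed (auto simp: gen_ideal_def)

text \<open>Krull's argument: an ideal maximal among those missing \<open>S\<close> is prime. If a
  and b lie outside it, some multiples of a and of b are congruent to members of \<open>S\<close>;
  with a b inside, a product of members of \<open>S\<close> would be inside too.\<close>

lemma exists_prime_disjoint:
  assumes "is_ideal I" "I \<inter> S = {}" "1 \<in> S" "\<And>a b. a \<in> S \<Longrightarrow> b \<in> S \<Longrightarrow> a * b \<in> S"
  shows "\<exists>P. is_prime P \<and> I \<subseteq> P \<and> P \<inter> S = {}"
proof -
  from exists_maximal_disjoint_ideal[OF assms(1,2)] obtain M where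
    M: "is_ideal M" "I \<subseteq> M" "M \<inter> S = {}"
    and max': "\<forall>J. is_ideal J \<and> M \<subseteq> J \<and> J \<inter> S = {} \<longrightarrow> J = M"
    by (elim exE conjE)
  have max: "J = M" if "is_ideal J" "M \<subseteq> J" "J \<inter> S = {}" for J
    using max' that by simp
  have meet: "\<exists>s h. s \<in> S \<and> s - h * a \<in> M" if "a \<notin> M" for a
  proof (rule ccontr)
    assume *: "\<not> ?thesis"
    let ?J = "gen_ideal M (\<lambda>_. a) {()}"
    have "?J \<inter> S = {}" using * by (auto simp: gen_ideal_single)
    moreover have "M \<subseteq> ?J" by (intro subsetI subset_gen_ideal)
    ultimately have "?J = M" by (intro max gen_ideal_is_ideal M)
    moreover have "a \<in> ?J" using gen_ideal_gen[OF M(1), of "{()}" "()" "\<lambda>_. a"] by simp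
    ultimately show False using that by simp
  qed
  have "a \<in> M \<or> b \<in> M" if ab: "a * b \<in> M" for a b
  proof (rule ccontr)
    assume *: "\<not> ?thesis"
    obtain s h where s: "s \<in> S" "s - h * a \<in> M" using meet[of a] * by auto
    obtain t k where t: "t \<in> S" "t - k * b \<in> M" using meet[of b] * by auto
    have "s * t - (h * a) * (k * b) \<in> M" by (rule ideal_cong_mult[OF M(1) s(2) t(2)])
    moreover have "(h * a) * (k * b) \<in> M"
      using is_idealD(3)[OF M(1) ab, of "h * k"] by (simp add: mult_ac)
    ultimately have "s * t \<in> M" using ideal_cong_mem[OF M(1), of "s * t"] by blast
    then show False using assms(4)[OF s(1) t(1)] M(3) by blast
  qed
  moreover have "1 \<notin> M" using assms(3) M(3) by blast
  ultimately show ?thesis using M by (intro exI[of _ M]) (simp add: is_prime_def)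
qed

text \<open>The homogeneous core of a prime \<open>Q\<close>, formed by the polynomials all of whose
  components lie in \<open>Q\<close>, is again prime and contains every homogeneous ideal below
  \<open>Q\<close>.\<close>

lemma exists_hom_prime_disjoint:
  assumes I: "hom_ideal I" "I \<inter> S = {}" "1 \<in> S" "\<And>a b. a \<in> S \<Longrightarrow> b \<in> S \<Longrightarrow> a * b \<in> S"
  shows "\<exists>P. is_prime P \<and> hom_ideal P \<and> I \<subseteq> P \<and> P \<inter> S = {}"
proof -
  from exists_prime_disjoint[OF hom_idealD(1)[OF I(1)] I(2-4)] obtain Q where
    Q: "is_prime Q" "I \<subseteq> Q" "Q \<inter> S = {}" by blast
  note Qi = is_idealD[OF is_primeD(1)[OF Q(1)]]
  define P where "P = {f. \<forall>s. hom_part s f \<in> Q}"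
  have PQ: "P \<subseteq> Q"
  proof
    fix f assume f: "f \<in> P"
    obtain N where "f = (\<Sum>s\<le>N. hom_part s f)" by (rule sum_hom_part)
    then show "f \<in> Q"
      using f ideal_sum[OF is_primeD(1)[OF Q(1)], of "{..N}" "\<lambda>s. hom_part s f"] by (simp add: P_def)
  qed
  have P: "hom_ideal P"
    unfolding hom_ideal_def
  proof (intro conjI ballI allI is_idealI)
    show "r * a \<in> P" if "a \<in> P" for a r
      using that by (auto simp: P_def hom_part_mult intro!: ideal_sum[OF is_primeD(1)[OF Q(1)]] Qi(3))
    show "hom_part s f \<in> P" if "f \<in> P" for f s
      using that Qi(1) by (simp add: P_def hom_part_homogeneous[OF homogeneous_hom_part])
    show "0 \<in> P" using Qi(1) by (simp add: P_def hom_part_0)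
    show "a + b \<in> P" if "a \<in> P" "b \<in> P" for a b using that Qi(2) by (simp add: P_def hom_part_add)
  qed
  have "is_prime P"
  proof (rule hom_ideal_is_primeI[OF P])
    show "1 \<notin> P" using PQ is_primeD(2)[OF Q(1)] by blast
    fix f g :: "('a, 'b) mpoly" and s r assume "homogeneous s f" "homogeneous r g" "f * g \<in> P"
    then have "f \<in> Q \<or> g \<in> Q" using PQ is_primeD(3)[OF Q(1), of f g] by blast
    then show "f \<in> P \<or> g \<in> P"
      using Qi(1) hom_part_homogeneous[OF \<open>homogeneous s f\<close>] hom_part_homogeneous[OF \<open>homogeneous r g\<close>]
      by (simp add: P_def)
  qed
  moreover have "I \<subseteq> P" using I Q(2) by (auto simp: P_def hom_ideal_def)
  ultimately show ?thesis using P PQ Q(3) by blast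
qed

subsection \<open>Systems of linear forms without common zeros\<close>

text \<open>Algebraic independence over k of the residue classes of \<open>g\<close> in
  k[x]/I.\<close>

definition independent_mod :: "('v, 'k::comm_ring_1) mpoly set \<Rightarrow> ('w \<Rightarrow> ('v, 'k) mpoly) \<Rightarrow> 'w set \<Rightarrow> bool" where
  "independent_mod I g W \<longleftrightarrow> (\<forall>G\<in>mpolys W. peval Const g G \<in> I \<longrightarrow> G = 0)"

text \<open>Geometrically, the \<open>l a\<close> have no common zero on the projective variety of
  \<open>I\<close>. Nilpotency of every variable expresses this without points over an algebraic
  closure.\<close>

definition cuts :: "('v, 'k::comm_ring_1) mpoly set \<Rightarrow> ('i \<Rightarrow> ('v, 'k) mpoly) \<Rightarrow> 'i set \<Rightarrow> bool" where
  "cuts I l A \<longleftrightarrow> (\<forall>v. \<exists>M. Var v ^ M \<in> gen_ideal I l A)"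

definition deg_le :: "('v, 'k::zero) mpoly \<Rightarrow> nat \<Rightarrow> bool" where
  "deg_le f s \<longleftrightarrow> (\<forall>\<alpha>\<in>Poly_Mapping.keys f. mon_degree \<alpha> \<le> s)"

lemma deg_le_exists: "\<exists>s. deg_le f s"
  unfolding deg_le_def
  by (rule exI[of _ "Max (mon_degree ` Poly_Mapping.keys f)"]) simp

lemma deg_le_mult: "deg_le f s \<Longrightarrow> deg_le g r \<Longrightarrow> deg_le (f * g) (s + r)"
  for f g :: "('v, 'k::comm_semiring_1) mpoly"
  unfolding deg_le_def
proof
  fix \<gamma> assume f: "\<forall>\<alpha>\<in>Poly_Mapping.keys f. mon_degree \<alpha> \<le> s"
    and g: "\<forall>\<alpha>\<in>Poly_Mapping.keys g. mon_degree \<alpha> \<le> r"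
    and "\<gamma> \<in> Poly_Mapping.keys (f * g)"
  then obtain \<alpha> \<beta> where "\<gamma> = \<alpha> + \<beta>" "\<alpha> \<in> Poly_Mapping.keys f" "\<beta> \<in> Poly_Mapping.keys g"
    using keys_mult[of f g] by blast
  then show "mon_degree \<gamma> \<le> s + r"
    using f g by (simp add: mon_degree_add add_mono)
qed

lemma deg_le_one: "deg_le (1 :: ('v, 'k::zero_neq_one) mpoly) 0"
  by (simp add: deg_le_def mon_degree_def)

lemma deg_le_power: "deg_le f s \<Longrightarrow> deg_le (f ^ k) (k * s)" for f :: "('v, 'k::comm_semiring_1) mpoly"
  by (induction k) (simp_all add: deg_le_one deg_le_mult)

lemma deg_le_prod:
  "(\<And>a. a \<in> A \<Longrightarrow> deg_le (f a :: ('v, 'k::comm_semiring_1) mpoly) (s a)) \<Longrightarrow> deg_le (prod f A) (sum s A)"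
  by (induction A rule: infinite_finite_induct) (simp_all add: deg_le_one deg_le_mult)

lemma deg_le_mono: "deg_le f s \<Longrightarrow> s \<le> r \<Longrightarrow> deg_le f r"
  by (auto simp: deg_le_def)

section \<open>Finiteness of k[x]/I over the subring generated by a cutting system of forms\<close>

definition span_mod :: "('v, 'k::comm_ring_1) mpoly set \<Rightarrow> ('i \<Rightarrow> ('v, 'k) mpoly) \<Rightarrow> 'i set \<Rightarrow> ('v, 'k) mpoly set" where
  "span_mod I e B = {f. \<exists>c. f - (\<Sum>i\<in>B. Const (c i) * e i) \<in> I}"

lemma span_mod_zero: "is_ideal I \<Longrightarrow> f \<in> I \<Longrightarrow> f \<in> span_mod I e B"
  unfolding span_mod_def by (intro CollectI exI[of _ "\<lambda>_. 0"]) (simp add: Const_simps)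

lemma span_mod_gen:
  assumes "is_ideal I" "finite B" "i \<in> B" shows "e i \<in> span_mod I e B"
proof -
  have "(\<Sum>j\<in>B. Const (if j = i then 1 else 0) * e j) = (\<Sum>j\<in>B. if j = i then e j else 0)"
    by (rule sum.cong) (auto simp: Const_simps)
  also have "\<dots> = e i" using assms(2,3) by simp
  finally have "e i - (\<Sum>j\<in>B. Const (if j = i then 1 else 0) * e j) \<in> I"
    using is_idealD(1)[OF assms(1)] by (simp only: diff_self)
  then show ?thesis
    unfolding span_mod_def by (intro CollectI exI[of _ "\<lambda>j. if j = i then 1 else 0"])
qed

lemma span_mod_add:
  assumes I: "is_ideal I" and "f \<in> span_mod I e B" "g \<in> span_mod I e B"
  shows "f + g \<in> span_mod I e B"
proof -
  obtain c where c: "f - (\<Sum>i\<in>B. Const (c i) * e i) \<in> I" using assms(2) by (auto simp: span_mod_def)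
  obtain d where d: "g - (\<Sum>i\<in>B. Const (d i) * e i) \<in> I" using assms(3) by (auto simp: span_mod_def)
  have "f + g - (\<Sum>i\<in>B. Const (c i + d i) * e i) \<in> I"
    using ideal_cong_add[OF I c d] by (simp add: Const_simps distrib_right sum.distrib)
  then show ?thesis unfolding span_mod_def by (intro CollectI exI[of _ "\<lambda>i. c i + d i"])
qed

lemma span_mod_scale:
  assumes I: "is_ideal I" and "f \<in> span_mod I e B"
  shows "Const a * f \<in> span_mod I e B"
proof -
  obtain c where c: "f - (\<Sum>i\<in>B. Const (c i) * e i) \<in> I" using assms(2) by (auto simp: span_mod_def)
  have "Const a * f - (\<Sum>i\<in>B. Const (a * c i) * e i) \<in> I"
    using is_idealD(3)[OF I c, of "Const a"]
    by (simp add: Const_simps right_diff_distrib sum_distrib_left mult.assoc)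
  then show ?thesis unfolding span_mod_def by (intro CollectI exI[of _ "\<lambda>i. a * c i"])
qed

lemma span_mod_sum:
  "is_ideal I \<Longrightarrow> (\<And>a. a \<in> A \<Longrightarrow> f a \<in> span_mod I e B) \<Longrightarrow> sum f A \<in> span_mod I e B"
  by (induction A rule: infinite_finite_induct) (auto intro: span_mod_zero span_mod_add simp: is_idealD(1))

lemma span_mod_cong:
  assumes I: "is_ideal I" and "f - g \<in> I" "g \<in> span_mod I e B"
  shows "f \<in> span_mod I e B"
  using span_mod_add[OF I span_mod_zero[OF I assms(2)] assms(3)] by simp

lemma span_mod_least:
  assumes "f \<in> span_mod I e B" "is_ideal I" "\<And>i. i \<in> B \<Longrightarrow> e i * g \<in> span_mod I e' B'"
  shows "f * g \<in> span_mod I e' B'"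
proof -
  obtain c where c: "f - (\<Sum>i\<in>B. Const (c i) * e i) \<in> I" using assms(1) by (auto simp: span_mod_def)
  have "f * g - (\<Sum>i\<in>B. Const (c i) * (e i * g)) \<in> I"
    using is_idealD(4)[OF assms(2) c, of g] by (simp add: left_diff_distrib sum_distrib_right mult.assoc)
  then show ?thesis
    by (rule span_mod_cong[OF assms(2)]) (intro span_mod_sum span_mod_scale assms)
qed

lemma mpoly_in_span_mod:
  assumes I: "is_ideal I"
    and "\<And>\<alpha>. \<alpha> \<in> Poly_Mapping.keys f \<Longrightarrow> Poly_Mapping.single \<alpha> 1 \<in> span_mod I e B"
  shows "f \<in> span_mod I e B"
proof -
  have "f = (\<Sum>\<alpha>\<in>Poly_Mapping.keys f. Const (Poly_Mapping.lookup f \<alpha>) * Poly_Mapping.single \<alpha> 1)"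
    by (subst mpoly_as_sum) (simp add: Const_def mult_single)
  moreover have "(\<Sum>\<alpha>\<in>Poly_Mapping.keys f. Const (Poly_Mapping.lookup f \<alpha>) * Poly_Mapping.single \<alpha> 1)
      \<in> span_mod I e B"
    by (intro span_mod_sum[OF I] span_mod_scale[OF I] assms(2))
  ultimately show ?thesis by simp
qed

lemma single_add_split:
  assumes "k \<le> Poly_Mapping.lookup \<alpha> v"
  shows "Poly_Mapping.single \<alpha> (1 :: 'k::comm_ring_1) =
    Var v ^ k * Poly_Mapping.single (\<alpha> - Poly_Mapping.single v k) 1"
proof -
  have "Poly_Mapping.single v k + (\<alpha> - Poly_Mapping.single v k) = \<alpha>"
    using assms by (intro poly_mapping_eqI) (auto simp: lookup_add lookup_minus lookup_single when_def)
  then show ?thesis by (simp add: Var_power mult_single)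
qed

text \<open>With bounded \<gamma> these span k[x]/I over k: finitely many monomials in the variables
  serve as module generators, monomials in the forms as coefficients.\<close>

definition spanning_products ::
    "('i \<Rightarrow> ('v, 'k::comm_ring_1) mpoly) \<Rightarrow> 'i set \<Rightarrow> 'v set \<Rightarrow> ('i \<Rightarrow> nat) \<times> ('v \<Rightarrow> nat) \<Rightarrow> ('v, 'k) mpoly" where
  "spanning_products l A V = (\<lambda>(\<beta>, \<gamma>). (\<Prod>a\<in>A. l a ^ \<beta> a) * (\<Prod>v\<in>V. Var v ^ \<gamma> v))"

text \<open>A graded Nakayama argument: a monomial with an exponent of at least \<open>M\<close>
  lies in the ideal of the forms modulo \<open>I\<close>, with cofactors of degree one less, which
  are spanned by induction.\<close>

lemma monomial_in_span_mod:
  fixes l :: "'i \<Rightarrow> ('v, 'k::comm_ring_1) mpoly"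
  assumes I: "hom_ideal I" and A: "finite A" and l: "\<And>a. a \<in> A \<Longrightarrow> homogeneous 1 (l a)"
    and V: "finite V" "\<And>v. v \<notin> V \<Longrightarrow> Var v \<in> I"
    and M: "M > 0" "\<And>v. v \<in> V \<Longrightarrow> Var v ^ M \<in> gen_ideal I l A"
    and d: "mon_degree \<alpha> = d"
  shows "Poly_Mapping.single \<alpha> 1 \<in>
    span_mod I (spanning_products l A V) ((A \<rightarrow>\<^sub>E {..d}) \<times> (V \<rightarrow>\<^sub>E {..<M}))"
  using d
proof (induction d arbitrary: \<alpha>)
  note Ii = hom_idealD(1)[OF I]
  let ?e = "spanning_products l A V"
  let ?B = "\<lambda>d::nat. (A \<rightarrow>\<^sub>E {..d}) \<times> (V \<rightarrow>\<^sub>E {..<M})"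
  have fin: "finite (?B d)" for d using A V by (intro finite_cartesian_product finite_PiE) auto
  have small: "Poly_Mapping.single \<alpha> 1 \<in> span_mod I ?e (?B d)"
    if "Poly_Mapping.keys \<alpha> \<subseteq> V" "\<And>v. v \<in> V \<Longrightarrow> Poly_Mapping.lookup \<alpha> v < M" for \<alpha> d
  proof -
    let ?i = "(\<lambda>a\<in>A. 0::nat, \<lambda>v\<in>V. Poly_Mapping.lookup \<alpha> v)"
    have "?i \<in> ?B d" using that by auto
    moreover have "?e ?i = Poly_Mapping.single \<alpha> 1"
      using that V by (simp add: spanning_products_def mon_eval_Var[symmetric] mon_eval_superset)
    ultimately show ?thesis using span_mod_gen[OF Ii fin, of ?i d ?e] by metis
  qed
  have outside: "Poly_Mapping.single \<alpha> 1 \<in> span_mod I ?e (?B d)"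
    if out: "\<not> Poly_Mapping.keys \<alpha> \<subseteq> V" for \<alpha> d
  proof -
    obtain v where v: "v \<in> Poly_Mapping.keys \<alpha>" "v \<notin> V" using out by blast
    have "Poly_Mapping.single \<alpha> 1 = Var v ^ 1 * Poly_Mapping.single (\<alpha> - Poly_Mapping.single v 1) (1::'k)"
      using v(1) by (intro single_add_split) (simp add: in_keys_iff)
    then have "Poly_Mapping.single \<alpha> (1::'k) \<in> I"
      using is_idealD(4)[OF Ii V(2)[OF v(2)], of "Poly_Mapping.single (\<alpha> - Poly_Mapping.single v 1) 1"] by simp
    then show ?thesis by (rule span_mod_zero[OF Ii])
  qed
  {
    case 0
    then have "\<alpha> = 0" by (intro poly_mapping_eqI) (auto simp: mon_degree_def in_keys_iff)
    then show ?case using M(1) by (intro small) auto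
  next
    case (Suc d)
    show ?case
    proof (cases "Poly_Mapping.keys \<alpha> \<subseteq> V \<and> (\<exists>v\<in>V. M \<le> Poly_Mapping.lookup \<alpha> v)")
      case False
      then show ?thesis using small[of \<alpha> "Suc d"] outside[of \<alpha> "Suc d"] by (meson not_le)
    next
      case True
      then obtain v where v: "v \<in> V" "M \<le> Poly_Mapping.lookup \<alpha> v" by blast
      have "Poly_Mapping.single \<alpha> 1 \<in> gen_ideal I l A"
        unfolding single_add_split[OF v(2)]
        by (rule is_idealD(4)[OF gen_ideal_is_ideal[OF Ii] M(2)[OF v(1)]])
      then obtain h where "Poly_Mapping.single \<alpha> 1 - (\<Sum>a\<in>A. h a * l a) \<in> I"
        by (auto simp: gen_ideal_def)
      \<comment> \<open>Comparing components of degree d + 1 replaces each cofactor by its component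
        of degree d.\<close>
      then have "hom_part (Suc d) (Poly_Mapping.single \<alpha> 1) - (\<Sum>a\<in>A. hom_part (Suc d) (h a * l a)) \<in> I"
        using hom_idealD(2)[OF I] by (metis hom_part_diff hom_part_sum)
      moreover have "hom_part (Suc d) (Poly_Mapping.single \<alpha> (1::'k)) = Poly_Mapping.single \<alpha> 1"
        using Suc.prems by (subst hom_part_homogeneous[of "Suc d"]) (auto simp: homogeneous_def)
      moreover have "(\<Sum>a\<in>A. hom_part (Suc d) (h a * l a)) = (\<Sum>a\<in>A. hom_part d (h a) * l a)"
        by (rule sum.cong[OF refl]) (simp add: hom_part_mult_homogeneous[OF l])
      ultimately have *: "Poly_Mapping.single \<alpha> 1 - (\<Sum>a\<in>A. hom_part d (h a) * l a) \<in> I" by simp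
      have "hom_part d (h a) * l a \<in> span_mod I ?e (?B (Suc d))" if a: "a \<in> A" for a
      proof (rule span_mod_least[OF _ Ii])
        show "hom_part d (h a) \<in> span_mod I ?e (?B d)"
          by (rule mpoly_in_span_mod[OF Ii], rule Suc.IH) (simp add: keys_hom_part)
        fix i assume "i \<in> ?B d"
        then obtain \<beta> \<gamma> where i: "i = (\<beta>, \<gamma>)" "\<beta> \<in> A \<rightarrow>\<^sub>E {..d}" "\<gamma> \<in> V \<rightarrow>\<^sub>E {..<M}" by auto
        let ?\<beta> = "\<beta>(a := Suc (\<beta> a))"
        have "(\<Prod>b\<in>A. l b ^ ?\<beta> b) = l a ^ ?\<beta> a * (\<Prod>b\<in>A - {a}. l b ^ ?\<beta> b)"
          using A a by (rule prod.remove)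
        also have "(\<Prod>b\<in>A - {a}. l b ^ ?\<beta> b) = (\<Prod>b\<in>A - {a}. l b ^ \<beta> b)"
          by (rule prod.cong) auto
        also have "l a ^ ?\<beta> a * \<dots> = (\<Prod>b\<in>A. l b ^ \<beta> b) * l a"
          using A a by (simp add: prod.remove[of A a "\<lambda>b. l b ^ \<beta> b"] mult_ac)
        finally have "?e i * l a = ?e (?\<beta>, \<gamma>)"
          by (simp add: spanning_products_def i(1) mult_ac)
        moreover have "(?\<beta>, \<gamma>) \<in> ?B (Suc d)"
        proof -
          have "?\<beta> b \<in> {..Suc d}" if "b \<in> A" for b
            using PiE_mem[OF i(2) that] by auto
          moreover have "?\<beta> b = undefined" if "b \<notin> A" for b
            using i(2) a that by (auto simp: PiE_def extensional_def)
          ultimately show ?thesis using i(3) by (auto simp: PiE_def extensional_def)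
        qed
        ultimately show "?e i * l a \<in> span_mod I ?e (?B (Suc d))"
          using span_mod_gen[OF Ii fin, of "(?\<beta>, \<gamma>)" "Suc d" ?e] by simp
      qed
      then show ?thesis by (intro span_mod_cong[OF Ii *] span_mod_sum[OF Ii])
    qed
  }
qed

lemma span_mod_mono:
  assumes I: "is_ideal I" and f: "f \<in> span_mod I e B" and B: "finite B'" "B \<subseteq> B'"
  shows "f \<in> span_mod I e B'"
  using span_mod_least[OF f I, of 1 e B'] span_mod_gen[OF I B(1), of _ e] B(2) by auto

text \<open>Transcendence degree by counting. Up to degree N the quotient has dimension O(N^a) with
  a = card A, while the products of the \<open>g w\<close> with exponents below k number k^(card W)
  and have degree O(k). For large k they are linearly dependent, and this dependence is the
  algebraic relation.\<close>

lemma dependent_of_cuts: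
  fixes l :: "'i \<Rightarrow> ('v, 'k::field) mpoly" and g :: "'w \<Rightarrow> ('v, 'k) mpoly"
  assumes I: "hom_ideal I" and A: "finite A" and l: "\<And>a. a \<in> A \<Longrightarrow> homogeneous 1 (l a)"
    and cuts: "cuts I l A" and V: "finite {v. Var v \<notin> I}" and W: "finite W" "card A < card W"
  shows "\<not> independent_mod I g W"
proof -
  note Ii = hom_idealD(1)[OF I]
  let ?V = "{v. Var v \<notin> I}"
  let ?e = "spanning_products l A ?V"
  from cuts obtain m where m: "\<And>v. Var v ^ m v \<in> gen_ideal I l A"
    unfolding cuts_def by metis
  define M where "M = Suc (sum m ?V)"
  have M: "Var v ^ M \<in> gen_ideal I l A" if "v \<in> ?V" for v
  proof -
    have "m v \<le> M" using member_le_sum[OF that _ V, of m] by (simp add: M_def)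
    then have "Var v ^ M = Var v ^ (M - m v) * (Var v ^ m v :: ('v, 'k) mpoly)"
      by (simp add: power_add[symmetric])
    then show ?thesis using is_idealD(3)[OF gen_ideal_is_ideal[OF Ii] m] by simp
  qed
  have fin: "finite ((A \<rightarrow>\<^sub>E {..d}) \<times> (?V \<rightarrow>\<^sub>E {..<M}))" for d :: nat
    using A V by (intro finite_cartesian_product finite_PiE) auto
  have span: "f \<in> span_mod I ?e ((A \<rightarrow>\<^sub>E {..s}) \<times> (?V \<rightarrow>\<^sub>E {..<M}))" if "deg_le f s" for f s
  proof (rule mpoly_in_span_mod[OF Ii])
    fix \<alpha> assume "\<alpha> \<in> Poly_Mapping.keys f"
    then have "mon_degree \<alpha> \<le> s" using that by (simp add: deg_le_def)
    then have sub: "(A \<rightarrow>\<^sub>E {..mon_degree \<alpha>}) \<times> (?V \<rightarrow>\<^sub>E {..<M}) \<subseteq> (A \<rightarrow>\<^sub>E {..s}) \<times> (?V \<rightarrow>\<^sub>E {..<M})"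
      by (intro Sigma_mono PiE_mono) auto
    show "Poly_Mapping.single \<alpha> 1 \<in> span_mod I ?e ((A \<rightarrow>\<^sub>E {..s}) \<times> (?V \<rightarrow>\<^sub>E {..<M}))"
      by (rule span_mod_mono[OF Ii monomial_in_span_mod[OF I A l V _ _ _ refl] fin sub])
        (use M in \<open>auto simp: M_def\<close>)
  qed
  have "\<exists>E. \<forall>w. deg_le (g w) (E w)" using deg_le_exists by (intro choice) blast
  then obtain E where E: "\<And>w. deg_le (g w) (E w)" by blast
  \<comment> \<open>\<open>C\<close> bounds the number of module generators, \<open>k * n\<close>
    the degrees of the products; \<open>k\<close> is chosen so that with a = card A one has (k n +
    1)^a C <= k^a (n + 1)^a C < k^(a + 1).\<close>
  define n where "n = sum E W"
  define C where "C = M ^ card ?V"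
  define k where "k = Suc (C * (n + 1) ^ card A)"
  define B where "B = (A \<rightarrow>\<^sub>E {..k * n}) \<times> (?V \<rightarrow>\<^sub>E {..<M})"
  define D where "D = (W \<rightarrow>\<^sub>E {..<k})"
  have finD: "finite D" "finite B" using W fin by (auto simp: D_def B_def intro: finite_PiE)
  have "card B = (k * n + 1) ^ card A * C"
    using A V by (simp add: B_def C_def card_cartesian_product card_PiE)
  also have "\<dots> \<le> (k * (n + 1)) ^ card A * C"
    by (intro mult_right_mono power_mono) (auto simp: k_def)
  also have "\<dots> = k ^ card A * (C * (n + 1) ^ card A)"
    by (simp only: power_mult_distrib mult_ac)
  also have "\<dots> < k ^ card A * k" by (intro mult_strict_left_mono) (auto simp: k_def)
  also have "\<dots> = k ^ Suc (card A)" by simp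
  also have "\<dots> \<le> k ^ card W" using W(2) by (intro power_increasing) (auto simp: k_def)
  also have "\<dots> = card D" using W by (simp add: D_def card_PiE)
  finally have card: "card B < card D" .
  let ?p = "\<lambda>d. \<Prod>w\<in>W. g w ^ d w"
  have "?p d \<in> span_mod I ?e B" if d: "d \<in> D" for d
    unfolding B_def
  proof (rule span, rule deg_le_mono)
    show "deg_le (?p d) (\<Sum>w\<in>W. d w * E w)" by (intro deg_le_prod deg_le_power E)
    have "(\<Sum>w\<in>W. d w * E w) \<le> (\<Sum>w\<in>W. k * E w)"
      using d by (intro sum_mono mult_right_mono) (auto simp: D_def PiE_def Pi_def less_imp_le)
    then show "(\<Sum>w\<in>W. d w * E w) \<le> k * n" by (simp add: n_def sum_distrib_left)
  qed
  then have "\<forall>d\<in>D. \<exists>c. ?p d - (\<Sum>i\<in>B. Const (c i) * ?e i) \<in> I" by (simp add: span_mod_def)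
  then obtain c where c: "\<And>d. d \<in> D \<Longrightarrow> ?p d - (\<Sum>i\<in>B. Const (c d i) * ?e i) \<in> I"
    using bchoice[of D "\<lambda>d c. ?p d - (\<Sum>i\<in>B. Const (c i) * ?e i) \<in> I"] by auto
  from more_unknowns_than_equations[OF finD(2,1) card, of c] obtain x where
    x: "\<exists>d\<in>D. x d \<noteq> 0" "\<And>b. b \<in> B \<Longrightarrow> (\<Sum>d\<in>D. x d * c d b) = 0" by (elim exE conjE) blast
  \<comment> \<open>Injectivity of \<open>conv\<close> on \<open>D\<close> gives different unknowns
    different monomials, so the relation \<open>G\<close> built from them is nonzero.\<close>
  define conv :: "('w \<Rightarrow> nat) \<Rightarrow> 'w \<Rightarrow>\<^sub>0 nat" where "conv d = (\<Sum>w\<in>W. Poly_Mapping.single w (d w))" for d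
  have lconv: "Poly_Mapping.lookup (conv d) w = (if w \<in> W then d w else 0)" for d w
    using W(1) by (simp add: conv_def lookup_sum lookup_single when_def sum.delta)
  have kconv: "Poly_Mapping.keys (conv d) \<subseteq> W" for d
    by (auto simp: in_keys_iff lconv split: if_splits)
  have inj: "inj_on conv D"
  proof (rule inj_onI)
    fix d d' assume dd: "d \<in> D" "d' \<in> D" "conv d = conv d'"
    have "d w = d' w" if "w \<in> W" for w
      using lconv[of d w] lconv[of d' w] dd(3) that by simp
    then show "d = d'" using dd(1,2) unfolding D_def by (rule PiE_ext[rotated 2])
  qed
  define G where "G = (\<Sum>d\<in>D. Poly_Mapping.single (conv d) (x d))"
  have lG: "Poly_Mapping.lookup G (conv d) = x d" if "d \<in> D" for d
  proof -
    have "Poly_Mapping.lookup G (conv d) = (\<Sum>d'\<in>D. if d' = d then x d' else 0)"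
      unfolding G_def lookup_sum
      by (rule sum.cong) (use inj that in \<open>auto simp: lookup_single when_def inj_on_def\<close>)
    then show ?thesis using that finD by simp
  qed
  have "G \<noteq> 0" using x(1) lG by (metis lookup_zero)
  moreover have "G \<in> mpolys W"
    unfolding G_def using kconv by (intro mpolys_sum) (auto simp: mpolys_def)
  moreover have "peval Const g G \<in> I"
  proof -
    have "peval Const g G = (\<Sum>d\<in>D. Const (x d) * ?p d)"
      unfolding G_def peval_sum[OF ring_map_Const] peval_single[OF ring_map_Const]
      by (simp add: mon_eval_superset[OF W(1) kconv] lconv)
    also have "\<dots> - (\<Sum>d\<in>D. Const (x d) * (\<Sum>i\<in>B. Const (c d i) * ?e i)) \<in> I"
      unfolding sum_subtractf[symmetric] right_diff_distrib[symmetric]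
      by (intro ideal_sum[OF Ii] is_idealD(3)[OF Ii] c)
    finally have *: "peval Const g G - (\<Sum>d\<in>D. Const (x d) * (\<Sum>i\<in>B. Const (c d i) * ?e i)) \<in> I" .
    have "(\<Sum>d\<in>D. Const (x d) * (\<Sum>i\<in>B. Const (c d i) * ?e i)) =
        (\<Sum>d\<in>D. \<Sum>i\<in>B. Const (x d * c d i) * ?e i)"
      by (simp add: sum_distrib_left Const_simps mult.assoc)
    also have "\<dots> = (\<Sum>i\<in>B. Const (\<Sum>d\<in>D. x d * c d i) * ?e i)"
      by (subst sum.swap) (simp add: ring_map_sum[OF ring_map_Const] sum_distrib_right)
    also have "\<dots> = 0" by (simp add: x(2) Const_simps)
    finally show ?thesis using * by simp
  qed
  ultimately show ?thesis by (auto simp: independent_mod_def)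
qed

lemma ideal_Const: "is_ideal I \<Longrightarrow> Const c \<in> I \<Longrightarrow> c \<noteq> 0 \<Longrightarrow> 1 \<in> I" for c :: "'k::field"
  using is_idealD(3)[of I "Const c" "Const (inverse c)"] Const_inverse[of c 1] by (metis mult.right_neutral)

lemma peval_linear_multiples:
  fixes G :: "('w, 'k::comm_ring_1) mpoly"
  assumes "homogeneous e G"
  shows "peval Const (\<lambda>a. Const (\<kappa> a) * y) G = Const (mpoly_eval G \<kappa>) * y ^ e"
proof -
  have "peval Const (\<lambda>a. Const (\<kappa> a) * y) G =
      (\<Sum>\<alpha>\<in>Poly_Mapping.keys G. Const (Poly_Mapping.lookup G \<alpha> * mon_eval \<alpha> \<kappa>) * y ^ e)"
    unfolding peval_def
  proof (rule sum.cong[OF refl])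
    fix \<alpha> assume "\<alpha> \<in> Poly_Mapping.keys G"
    then have "mon_degree \<alpha> = e" using assms by (simp add: homogeneous_def)
    moreover have "mon_eval \<alpha> (\<lambda>a. Const (\<kappa> a) * y) = mon_eval \<alpha> (\<lambda>a. y * Const (\<kappa> a))"
      by (simp add: mult.commute)
    ultimately have "mon_eval \<alpha> (\<lambda>a. Const (\<kappa> a) * y) = y ^ e * Const (mon_eval \<alpha> \<kappa>)"
      by (simp only: mon_eval_scale ring_map_mon_eval[OF ring_map_Const])
    then show "Const (Poly_Mapping.lookup G \<alpha>) * mon_eval \<alpha> (\<lambda>a. Const (\<kappa> a) * y) =
        Const (Poly_Mapping.lookup G \<alpha> * mon_eval \<alpha> \<kappa>) * y ^ e"
      by (simp add: Const_simps mult_ac)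
  qed
  then show ?thesis
    by (simp add: mpoly_eval_def ring_map_sum[OF ring_map_Const] sum_distrib_right)
qed

lemma Var_neq_0: "(Var v :: ('v, 'k::comm_ring_1) mpoly) \<noteq> 0"
  unfolding Var_def by (metis lookup_single_eq lookup_zero zero_neq_one)

text \<open>If a form \<open>G\<close> vanishes on \<open>l\<close>, a generic projection of \<open>l\<close> from the
  coordinate point \<open>p\<close> still has no common zero.\<close>

lemma drop_form:
  fixes l :: "'i::linorder \<Rightarrow> ('v, 'k::field) mpoly"
  assumes I: "is_ideal I" and A: "finite A" and cuts: "cuts I l A" and p: "p \<in> A"
    and G: "G \<in> mpolys A" "homogeneous e G" "G \<noteq> 0" "peval Const l G \<in> I"
    and k0: "infinite k0" "\<forall>a\<in>k0. \<forall>b\<in>k0. a / b \<in> k0"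
  shows "\<exists>\<kappa>. (\<forall>a. \<kappa> a \<in> k0) \<and> \<kappa> p = 1 \<and> mpoly_eval G \<kappa> \<noteq> 0 \<and>
    cuts I (\<lambda>a. l a - Const (\<kappa> a) * l p) (A - {p})"
proof -
  \<comment> \<open>The factor x_p allows scaling the generic point to \<open>\<kappa> p = 1\<close>
    while \<open>G\<close> stays nonzero there.\<close>
  have "G * Var p \<noteq> 0" using G(3) Var_neq_0 by simp
  from mpoly_nonvanishing[OF k0(1) this] obtain c where
    c: "\<And>a. c a \<in> k0" "mpoly_eval (G * Var p) c \<noteq> 0" by (elim exE conjE) blast
  then have cp: "c p \<noteq> 0" "mpoly_eval G c \<noteq> 0" by (auto simp: mpoly_eval_mult mpoly_eval_Var)
  define \<kappa> where "\<kappa> a = inverse (c p) * c a" for a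
  have \<kappa>0: "\<kappa> a \<in> k0" for a using k0(2) c(1)[of a] c(1)[of p] by (simp add: \<kappa>_def field_simps)
  have \<kappa>p: "\<kappa> p = 1" using cp by (simp add: \<kappa>_def)
  have G\<kappa>: "mpoly_eval G \<kappa> \<noteq> 0"
    using mpoly_eval_homogeneous_scale[OF G(2), of "inverse (c p)" c] cp by (simp add: \<kappa>_def[abs_def])
  define l' where "l' a = l a - Const (\<kappa> a) * l p" for a
  define J where "J = gen_ideal I l' (A - {p})"
  have J: "is_ideal J" unfolding J_def by (rule gen_ideal_is_ideal[OF I])
  have lJ: "l a - Const (\<kappa> a) * l p \<in> J" if "a \<in> A" for a
  proof (cases "a = p")
    case True
    then show ?thesis using is_idealD(1)[OF J] by (simp add: \<kappa>p Const_simps)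
  next
    case False
    then show ?thesis using gen_ideal_gen[OF I, of "A - {p}" a l'] A that by (simp add: J_def l'_def)
  qed
  \<comment> \<open>Modulo \<open>J\<close> each l a is \<kappa> a times l p, so G(l) becomes
    G(\<kappa>) times the e-th power of l p. Since G(l) lies in \<open>I\<close>, that power lies in
    \<open>J\<close>.\<close>
  have "peval Const l G - peval Const (\<lambda>a. Const (\<kappa> a) * l p) G \<in> J"
    by (rule ideal_cong_peval[OF J G(1) lJ])
  then have "Const (mpoly_eval G \<kappa>) * l p ^ e \<in> J"
    using ideal_cong_mem[OF J] subset_gen_ideal[OF G(4)] unfolding J_def peval_linear_multiples[OF G(2)] by blast
  then have lp: "l p ^ e \<in> J"
    using is_idealD(3)[OF J, of _ "Const (inverse (mpoly_eval G \<kappa>))"] Const_inverse[OF G\<kappa>, of "l p ^ e"] by metis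
  have "cuts I l' (A - {p})"
    unfolding cuts_def J_def[symmetric]
  proof
    fix v
    \<comment> \<open>Modulo \<open>J\<close> a power of x_v is a multiple of l p, and the e-th
      power of that multiple is zero.\<close>
    obtain M h where h: "Var v ^ M - (\<Sum>a\<in>A. h a * l a) \<in> I"
      using cuts unfolding cuts_def gen_ideal_def by blast
    have "(\<Sum>a\<in>A. h a * l a) - (\<Sum>a\<in>A. h a * (Const (\<kappa> a) * l p)) \<in> J"
      unfolding sum_subtractf[symmetric] right_diff_distrib[symmetric]
      by (intro ideal_sum[OF J] is_idealD(3)[OF J] lJ)
    moreover have "Var v ^ M - (\<Sum>a\<in>A. h a * l a) \<in> J" unfolding J_def by (rule subset_gen_ideal[OF h])
    ultimately have "Var v ^ M - (\<Sum>a\<in>A. h a * (Const (\<kappa> a) * l p)) \<in> J"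
      using ideal_cong_trans[OF J] by blast
    moreover have "(\<Sum>a\<in>A. h a * (Const (\<kappa> a) * l p)) = (\<Sum>a\<in>A. h a * Const (\<kappa> a)) * l p"
      by (simp add: sum_distrib_right mult.assoc)
    ultimately have "Var v ^ M - (\<Sum>a\<in>A. h a * Const (\<kappa> a)) * l p \<in> J" by simp
    from ideal_cong_power[OF J this, of e]
    have "(Var v ^ M) ^ e - (\<Sum>a\<in>A. h a * Const (\<kappa> a)) ^ e * l p ^ e \<in> J"
      by (simp add: power_mult_distrib)
    moreover have "(\<Sum>a\<in>A. h a * Const (\<kappa> a)) ^ e * l p ^ e \<in> J" by (rule is_idealD(3)[OF J lp])
    ultimately have "(Var v ^ M) ^ e \<in> J" using ideal_cong_mem[OF J] by blast
    then show "\<exists>M. Var v ^ M \<in> J" by (metis power_mult)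
  qed
  then show ?thesis using \<kappa>0 \<kappa>p G\<kappa> by (intro exI[of _ \<kappa>]) (simp add: l'_def[abs_def])
qed

lemma cuts_mono:
  assumes "cuts I l A" "is_ideal J" "\<And>f. f \<in> I \<Longrightarrow> f \<in> gen_ideal J l' B"
    "\<And>a. a \<in> A \<Longrightarrow> l a \<in> gen_ideal J l' B"
  shows "cuts J l' B"
  using assms(1) gen_ideal_least[of _ I l A, OF _ gen_ideal_is_ideal[OF assms(2)] assms(3,4)]
  unfolding cuts_def by blast

text \<open>\<open>k0\<close> will be the copy of C inside C(t), and \<open>L\<close> the linear
  forms with coefficients in it. The assumptions are what keeps the projections of
  \<open>drop_form\<close> inside \<open>L\<close>.\<close>

locale linear_system =
  fixes k0 :: "'k::field set" and L :: "('v, 'k) mpoly set"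
  assumes infinite_k0: "infinite k0" and k0_divide: "\<forall>a\<in>k0. \<forall>b\<in>k0. a / b \<in> k0"
    and L_homogeneous: "\<And>f. f \<in> L \<Longrightarrow> homogeneous 1 f"
    and L_closed: "\<And>f g c. f \<in> L \<Longrightarrow> g \<in> L \<Longrightarrow> c \<in> k0 \<Longrightarrow> f - Const c * g \<in> L"
begin

definition cut_by :: "('v, 'k) mpoly set \<Rightarrow> nat \<Rightarrow> bool" where
  "cut_by I q \<longleftrightarrow> (\<exists>l. (\<forall>i<q. l i \<in> L) \<and> cuts I l {..<q})"

lemma hom_part_relation:
  assumes I: "hom_ideal I" and l: "\<forall>i<q. l i \<in> L"
    and G: "G \<in> mpolys {..<q}" "peval Const l G \<in> I" "G \<noteq> 0"
  shows "\<exists>e. hom_part e G \<in> mpolys {..<q} \<and> homogeneous e (hom_part e G) \<and> hom_part e G \<noteq> 0 \<and>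
    peval Const l (hom_part e G) \<in> I"
proof -
  obtain e where "hom_part e G \<noteq> 0" using hom_part_nonzero[OF G(3)] by blast
  moreover have "hom_part e (peval Const l G) = peval Const l (hom_part e G)"
    by (rule hom_part_peval[OF G(1)]) (use l in \<open>auto intro: L_homogeneous[unfolded One_nat_def] homogeneous_Const ring_map_Const\<close>)
  ultimately show ?thesis
    using hom_idealD(2)[OF I G(2), of e] hom_part_in_mpolys[OF G(1)] homogeneous_hom_part by metis
qed

text \<open>A relation between the forms can be taken homogeneous, and then \<open>drop_form\<close>
  removes one form, against minimality.\<close>

lemma minimal_independent:
  assumes I: "hom_ideal I" "1 \<notin> I" and l: "\<And>i. i < q \<Longrightarrow> l i \<in> L" and cuts: "cuts I l {..<q}"
    and minimal: "\<And>r. r < q \<Longrightarrow> \<not> cut_by I r"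
  shows "independent_mod I l {..<q}"
  unfolding independent_mod_def
proof (intro ballI impI)
  fix G :: "(nat, 'k) mpoly" assume G: "G \<in> mpolys {..<q}" "peval Const l G \<in> I"
  show "G = 0"
  proof (rule ccontr)
    assume "G \<noteq> 0"
    from l have "\<forall>i<q. l i \<in> L" by simp
    from hom_part_relation[OF I(1) this G \<open>G \<noteq> 0\<close>] obtain e where
      e: "hom_part e G \<in> mpolys {..<q}" "homogeneous e (hom_part e G)" "hom_part e G \<noteq> 0"
        "peval Const l (hom_part e G) \<in> I" by (elim exE conjE) (rule that)
    show False
    proof (cases q)
      case 0
      \<comment> \<open>Without forms, the relation is a nonzero constant lying in
        \<open>I\<close>.\<close>
      obtain c where c: "mpoly_eval G c \<noteq> 0"
        using mpoly_nonvanishing[OF infinite_k0 \<open>G \<noteq> 0\<close>] by (elim exE conjE) (rule that)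
      have "peval Const l G = peval Const (\<lambda>i. Const (c i)) G"
        by (rule peval_cong[OF G(1)]) (simp add: 0)
      also have "\<dots> = Const (mpoly_eval G c)"
        by (simp add: mpoly_eval_eq_peval peval_comp[OF ring_map_Const])
      finally show False
        using G(2) I(2) c ideal_Const[OF hom_idealD(1)[OF I(1)], of "mpoly_eval G c"] by simp
    next
      case (Suc r)
      have "r \<in> {..<q}" by (simp add: Suc)
      from drop_form[OF hom_idealD(1)[OF I(1)] finite_lessThan cuts this e infinite_k0 k0_divide]
      obtain \<kappa> where \<kappa>: "\<And>a. \<kappa> a \<in> k0" "cuts I (\<lambda>a. l a - Const (\<kappa> a) * l r) ({..<q} - {r})"
        by (elim exE conjE) blast
      moreover have "{..<q} - {r} = {..<r}" using Suc by auto
      ultimately have "cut_by I r"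
        unfolding cut_by_def using Suc
        by (intro exI[of _ "\<lambda>a. l a - Const (\<kappa> a) * l r"]) (auto intro!: L_closed l)
      then show False using minimal[of r] Suc by simp
    qed
  qed
qed

lemma independent_mod_not_mem:
  fixes I :: "('v, 'k) mpoly set" and l :: "nat \<Rightarrow> ('v, 'k) mpoly"
  shows "independent_mod I l W \<Longrightarrow> i \<in> W \<Longrightarrow> l i \<notin> I"
  unfolding independent_mod_def
  using Var_in_mpolys_iff[of i W] Var_neq_0[of i] peval_Var[OF ring_map_Const, of l i] by metis

text \<open>The source of dim X >= q - 1. Add the last form to \<open>Q\<close> and choose a
  homogeneous prime above it that contains no nonzero polynomial in the remaining forms; these stay
  independent and the induction continues. Witnesses in \<open>L\<close> and the surviving form l 0
  ensure that the primes give distinct points of Proj. The smallest prime carries the largest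
  index.\<close>

lemma chain_of_primes:
  assumes "is_prime Q" "hom_ideal Q" "finite {v. Var v \<notin> Q}" "\<And>i. i \<le> k \<Longrightarrow> l i \<in> L"
    "independent_mod Q l {..<Suc k}" "cuts Q l {..<Suc k}"
  shows "\<exists>P. P k = Q \<and> (\<forall>i\<le>k. is_prime (P i) \<and> hom_ideal (P i) \<and> l 0 \<notin> P i \<and> Q \<subseteq> P i) \<and>
    (\<forall>i<k. P (Suc i) \<subseteq> P i \<and> (\<exists>f\<in>L. f \<in> P i \<and> f \<notin> P (Suc i)))"
  using assms
proof (induction k arbitrary: Q)
  case 0
  then show ?case
    using independent_mod_not_mem[of Q l "{..<Suc 0}" 0] by (intro exI[of _ "\<lambda>_. Q"]) simp
next
  case (Suc k)
  note Q = Suc.prems(1,2) and V = Suc.prems(3) and l = Suc.prems(4)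
  note Qi = is_primeD(1)[OF Q(1)]
  define I where "I = gen_ideal Q l {Suc k}"
  have I: "hom_ideal I"
    unfolding I_def by (rule hom_ideal_gen_ideal[OF Q(2)]) (auto intro!: L_homogeneous[unfolded One_nat_def] l)
  note Ii = hom_idealD(1)[OF I]
  have QI: "f \<in> I" if "f \<in> Q" for f unfolding I_def using that by (rule subset_gen_ideal)
  have lI: "l (Suc k) \<in> I" unfolding I_def by (rule gen_ideal_gen[OF Qi]) auto
  define S where "S = {peval Const l G | G. G \<in> mpolys {..<Suc k} \<and> G \<noteq> 0}"
  have cutsI: "cuts J l {..<Suc k}" if "is_ideal J" "I \<subseteq> J" for J
  proof (rule cuts_mono[OF Suc.prems(6) that(1)])
    show "f \<in> gen_ideal J l {..<Suc k}" if "f \<in> Q" for f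
      using QI[OF that] \<open>I \<subseteq> J\<close> by (intro subset_gen_ideal) blast
    show "l a \<in> gen_ideal J l {..<Suc k}" if "a \<in> {..<Suc (Suc k)}" for a
    proof (cases "a = Suc k")
      case True
      then show ?thesis using lI \<open>I \<subseteq> J\<close> by (intro subset_gen_ideal) blast
    next
      case False
      then show ?thesis using that by (intro gen_ideal_gen \<open>is_ideal J\<close>) auto
    qed
  qed
  \<comment> \<open>A relation modulo \<open>I\<close> would let \<open>drop_form\<close> remove the
    form with index \<open>k\<close>. With l (Suc k) put in its place, k + 1 forms would cut
    \<open>Q\<close>, although k + 2 elements are independent modulo \<open>Q\<close>.\<close>
  have "I \<inter> S = {}"
  proof (rule ccontr)
    assume "I \<inter> S \<noteq> {}"
    then obtain G where G: "G \<in> mpolys {..<Suc k}" "peval Const l G \<in> I" "G \<noteq> 0"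
      unfolding S_def by auto
    have "\<forall>i<Suc k. l i \<in> L" using l by simp
    from hom_part_relation[OF I this G] obtain e where
      e: "hom_part e G \<in> mpolys {..<Suc k}" "homogeneous e (hom_part e G)" "hom_part e G \<noteq> 0"
        "peval Const l (hom_part e G) \<in> I" by (elim exE conjE) (rule that)
    have "k \<in> {..<Suc k}" by simp
    from drop_form[OF Ii finite_lessThan cutsI[OF Ii order.refl] this e infinite_k0 k0_divide]
    obtain \<kappa> where \<kappa>: "\<And>a. \<kappa> a \<in> k0" "cuts I (\<lambda>a. l a - Const (\<kappa> a) * l k) ({..<Suc k} - {k})"
      by (elim exE conjE) blast
    define l' where "l' a = (if a = k then l (Suc k) else l a - Const (\<kappa> a) * l k)" for a
    have gen: "l' a \<in> gen_ideal Q l' {..<Suc k}" if "a < Suc k" for a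
      using that by (intro gen_ideal_gen Qi) auto
    have "cuts Q l' {..<Suc k}"
    proof (rule cuts_mono[OF \<kappa>(2) Qi])
      fix f assume "f \<in> I"
      then show "f \<in> gen_ideal Q l' {..<Suc k}"
        unfolding I_def using gen[of k]
        by (elim gen_ideal_least) (auto simp: l'_def intro: gen_ideal_is_ideal Qi subset_gen_ideal)
    next
      fix a assume "a \<in> {..<Suc k} - {k}"
      then show "l a - Const (\<kappa> a) * l k \<in> gen_ideal Q l' {..<Suc k}"
        using gen[of a] by (auto simp: l'_def)
    qed
    moreover have "homogeneous 1 (l' a)" if "a \<in> {..<Suc k}" for a
      using that l \<kappa>(1) by (intro L_homogeneous) (auto simp: l'_def intro!: L_closed)
    ultimately have "\<not> independent_mod Q l {..<Suc (Suc k)}"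
      using V by (intro dependent_of_cuts[where l = l' and A = "{..<Suc k}"] Q) auto
    then show False using Suc.prems(5) by simp
  qed
  moreover have "1 \<in> S"
    unfolding S_def using ring_mapD(2)[OF ring_map_peval[OF ring_map_Const], of l]
    by (intro CollectI exI[of _ 1]) (auto simp: mpolys_one)
  moreover have "a * b \<in> S" if ab: "a \<in> S" "b \<in> S" for a b
  proof -
    obtain F G where "a = peval Const l F" "b = peval Const l G" "F \<in> mpolys {..<Suc k}" "F \<noteq> 0"
      "G \<in> mpolys {..<Suc k}" "G \<noteq> 0" using ab unfolding S_def by auto
    then show ?thesis
      unfolding S_def
      by (intro CollectI exI[of _ "F * G"]) (simp add: peval_mult ring_map_Const mpolys_mult)
  qed
  ultimately obtain P where P: "is_prime P" "hom_ideal P" "I \<subseteq> P" "P \<inter> S = {}"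
    using exists_hom_prime_disjoint[OF I, of S] by auto
  have "independent_mod P l {..<Suc k}"
    using P(4) by (auto simp: independent_mod_def S_def)
  moreover have "finite {v. Var v \<notin> P}"
    using V QI P(3) by (rule_tac finite_subset[OF _ V]) auto
  ultimately obtain R where R: "R k = P" "\<forall>i\<le>k. is_prime (R i) \<and> hom_ideal (R i) \<and> l 0 \<notin> R i \<and> P \<subseteq> R i"
    "\<forall>i<k. R (Suc i) \<subseteq> R i \<and> (\<exists>f\<in>L. f \<in> R i \<and> f \<notin> R (Suc i))"
    using Suc.IH[OF P(1,2)] l cutsI[OF is_primeD(1)[OF P(1)] P(3)] by (metis le_SucI)
  have QP: "Q \<subseteq> P" using QI P(3) by blast
  have nm: "l 0 \<notin> Q" "l (Suc k) \<notin> Q"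
    using independent_mod_not_mem[OF Suc.prems(5)] by auto
  have lP: "l (Suc k) \<in> P" using lI P(3) by blast
  let ?R = "\<lambda>i. if i \<le> k then R i else Q"
  show ?case
  proof (intro exI[of _ ?R] conjI allI impI)
    fix i assume "i < Suc k"
    then have i: "i < k \<or> i = k" by linarith
    then show "?R (Suc i) \<subseteq> ?R i" using R(3) QP R(1) by auto
    show "\<exists>f\<in>L. f \<in> ?R i \<and> f \<notin> ?R (Suc i)"
    proof (cases "i = k")
      case True
      then show ?thesis using nm(2) lP R(1) l by (intro bexI[of _ "l (Suc k)"]) auto
    qed (use R(3) i in auto)
  next
    fix i assume "i \<le> Suc k"
    show "is_prime (?R i)" "hom_ideal (?R i)" "l 0 \<notin> ?R i" "Q \<subseteq> ?R i"
      using R(2) Q nm QP by auto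
  qed simp
qed

end

subsection \<open>Roots along lines\<close>

lemma poly_taylor2:
  fixes p :: "'a::idom poly"
  shows "\<exists>c. poly p (a + h) = poly p a + h * poly (pderiv p) a + h ^ 2 * c"
proof (induction p)
  case (pCons x p)
  from pCons.IH obtain c where c: "poly p (a + h) = poly p a + h * poly (pderiv p) a + h ^ 2 * c" ..
  show ?case
    by (rule exI[of _ "poly (pderiv p) a + a * c + h * c"])
      (simp add: c pderiv_pCons algebra_simps power2_eq_square)
qed simp

lemma ring_map_fps_nth_0: "ring_map (\<lambda>f. fps_nth f 0)"
  by (simp add: ring_map_def)

lemma ring_map_of_nat: "ring_map h \<Longrightarrow> h (of_nat n) = of_nat n"
  by (induction n) (simp_all add: ring_mapD)

lemma pderiv_map_poly: "ring_map h \<Longrightarrow> pderiv (map_poly h p) = map_poly h (pderiv p)"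
  for h :: "'a::idom \<Rightarrow> 'b::idom"
  by (simp add: poly_eq_iff coeff_pderiv coeff_map_poly_ring ring_mapD(4) ring_map_of_nat del: of_nat_Suc)

lemma fps_X_power_mult_0: "fps_nth (fps_const k * fps_X ^ Suc n * f) i = (if i \<le> n then 0 else k * fps_nth f (i - Suc n))"
  for k :: "'a::comm_ring_1"
  by (simp add: mult.assoc fps_X_power_mult_nth less_Suc_eq_le del: power_Suc)

text \<open>Newton iteration correcting one coefficient at a time. The base ring is only a domain,
  later a polynomial ring, so the inverse \<open>e\<close> of the initial derivative is supplied; in
  the application it is a complex constant.\<close>

lemma hensel:
  fixes p :: "'a::idom fps poly"
  assumes root: "fps_nth (poly p (fps_const a)) 0 = 0"
    and unit: "fps_nth (poly (pderiv p) (fps_const a)) 0 * e = 1"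
  shows "\<exists>s. fps_nth s 0 = a \<and> poly p s = 0"
proof -
  define s where "s = rec_nat (fps_const a)
    (\<lambda>n s. s - fps_const (e * fps_nth (poly p s) (Suc n)) * fps_X ^ Suc n)"
  have s0: "s 0 = fps_const a" by (simp add: s_def)
  have sS: "s (Suc n) = s n - fps_const (e * fps_nth (poly p (s n)) (Suc n)) * fps_X ^ Suc n" for n
    by (simp add: s_def)
  have nth_s: "fps_nth (s (Suc n)) i = fps_nth (s n) i" if "i \<le> n" for n i
    using fps_X_power_mult_0[of _ n 1 i] that by (simp add: sS del: power_Suc)
  have const: "fps_nth (s n) 0 = a" for n
    by (induction n) (simp_all add: s0 nth_s)
  have p0: "fps_nth (poly (pderiv p) f) 0 * e = 1" if "fps_nth f 0 = a" for f
    using unit that ring_map_map_poly_poly[OF ring_map_fps_nth_0, of "pderiv p" f]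
      ring_map_map_poly_poly[OF ring_map_fps_nth_0, of "pderiv p" "fps_const a"] by simp
  have zero: "\<forall>i\<le>n. fps_nth (poly p (s n)) i = 0" for n
  proof (induction n)
    case 0
    then show ?case using root by (simp add: s0)
  next
    case (Suc n)
    define k where "k = fps_nth (poly p (s n)) (Suc n)"
    define h where "h = fps_const (- (e * k)) * fps_X ^ Suc n"
    have sh: "s (Suc n) = s n + h" by (simp add: sS h_def k_def fps_const_neg[symmetric] del: fps_const_neg)
    obtain c where "poly p (s n + h) = poly p (s n) + h * poly (pderiv p) (s n) + h ^ 2 * c"
      using poly_taylor2 by blast
    then have *: "poly p (s (Suc n)) = poly p (s n) + h * (poly (pderiv p) (s n) + h * c)"
      by (simp add: sh algebra_simps power2_eq_square)
    have hn: "fps_nth (h * f) i = (if i \<le> n then 0 else - (e * k) * fps_nth f (i - Suc n))" for f i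
      unfolding h_def by (rule fps_X_power_mult_0)
    show ?case
    proof (intro allI impI)
      fix i assume "i \<le> Suc n"
      then consider "i \<le> n" | "i = Suc n" by linarith
      then show "fps_nth (poly p (s (Suc n))) i = 0"
      proof cases
        case 1
        then show ?thesis using Suc by (simp add: * hn)
      next
        case 2
        have "- (e * k) * fps_nth (poly (pderiv p) (s n)) 0 = - (k * (fps_nth (poly (pderiv p) (s n)) 0 * e))"
          by (simp add: mult_ac)
        moreover have "fps_nth h 0 = 0" using hn[of 1 0] by simp
        ultimately show ?thesis using p0[OF const[of n]] by (simp add: * hn 2 k_def[symmetric])
      qed
    qed
  qed
  have stable: "fps_nth (s (i + k)) i = fps_nth (s i) i" for i k
    by (induction k) (simp_all add: nth_s)
  \<comment> \<open>Coefficient i no longer changes after step i, so the diagonal is the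
    limit.\<close>
  define t where "t = Abs_fps (\<lambda>i. fps_nth (s i) i)"
  have "fps_nth (poly p t) n = 0" for n
  proof -
    obtain c where c: "poly p (s n + (t - s n)) = poly p (s n) + (t - s n) * poly (pderiv p) (s n) + (t - s n) ^ 2 * c"
      using poly_taylor2 by blast
    have 0: "fps_nth (t - s n) i = 0" if "i \<le> n" for i
      using stable[of i "n - i"] that by (simp add: t_def)
    have "poly p t = poly p (s n) + (t - s n) * (poly (pderiv p) (s n) + (t - s n) * c)"
      using c by (simp add: algebra_simps power2_eq_square)
    moreover have "fps_nth ((t - s n) * f) n = 0" for f
      unfolding fps_mult_nth by (rule sum.neutral) (simp add: 0 del: fps_sub_nth)
    ultimately show ?thesis using zero[of n] by simp
  qed
  then have "poly p t = 0" by (simp add: fps_eq_iff)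
  moreover have "fps_nth t 0 = a" by (simp add: t_def s0)
  ultimately show ?thesis by blast
qed

text \<open>By Taylor's formula, \<open>s - t\<close> times a series with nonzero constant
  coefficient is zero.\<close>

lemma hensel_unique:
  fixes p :: "'a::idom fps poly"
  assumes "poly p s = 0" "poly p t = 0" "fps_nth s 0 = fps_nth t 0" "fps_nth (poly (pderiv p) t) 0 \<noteq> 0"
  shows "s = t"
proof -
  obtain c where c: "poly p (t + (s - t)) = poly p t + (s - t) * poly (pderiv p) t + (s - t) ^ 2 * c"
    using poly_taylor2 by blast
  have "(s - t) * (poly (pderiv p) t + (s - t) * c) = 0"
    using c assms(1,2) by (simp add: algebra_simps power2_eq_square)
  moreover have "fps_nth (poly (pderiv p) t + (s - t) * c) 0 \<noteq> 0" using assms(3,4) by simp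
  then have "poly (pderiv p) t + (s - t) * c \<noteq> 0" by (metis fps_zero_nth)
  ultimately show ?thesis by simp
qed

lemma ring_map_fps_of_poly: "ring_map (fps_of_poly :: 'a::comm_ring_1 poly \<Rightarrow> _)"
  by (simp add: ring_map_def fps_of_poly_add fps_of_poly_mult)

definition fps_map :: "('a \<Rightarrow> 'b) \<Rightarrow> 'a fps \<Rightarrow> 'b fps" where
  "fps_map h f = Abs_fps (\<lambda>n. h (fps_nth f n))"

lemma fps_nth_map: "fps_nth (fps_map h f) n = h (fps_nth f n)"
  by (simp add: fps_map_def)

lemma ring_map_fps_map: "ring_map h \<Longrightarrow> ring_map (fps_map h)"
  by (intro ring_mapI) (simp_all add: fps_eq_iff fps_nth_map ring_mapD fps_mult_nth ring_map_sum)

lemma fps_map_fps_of_poly: "ring_map h \<Longrightarrow> fps_map h (fps_of_poly p) = fps_of_poly (map_poly h p)"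
  by (simp add: fps_eq_iff fps_nth_map coeff_map_poly_ring)

text \<open>Above degree \<open>D\<close> the leading power of y would have larger degree than all
  other terms of the equation. The bound depends on the coefficients only, so it will hold uniformly
  on all lines.\<close>

lemma monic_root_degree:
  fixes p :: "'a::idom poly poly"
  assumes "lead_coeff p = 1" "poly p y = 0" "\<And>i. degree (coeff p i) \<le> D"
  shows "degree y \<le> D"
proof (rule ccontr)
  assume D: "\<not> degree y \<le> D"
  define e where "e = degree p"
  have "poly p y = (\<Sum>i<e. coeff p i * y ^ i) + y ^ e"
    using assms(1) by (simp add: poly_altdef e_def lessThan_Suc_atMost[symmetric])
  then have eq: "y ^ e = - (\<Sum>i<e. coeff p i * y ^ i)" using assms(2) by (simp add: eq_neg_iff_add_eq_0 add.commute)
  have "y \<noteq> 0" using D by auto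
  then have yne: "y ^ e \<noteq> 0" by simp
  have "e \<noteq> 0" using eq by (intro notI) simp
  have "degree (\<Sum>i<e. coeff p i * y ^ i) \<le> D + (e - 1) * degree y"
  proof (rule degree_sum_le)
    fix i assume "i \<in> {..<e}"
    have "degree (coeff p i * y ^ i) \<le> degree (coeff p i) + degree (y ^ i)" by (rule degree_mult_le)
    also have "\<dots> \<le> D + i * degree y" using degree_power_le[of y i] assms(3)[of i] by (simp add: mult.commute add_mono)
    also have "\<dots> \<le> D + (e - 1) * degree y" using \<open>i \<in> {..<e}\<close> by (intro add_left_mono mult_right_mono) auto
    finally show "degree (coeff p i * y ^ i) \<le> D + (e - 1) * degree y" .
  qed simp
  also have "\<dots> < e * degree y" using D \<open>e \<noteq> 0\<close> by (cases e) auto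
  also have "\<dots> = degree (y ^ e)" using \<open>y \<noteq> 0\<close> by (simp add: degree_power_eq)
  finally show False unfolding eq by simp
qed

text \<open>The hypothesis asks for a polynomial root of \<open>\<Phi>\<close> on almost every line through \<open>p\<close>,
  starting at a simple root. By Hensel's lemma the coefficients of such a root depend polynomially
  on the direction \<open>v\<close>, and those of high order vanish identically.\<close>

lemma root_of_roots_on_lines:
  fixes \<Phi> :: "('v::linorder, complex) mpoly poly"
  assumes monic: "lead_coeff \<Phi> = 1" and "h \<noteq> 0"
    and lines: "\<And>v. mpoly_eval h v \<noteq> 0 \<Longrightarrow> \<exists>y. poly (map_poly (peval (\<lambda>c. [:c:]) (\<lambda>i. [:p i, v i:])) \<Phi>) y = 0 \<and>
        poly (map_poly (\<lambda>G. mpoly_eval G p) (pderiv \<Phi>)) (poly y 0) \<noteq> 0"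
  shows "\<exists>g. poly \<Phi> g = 0"
proof -
  let ?ev = "\<lambda>v G. mpoly_eval G v" and ?line = "\<lambda>v. peval (\<lambda>c. [:c:]) (\<lambda>i. [:p i, v i:])"
  \<comment> \<open>Restriction to the generic line through \<open>p\<close>, whose direction
    consists of the variables themselves: G(p + T x) as a polynomial in the line parameter
    T.\<close>
  define \<Lambda> :: "('v, complex) mpoly \<Rightarrow> _ poly" where "\<Lambda> = peval (\<lambda>c. [:Const c:]) (\<lambda>i. [:Const (p i), Var i:])"
  have r\<Lambda>: "ring_map \<Lambda>" unfolding \<Lambda>_def by (rule ring_map_peval[OF ring_map_Const_poly])
  have rev: "ring_map (?ev v)" for v by (rule ring_map_mpoly_eval)
  have rline: "ring_map (?line v)" for v by (rule ring_map_peval[OF ring_map_const_poly])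
  note rF = ring_map_comp[OF ring_map_fps_of_poly r\<Lambda>]
  define \<Psi> where "\<Psi> = map_poly (fps_of_poly \<circ> \<Lambda>) \<Phi>"
  have \<Lambda>0: "poly (\<Lambda> G) 0 = Const (mpoly_eval G p)" for G
    by (simp add: \<Lambda>_def mpoly_eval_eq_peval peval_comp[OF ring_map_poly] peval_comp[OF ring_map_Const])
  have line0: "poly (?line v G) 0 = mpoly_eval G p" for v G
    by (simp add: mpoly_eval_eq_peval peval_comp[OF ring_map_poly])
  have \<Lambda>v: "map_poly (?ev v) (\<Lambda> G) = ?line v G" for v G
    by (simp add: \<Lambda>_def peval_comp[OF ring_map_map_poly[OF rev]] map_poly_pCons mpoly_eval_Const mpoly_eval_Var
        ring_mapD[OF rev])
  define \<Phi>p where "\<Phi>p = map_poly (?ev p) \<Phi>"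
  \<comment> \<open>The possible initial values: the simple roots at \<open>p\<close>. They are
    finitely many, and each lifts to a power series root over the generic line.\<close>
  define Z where "Z = {\<eta>. poly \<Phi>p \<eta> = 0 \<and> poly (pderiv \<Phi>p) \<eta> \<noteq> 0}"
  have "coeff \<Phi>p (degree \<Phi>) = 1"
    by (simp add: \<Phi>p_def coeff_map_poly_ring rev monic ring_mapD[OF rev])
  then have "\<Phi>p \<noteq> 0" by auto
  then have "finite {\<eta>. poly \<Phi>p \<eta> = 0}" by (rule poly_roots_finite)
  then have finZ: "finite Z" by (rule rev_finite_subset) (auto simp: Z_def)
  have \<Psi>0: "fps_nth (poly (map_poly (fps_of_poly \<circ> \<Lambda>) q) (fps_const (Const \<eta>))) 0 = Const (poly (map_poly (?ev p) q) \<eta>)" for q \<eta>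
  proof -
    have "fps_nth (poly (map_poly (fps_of_poly \<circ> \<Lambda>) q) (fps_const (Const \<eta>))) 0 =
        poly (map_poly (\<lambda>G. Const (?ev p G)) q) (Const \<eta>)"
      using ring_map_map_poly_poly[OF ring_map_fps_nth_0, of "map_poly (fps_of_poly \<circ> \<Lambda>) q" "fps_const (Const \<eta>)"]
      by (simp add: map_poly_comp[OF ring_map_fps_nth_0 rF] \<Lambda>0[unfolded poly_0_coeff_0])
    also have "\<dots> = Const (poly (map_poly (?ev p) q) \<eta>)"
      by (rule ring_map_map_poly_poly[OF ring_map_Const, of "map_poly (?ev p) q" \<eta>, unfolded map_poly_comp[OF ring_map_Const rev], symmetric])
    finally show ?thesis .
  qed
  have "\<exists>s. fps_nth s 0 = Const \<eta> \<and> poly \<Psi> s = 0" if "\<eta> \<in> Z" for \<eta>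
  proof (rule hensel)
    show "fps_nth (poly \<Psi> (fps_const (Const \<eta>))) 0 = 0"
      using that by (simp add: \<Psi>_def \<Psi>0 Z_def \<Phi>p_def Const_simps)
    show "fps_nth (poly (pderiv \<Psi>) (fps_const (Const \<eta>))) 0 * Const (inverse (poly (pderiv \<Phi>p) \<eta>)) = 1"
      using that unfolding \<Psi>_def pderiv_map_poly[OF rF] \<Psi>0
      by (simp add: Z_def \<Phi>p_def pderiv_map_poly[OF rev] Const_simps(4)[symmetric] Const_simps(2))
  qed
  then have "\<forall>\<eta>\<in>Z. \<exists>s. fps_nth s 0 = Const \<eta> \<and> poly \<Psi> s = 0" by blast
  from bchoice[OF this] obtain S where
    S: "\<And>\<eta>. \<eta> \<in> Z \<Longrightarrow> fps_nth (S \<eta>) 0 = Const \<eta>" "\<And>\<eta>. \<eta> \<in> Z \<Longrightarrow> poly \<Psi> (S \<eta>) = 0" by blast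
  \<comment> \<open>A bound, independent of the direction, for the degrees in the line parameter of
    the coefficients of \<Phi>.\<close>
  define D where "D = (\<Sum>i\<le>degree \<Phi>. degree (\<Lambda> (coeff \<Phi> i)))"
  have D: "degree (coeff (map_poly (?line v) \<Phi>) i) \<le> D" for v i
  proof (cases "i \<le> degree \<Phi>")
    case True
    have "degree (coeff (map_poly (?line v) \<Phi>) i) = degree (map_poly (?ev v) (\<Lambda> (coeff \<Phi> i)))"
      by (simp add: coeff_map_poly_ring rline \<Lambda>v)
    also have "\<dots> \<le> degree (\<Lambda> (coeff \<Phi> i))" by (rule degree_le) (simp add: coeff_map_poly_ring[OF rev] coeff_eq_0 ring_mapD[OF rev])
    also have "\<dots> \<le> D" unfolding D_def using True by (intro member_le_sum) auto
    finally show ?thesis .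
  next
    case False
    then show ?thesis by (simp add: coeff_map_poly_ring rline coeff_eq_0 ring_mapD[OF rline])
  qed
  have deg: "degree (map_poly (?line v) \<Phi>) = degree \<Phi>" for v
    using monic by (intro antisym degree_le le_degree)
      (simp_all add: coeff_map_poly_ring[OF rline] coeff_eq_0 ring_mapD[OF rline])
  have key: "\<exists>\<eta>\<in>Z. \<forall>k>D. mpoly_eval (fps_nth (S \<eta>) k) v = 0" if v: "mpoly_eval h v \<noteq> 0" for v
  proof -
    obtain y where y: "poly (map_poly (?line v) \<Phi>) y = 0"
      "poly (map_poly (?ev p) (pderiv \<Phi>)) (poly y 0) \<noteq> 0" using lines[OF v] by blast
    have "degree y \<le> D"
      using y(1) by (rule monic_root_degree[rotated]) (simp_all only: deg coeff_map_poly_ring[OF rline] monic ring_mapD[OF rline] D[unfolded coeff_map_poly_ring[OF rline]])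
    have "poly \<Phi>p (poly y 0) = 0"
      using arg_cong[OF y(1), of "\<lambda>q. poly q 0"] ring_map_map_poly_poly[OF ring_map_poly[of "0::complex"], of "map_poly (?line v) \<Phi>" y]
      by (simp add: map_poly_comp[OF ring_map_poly rline] line0 \<Phi>p_def)
    then have Z: "poly y 0 \<in> Z"
      using y(2) by (simp add: Z_def \<Phi>p_def pderiv_map_poly[OF rev])
    let ?\<Xi> = "map_poly (\<lambda>G. fps_of_poly (?line v G)) \<Phi>"
    have rX: "ring_map (\<lambda>G. fps_of_poly (?line v G))"
      using ring_map_comp[OF ring_map_fps_of_poly rline, of v] by (simp add: o_def)
    \<comment> \<open>The polynomial root on this line and the specialisation of the generic series
      solve the same equation with the same simple initial value.\<close>
    have "fps_of_poly y = fps_map (?ev v) (S (poly y 0))"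
    proof (rule sym, rule hensel_unique)
      show "poly ?\<Xi> (fps_of_poly y) = 0"
        using ring_map_map_poly_poly[OF ring_map_fps_of_poly, of "map_poly (?line v) \<Phi>" y] y(1)
        by (simp add: map_poly_comp[OF ring_map_fps_of_poly rline])
      have "poly (map_poly (fps_map (?ev v)) \<Psi>) (fps_map (?ev v) (S (poly y 0))) = 0"
        using ring_map_map_poly_poly[OF ring_map_fps_map[OF rev], of v \<Psi> "S (poly y 0)"]
        by (simp add: S(2)[OF Z] ring_mapD[OF ring_map_fps_map[OF rev]])
      then show "poly ?\<Xi> (fps_map (?ev v) (S (poly y 0))) = 0"
        by (simp add: \<Psi>_def map_poly_comp[OF ring_map_fps_map[OF rev] rF] fps_map_fps_of_poly[OF rev] \<Lambda>v)
      show "fps_nth (fps_map (?ev v) (S (poly y 0))) 0 = fps_nth (fps_of_poly y) 0"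
        by (simp add: fps_nth_map S(1)[OF Z[unfolded poly_0_coeff_0]] mpoly_eval_Const poly_0_coeff_0)
      have "fps_nth (poly (pderiv ?\<Xi>) (fps_of_poly y)) 0 = poly (map_poly (?ev p) (pderiv \<Phi>)) (poly y 0)"
        unfolding pderiv_map_poly[OF rX]
        using ring_map_map_poly_poly[OF ring_map_fps_nth_0, of "map_poly (\<lambda>G. fps_of_poly (?line v G)) (pderiv \<Phi>)" "fps_of_poly y"]
        by (simp add: map_poly_comp[OF ring_map_fps_nth_0 rX] line0[unfolded poly_0_coeff_0] poly_0_coeff_0)
      then show "fps_nth (poly (pderiv ?\<Xi>) (fps_of_poly y)) 0 \<noteq> 0" using y(2) by simp
    qed
    then have "mpoly_eval (fps_nth (S (poly y 0)) k) v = coeff y k" for k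
      by (metis fps_nth_map fps_of_poly_nth)
    then show ?thesis using Z \<open>degree y \<le> D\<close> by (intro bexI[of _ "poly y 0"]) (simp_all add: coeff_eq_0)
  qed
  \<comment> \<open>Otherwise each initial value has a nonzero coefficient of order above
    \<open>D\<close>. The product of these with \<open>h\<close> is nonzero at some direction, and
    \<open>key\<close> fails there.\<close>
  have "\<exists>\<eta>\<in>Z. \<forall>k>D. fps_nth (S \<eta>) k = 0"
  proof (rule ccontr)
    assume "\<not> ?thesis"
    then have "\<forall>\<eta>\<in>Z. \<exists>k. k > D \<and> fps_nth (S \<eta>) k \<noteq> 0" by blast
    from bchoice[OF this] obtain k where
      k: "\<And>\<eta>. \<eta> \<in> Z \<Longrightarrow> k \<eta> > D" "\<And>\<eta>. \<eta> \<in> Z \<Longrightarrow> fps_nth (S \<eta>) (k \<eta>) \<noteq> 0" by blast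
    have "h * (\<Prod>\<eta>\<in>Z. fps_nth (S \<eta>) (k \<eta>)) \<noteq> 0"
      using \<open>h \<noteq> 0\<close> k(2) finZ by simp
    then obtain v where v: "mpoly_eval (h * (\<Prod>\<eta>\<in>Z. fps_nth (S \<eta>) (k \<eta>))) v \<noteq> 0"
      using mpoly_nonvanishing[OF infinite_UNIV_char_0] by blast
    then have "mpoly_eval h v \<noteq> 0" "\<And>\<eta>. \<eta> \<in> Z \<Longrightarrow> mpoly_eval (fps_nth (S \<eta>) (k \<eta>)) v \<noteq> 0"
      using finZ by (auto simp: mpoly_eval_mult ring_map_prod[OF rev])
    then show False using key[of v] k(1) by blast
  qed
  then obtain \<eta> where \<eta>: "\<eta> \<in> Z" "\<And>k. k > D \<Longrightarrow> fps_nth (S \<eta>) k = 0" by blast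
  define Q where "Q = Abs_poly (fps_nth (S \<eta>))"
  have "coeff Q = fps_nth (S \<eta>)"
    unfolding Q_def using \<eta>(2) by (intro coeff_Abs_poly[of D]) auto
  then have Q: "fps_of_poly Q = S \<eta>" by (simp add: fps_eq_iff)
  have "fps_of_poly (poly (map_poly \<Lambda> \<Phi>) Q) = 0"
    using S(2)[OF \<eta>(1)] ring_map_map_poly_poly[OF ring_map_fps_of_poly, of "map_poly \<Lambda> \<Phi>" Q]
    by (simp add: \<Psi>_def Q map_poly_comp[OF ring_map_fps_of_poly r\<Lambda>] o_def)
  then have "poly (map_poly \<Lambda> \<Phi>) Q = 0" by (simp add: fps_eq_iff poly_eq_iff)
  then have 1: "poly (map_poly (\<lambda>G. poly (\<Lambda> G) 1) \<Phi>) (poly Q 1) = 0"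
    using ring_map_map_poly_poly[OF ring_map_poly[of "1 :: ('v, complex) mpoly"], of "map_poly \<Lambda> \<Phi>" Q]
    by (simp add: map_poly_comp[OF ring_map_poly r\<Lambda>])
  \<comment> \<open>At line parameter 1 the generic line gives G(p + x); this translation undoes the
    shift by \<open>p\<close>.\<close>
  define T where "T = peval Const (\<lambda>i. Var i - Const (p i) :: ('v, complex) mpoly)"
  have rT: "ring_map T" unfolding T_def by (rule ring_map_peval[OF ring_map_Const])
  have "ring_map (\<lambda>G. poly (\<Lambda> G) 1)"
    using ring_map_comp[OF ring_map_poly[of "1 :: ('v, complex) mpoly"] r\<Lambda>] by (simp add: o_def)
  note 2 = map_poly_comp[OF rT this, of \<Phi>]
  have "T (poly (\<Lambda> G) 1) = G" for G
  proof -
    have "T (poly (\<Lambda> G) 1) = peval (\<lambda>c. T (poly [:Const c:] 1)) (\<lambda>i. T (poly [:Const (p i), Var i:] 1)) G"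
      unfolding \<Lambda>_def by (simp only: peval_comp[OF ring_map_poly] peval_comp[OF rT])
    also have "\<dots> = peval Const Var G"
      by (simp add: ring_mapD[OF rT]) (simp add: T_def peval_Const peval_Var ring_map_Const)
    finally show ?thesis by (simp add: peval_Const_Var)
  qed
  then have "poly \<Phi> (T (poly Q 1)) = 0"
    using ring_map_map_poly_poly[OF rT, of "map_poly (\<lambda>G. poly (\<Lambda> G) 1) \<Phi>" "poly Q 1"] 1 2
    by (simp add: ring_mapD[OF rT])
  then show ?thesis ..
qed

subsection \<open>The Nullstellensatz over the complex numbers\<close>

lemma lookup_Const_mult: "Poly_Mapping.lookup (Const c * f) \<alpha> = c * Poly_Mapping.lookup f \<alpha>"
  for f :: "('v, 'k::comm_ring_1) mpoly"
proof -
  have "Poly_Mapping.lookup (Poly_Mapping.map ((*) c) f) \<alpha> = c * Poly_Mapping.lookup f \<alpha>"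
    by (simp add: Poly_Mapping.map.rep_eq when_def)
  then show ?thesis by (simp only: mult_map_scale_conv_mult Const_def)
qed

lemma lookup_le_mon_degree: "Poly_Mapping.lookup \<alpha> v \<le> mon_degree \<alpha>"
proof (cases "v \<in> Poly_Mapping.keys \<alpha>")
  case True
  then show ?thesis unfolding mon_degree_def by (intro member_le_sum) auto
qed (simp add: in_keys_iff)

lemma finite_exponents:
  assumes "finite A" shows "finite {\<alpha>. Poly_Mapping.keys \<alpha> \<subseteq> A \<and> mon_degree \<alpha> \<le> N}" (is "finite ?E")
proof (rule finite_imageD)
  let ?r = "\<lambda>\<alpha>. \<lambda>v\<in>A. Poly_Mapping.lookup \<alpha> v"
  have "Poly_Mapping.lookup \<alpha> v \<le> N" if "mon_degree \<alpha> \<le> N" for \<alpha> v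
    using lookup_le_mon_degree[of \<alpha> v] that by linarith
  then have "?r ` ?E \<subseteq> A \<rightarrow>\<^sub>E {..N}" by auto
  moreover have "finite (A \<rightarrow>\<^sub>E {..N})" using assms by (intro finite_PiE) auto
  ultimately show "finite (?r ` ?E)" by (rule finite_subset)
  show "inj_on ?r ?E"
  proof (rule inj_onI)
    fix \<alpha> \<beta> assume "\<alpha> \<in> ?E" "\<beta> \<in> ?E" and eq: "?r \<alpha> = ?r \<beta>"
    then have out: "Poly_Mapping.lookup \<alpha> v = 0" "Poly_Mapping.lookup \<beta> v = 0" if "v \<notin> A" for v
      using that by (auto simp: in_keys_iff subset_iff)
    have "Poly_Mapping.lookup \<alpha> v = Poly_Mapping.lookup \<beta> v" for v
      using fun_cong[OF eq, of v] out[of v] by (cases "v \<in> A") auto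
    then show "\<alpha> = \<beta>" by (rule poly_mapping_eqI)
  qed
qed

text \<open>The inverses of \<open>x\<^sub>v - a\<close> modulo a maximal ideal, for the uncountably many
  complex numbers \<open>a\<close>, would be linearly independent in a space of countable dimension.\<close>

lemma nullstellensatz:
  fixes I :: "('v::countable, complex) mpoly set"
  assumes I: "is_ideal I" "1 \<notin> I"
  shows "\<exists>z. \<forall>f\<in>I. mpoly_eval f z = 0"
proof -
  have "I \<inter> {1} = {}" using I(2) by simp
  from exists_maximal_disjoint_ideal[OF I(1) this] obtain M where
    M: "is_ideal M" "I \<subseteq> M" "1 \<notin> M"
    and max: "\<forall>J. is_ideal J \<and> M \<subseteq> J \<and> J \<inter> {1} = {} \<longrightarrow> J = M"
    by (elim exE conjE) simp
  have inv: "\<exists>h. 1 - h * a \<in> M" if "a \<notin> M" for a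
  proof (rule ccontr)
    assume *: "\<not> ?thesis"
    let ?J = "gen_ideal M (\<lambda>_. a) {()}"
    have "1 \<notin> ?J" using * by (simp add: gen_ideal_single)
    moreover have "M \<subseteq> ?J" by (intro subsetI subset_gen_ideal)
    ultimately have "?J = M" using max gen_ideal_is_ideal[OF M(1), of "\<lambda>_. a" "{()}"] by simp
    moreover have "a \<in> ?J" using gen_ideal_gen[OF M(1), of "{()}" "()" "\<lambda>_. a"] by simp
    ultimately show False using that by simp
  qed
  have prime: "b \<in> M" if ab: "a * b \<in> M" "a \<notin> M" for a b
  proof -
    obtain h where h: "1 - h * a \<in> M" using inv[OF ab(2)] ..
    have "b * (1 - h * a) + h * (a * b) \<in> M"
      by (rule is_idealD(2)[OF M(1) is_idealD(3)[OF M(1) h] is_idealD(3)[OF M(1) ab(1)]])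
    moreover have eq: "b * (1 - h * a) + h * (a * b) = b" by (simp add: algebra_simps)
    ultimately show ?thesis unfolding eq by blast
  qed
  have "\<exists>c. Var v - Const c \<in> M" for v
  proof (rule ccontr)
    assume "\<nexists>c. Var v - Const c \<in> M"
    then have nM: "Var v - Const c \<notin> M" for c by blast
    \<comment> \<open>Since complex polynomials split into linear factors, x_v is transcendental
      modulo \<open>M\<close>.\<close>
    have no_poly: "poly (map_poly Const p) (Var v) \<notin> M" if "p \<noteq> 0" for p
      using that
    proof (induction "degree p" arbitrary: p)
      case 0
      then obtain c where "p = [:c:]" "c \<noteq> 0" by (metis degree_eq_zeroE pCons_0_0)
      then show ?case using ideal_Const[OF M(1), of c] M(3) by (auto simp: map_poly_pCons Const_simps)
    next
      case (Suc n)
      then obtain z where "poly p z = 0" using alg_closed_imp_poly_has_root[of p] by auto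
      then obtain q where q: "p = [:- z, 1:] * q" by (metis dvdE poly_eq_0_iff_dvd)
      with \<open>p \<noteq> 0\<close> have "q \<noteq> 0" "degree p = Suc (degree q)"
        by (auto simp del: mult_pCons_left simp: degree_mult_eq)
      then have *: "poly (map_poly Const q) (Var v) \<notin> M" using Suc by simp
      have "poly (map_poly Const p) (Var v) = (Var v - Const z) * poly (map_poly Const q) (Var v)"
        unfolding q ring_mapD(4)[OF ring_map_map_poly[OF ring_map_Const]] poly_mult
        by (simp add: map_poly_pCons Const_simps)
      then show ?case using prime[of "Var v - Const z", OF _ nM] * by auto
    qed
    have "\<forall>a. \<exists>g. 1 - g * (Var v - Const a) \<in> M" using inv[OF nM] by blast
    then obtain g where g: "\<And>a. 1 - g a * (Var v - Const a) \<in> M" by (metis choice)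
    let ?A = "\<lambda>N. {w :: 'v. to_nat w < N}"
    have "\<exists>N. g a \<in> mpolys (?A N) \<and> deg_le (g a) N" for a
    proof -
      obtain A s where A: "finite A" "g a \<in> mpolys A" and s: "deg_le (g a) s"
        using finite_vars[of "g a"] deg_le_exists[of "g a"] by auto
      define N where "N = max s (Suc (Max (to_nat ` A)))"
      have "A \<subseteq> ?A N"
      proof
        fix w assume "w \<in> A"
        then have "to_nat w \<le> Max (to_nat ` A)" using A(1) by simp
        then show "w \<in> ?A N" by (simp add: N_def)
      qed
      then show ?thesis using A(2) s
        by (intro exI[of _ N]) (auto simp: N_def intro: mpolys_mono deg_le_mono)
    qed
    then have "\<forall>a. \<exists>N. g a \<in> mpolys (?A N) \<and> deg_le (g a) N" by blast
    from choice[OF this] obtain N where N: "\<And>a. g a \<in> mpolys (?A (N a)) \<and> deg_le (g a) (N a)" by blast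
    \<comment> \<open>The bounds are natural numbers and C is uncountable, so infinitely many
      inverses lie in one space spanned by finitely many monomials.\<close>
    have "\<exists>n. infinite {a. N a = n}"
    proof (rule ccontr)
      assume "\<not> ?thesis"
      then have "countable (\<Union>n. {a. N a = n})" by (intro countable_UN) (auto intro: countable_finite)
      moreover have "(\<Union>n. {a. N a = n}) = UNIV" by auto
      ultimately show False using uncountable_UNIV_complex by simp
    qed
    then obtain n where n: "infinite {a. N a = n}" ..
    define E :: "('v \<Rightarrow>\<^sub>0 nat) set" where "E = {\<alpha>. Poly_Mapping.keys \<alpha> \<subseteq> ?A n \<and> mon_degree \<alpha> \<le> n}"
    have "finite (?A n)"
      using finite_vimageI[OF finite_lessThan[of n] inj_to_nat[where 'a = 'v]] by (simp add: vimage_def)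
    then have E: "finite E" unfolding E_def by (rule finite_exponents)
    obtain D where D: "D \<subseteq> {a. N a = n}" "finite D" "card D = Suc (card E)"
      using infinite_arbitrarily_large[OF n] by blast
    from more_unknowns_than_equations[OF E D(2), of "\<lambda>a. Poly_Mapping.lookup (g a)"] D(3)
    obtain x where x: "\<exists>a\<in>D. x a \<noteq> 0" "\<And>\<alpha>. \<alpha> \<in> E \<Longrightarrow> (\<Sum>a\<in>D. x a * Poly_Mapping.lookup (g a) \<alpha>) = 0" by auto
    have "(\<Sum>a\<in>D. Const (x a) * g a) = 0"
    proof (rule poly_mapping_eqI)
      fix \<alpha>
      have "(\<Sum>a\<in>D. x a * Poly_Mapping.lookup (g a) \<alpha>) = 0"
      proof (cases "\<alpha> \<in> E")
        case False
        have "Poly_Mapping.lookup (g a) \<alpha> = 0" if "a \<in> D" for a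
        proof (rule ccontr)
          assume "Poly_Mapping.lookup (g a) \<alpha> \<noteq> 0"
          then have "\<alpha> \<in> Poly_Mapping.keys (g a)" by (simp add: in_keys_iff)
          moreover have "N a = n" using D(1) that by blast
          ultimately show False using N[of a] False by (simp add: E_def mpolys_def deg_le_def)
        qed
        then show ?thesis by simp
      qed (rule x(2))
      then show "Poly_Mapping.lookup (\<Sum>a\<in>D. Const (x a) * g a) \<alpha> = Poly_Mapping.lookup 0 \<alpha>"
        by (simp add: lookup_sum lookup_Const_mult)
    qed
    \<comment> \<open>Multiplication by all x_v - b turns the linear dependence of the inverses into
      a polynomial equation for x_v modulo \<open>M\<close>.\<close>
    then have "(\<Sum>a\<in>D. Const (x a) * g a) * (\<Prod>b\<in>D. Var v - Const b) \<in> M"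
      using is_idealD(1)[OF M(1)] by simp
    then have 0: "(\<Sum>a\<in>D. Const (x a) * g a * (\<Prod>b\<in>D. Var v - Const b)) \<in> M"
      by (simp only: sum_distrib_right)
    define p where "p = (\<Sum>a\<in>D. smult (x a) (\<Prod>b\<in>D - {a}. [:- b, 1:]))"
    have "poly (map_poly Const p) (Var v) = (\<Sum>a\<in>D. Const (x a) * (\<Prod>b\<in>D - {a}. Var v - Const b))"
    proof -
      have *: "ring_map (\<lambda>p. poly (map_poly Const p) (Var v))"
        using ring_map_comp[OF ring_map_poly ring_map_map_poly[OF ring_map_Const]] by (simp add: o_def)
      have "p = (\<Sum>a\<in>D. [:x a:] * (\<Prod>b\<in>D - {a}. [:- b, 1:]))" by (simp add: p_def)
      then show ?thesis
        by (simp only: ring_map_sum[OF *] ring_mapD[OF *] ring_map_prod[OF *])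
          (simp add: map_poly_pCons Const_simps)
    qed
    note p_eq = this
    have diff: "(\<Sum>a\<in>D. Const (x a) * (\<Prod>b\<in>D - {a}. Var v - Const b))
        - (\<Sum>a\<in>D. Const (x a) * g a * (\<Prod>b\<in>D. Var v - Const b)) \<in> M"
      unfolding sum_subtractf[symmetric]
    proof (rule ideal_sum[OF M(1)])
      fix a assume "a \<in> D"
      with D(2) have "(\<Prod>b\<in>D. Var v - Const b) = (Var v - Const a) * (\<Prod>b\<in>D - {a}. Var v - Const b)"
        by (rule prod.remove)
      then have "Const (x a) * (\<Prod>b\<in>D - {a}. Var v - Const b) - Const (x a) * g a * (\<Prod>b\<in>D. Var v - Const b)
          = Const (x a) * (\<Prod>b\<in>D - {a}. Var v - Const b) * (1 - g a * (Var v - Const a))"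
        by (simp only:) (simp add: algebra_simps)
      then show "Const (x a) * (\<Prod>b\<in>D - {a}. Var v - Const b) - Const (x a) * g a * (\<Prod>b\<in>D. Var v - Const b) \<in> M"
        by (simp only: is_idealD(3)[OF M(1) g])
    qed
    have "poly (map_poly Const p) (Var v) \<in> M"
      unfolding p_eq using 0 ideal_cong_mem[OF M(1) diff] by blast
    moreover have "p \<noteq> 0"
    proof -
      obtain a where a: "a \<in> D" "x a \<noteq> 0" using x(1) by blast
      \<comment> \<open>As in Lagrange interpolation, only the summand belonging to the node
        \<open>a\<close> survives at \<open>a\<close>.\<close>
      have "poly p a = (\<Sum>c\<in>D. if c = a then x a * (\<Prod>b\<in>D - {a}. a - b) else 0)"
        unfolding p_def poly_sum
      proof (rule sum.cong[OF refl])
        fix c assume "c \<in> D"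
        then show "poly (smult (x c) (\<Prod>b\<in>D - {c}. [:- b, 1:])) a = (if c = a then x a * (\<Prod>b\<in>D - {a}. a - b) else 0)"
          using a(1) D(2) prod_zero[of "D - {c}" "\<lambda>b. a - b"] by (cases "c = a") (auto simp: poly_prod)
      qed
      then have "poly p a \<noteq> 0" using a D(2) by simp
      then show ?thesis by auto
    qed
    ultimately show False using no_poly by blast
  qed
  then have "\<forall>v. \<exists>c. Var v - Const c \<in> M" by blast
  from choice[OF this] obtain z where z: "\<And>v. Var v - Const (z v) \<in> M" by blast
  have "mpoly_eval f z = 0" if "f \<in> I" for f
  proof (rule ccontr)
    assume nz: "mpoly_eval f z \<noteq> 0"
    have "peval Const Var f - peval Const (\<lambda>v. Const (z v)) f \<in> M"
      by (rule ideal_cong_peval[OF M(1) mpolys_UNIV z])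
    then have "f - Const (mpoly_eval f z) \<in> M"
      by (simp add: peval_Const_Var mpoly_eval_eq_peval peval_comp[OF ring_map_Const])
    then have "Const (mpoly_eval f z) \<in> M" using ideal_cong_mem[OF M(1)] that M(2) by blast
    then show False using ideal_Const[OF M(1) _ nz] M(3) by blast
  qed
  then show ?thesis by blast
qed

text \<open>Otherwise the ideal would have a zero with \<open>x\<^sub>v = 1\<close>.\<close>

lemma hom_nullstellensatz:
  fixes I :: "('v::countable, complex) mpoly set"
  assumes I: "hom_ideal I" and zero: "\<And>z. \<forall>f\<in>I. mpoly_eval f z = 0 \<Longrightarrow> z v = 0"
  shows "\<exists>M. Var v ^ M \<in> I"
proof -
  note Ii = hom_idealD(1)[OF I]
  let ?J = "gen_ideal I (\<lambda>_. Var v - 1) {()}"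
  have "1 \<in> ?J"
  proof (rule ccontr)
    assume "1 \<notin> ?J"
    from nullstellensatz[OF gen_ideal_is_ideal[OF Ii] this] obtain z where z: "\<forall>f\<in>?J. mpoly_eval f z = 0" ..
    then have "z v = 0" using zero subset_gen_ideal by blast
    moreover have "Var v - 1 \<in> ?J" using gen_ideal_gen[OF Ii, of "{()}" "()" "\<lambda>_. Var v - 1"] by simp
    then have "mpoly_eval (Var v - 1) z = 0" using z by blast
    then have "z v = 1"
      by (simp add: ring_map_diff[OF ring_map_mpoly_eval] ring_mapD[OF ring_map_mpoly_eval] mpoly_eval_Var)
    ultimately show False by simp
  qed
  \<comment> \<open>Compared degree by degree, 1 = h (x_v - 1) modulo \<open>I\<close> says that the
    component of \<open>h\<close> in degree s is -x_v^s. Beyond the degree of \<open>h\<close> it is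
    zero.\<close>
  then obtain h where "1 - h * (Var v - 1) \<in> I" by (auto simp: gen_ideal_single)
  then have h: "hom_part s (1 - h * Var v + h) \<in> I" for s
    using hom_idealD(2)[OF I] by (simp add: algebra_simps)
  have one: "hom_part s (1 :: ('v, complex) mpoly) = (if s = 0 then 1 else 0)" for s
    by (rule hom_part_homogeneous[OF homogeneous_one])
  have *: "hom_part s h + Var v ^ s \<in> I" for s
  proof (induction s)
    case 0
    show ?case
      using h[of 0] by (simp add: one hom_part_add hom_part_diff hom_part_mult_homogeneous[OF homogeneous_Var] add.commute)
  next
    case (Suc s)
    have "hom_part (Suc s) h - hom_part s h * Var v \<in> I"
      using h[of "Suc s"] by (simp add: one hom_part_add hom_part_diff hom_part_mult_homogeneous[OF homogeneous_Var])
    from is_idealD(2)[OF Ii this is_idealD(4)[OF Ii Suc, of "Var v"]] show ?case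
      by (simp add: algebra_simps)
  qed
  obtain N where "deg_le h N" using deg_le_exists by blast
  then have "Poly_Mapping.keys (hom_part (Suc N) h) = {}" by (auto simp: keys_hom_part deg_le_def)
  then have "hom_part (Suc N) h = 0" by simp
  then have "Var v ^ Suc N \<in> I" using *[of "Suc N"] by (simp del: power_Suc)
  then show ?thesis by blast
qed

subsection \<open>Chains of irreducible closed sets\<close>

text \<open>Going down one prime adds one independent element. In a relation read as a polynomial in
  \<open>f\<close>, the constant coefficient lies in \<open>J\<close> and hence is zero;
  \<open>f\<close> can then be cancelled modulo the prime \<open>I\<close>, and the argument
  repeats.\<close>

lemma independent_mod_extend:
  fixes g :: "nat \<Rightarrow> ('v, 'k::comm_ring_1) mpoly"
  assumes I: "is_prime I" and J: "I \<subseteq> J" "is_ideal J" and g: "independent_mod J g {..<n}"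
    and f: "f \<in> J" "f \<notin> I"
  shows "independent_mod I (g(n := f)) {..<Suc n}"
  unfolding independent_mod_def
proof (intro ballI impI)
  fix G :: "(nat, 'k) mpoly" assume G: "G \<in> mpolys {..<Suc n}" "peval Const (g(n := f)) G \<in> I"
  have strip: "q = 0" if "poly (map_poly (peval Const g) q) f \<in> I" "\<And>i. coeff q i \<in> mpolys {..<n}" for q
    using that
  proof (induction q)
    case (pCons a q)
    let ?r = "poly (map_poly (peval Const g) q) f"
    have eq: "peval Const g a + f * ?r \<in> I"
      using pCons.prems(1) by (simp add: map_poly_pCons ring_mapD[OF ring_map_peval[OF ring_map_Const]])
    then have "peval Const g a - - (f * ?r) \<in> J" using J by auto
    then have "peval Const g a \<in> J"
      using ideal_cong_mem[OF J(2)] is_idealD(4,5)[OF J(2)] f(1) by metis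
    moreover have "a \<in> mpolys {..<n}" using pCons.prems(2)[of 0] by simp
    ultimately have a: "a = 0" using g by (simp add: independent_mod_def)
    then have "f * ?r \<in> I" using eq by (simp add: ring_mapD[OF ring_map_peval[OF ring_map_Const]])
    then have "?r \<in> I" using is_primeD(3)[OF I] f(2) by blast
    moreover have "coeff q i \<in> mpolys {..<n}" for i using pCons.prems(2)[of "Suc i"] by simp
    ultimately show ?case using pCons.IH a by simp
  qed simp
  have "unpack n G = 0"
  proof (rule strip)
    show "poly (map_poly (peval Const g) (unpack n G)) f \<in> I"
      using G(2) by (simp add: poly_unpack ring_map_Const)
    show "coeff (unpack n G) i \<in> mpolys {..<n}" for i
      using G(1) by (intro coeff_unpack_in_mpolys) (simp add: lessThan_Suc)
  qed
  then show "G = 0" by (rule unpack_inj)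
qed

lemma homogeneous_0_Const: "homogeneous 0 f \<Longrightarrow> f = Const (Poly_Mapping.lookup f 0)"
proof (rule poly_mapping_eqI)
  fix \<alpha> assume f: "homogeneous 0 f"
  show "Poly_Mapping.lookup f \<alpha> = Poly_Mapping.lookup (Const (Poly_Mapping.lookup f 0)) \<alpha>"
  proof (cases "\<alpha> = 0")
    case False
    then obtain v where v: "v \<in> Poly_Mapping.keys \<alpha>" by (metis ex_in_conv keys_eq_empty)
    have "mon_degree \<alpha> \<noteq> 0" using v lookup_le_mon_degree[of \<alpha> v] by (auto simp: in_keys_iff)
    then have "\<alpha> \<notin> Poly_Mapping.keys f" using f by (auto simp: homogeneous_def)
    then show ?thesis using False by (simp add: Const_def lookup_single in_keys_iff)
  qed (simp add: Const_def)
qed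

text \<open>Beyond \<open>I 0\<close> the chain is prolonged by the ideal of the origin, which
  contains every proper homogeneous ideal and also x_v. This extra step is why r inclusions yield r
  + 1 independent elements, as befits the cone.\<close>

lemma independent_of_prime_chain:
  fixes I :: "nat \<Rightarrow> ('v, 'k::field) mpoly set"
  assumes I: "\<And>i. i \<le> r \<Longrightarrow> is_prime (I i)" "hom_ideal (I 0)" "Var v \<notin> I 0"
    and step: "\<And>i. i < r \<Longrightarrow> I (Suc i) \<subseteq> I i \<and> (\<exists>f. f \<in> I i \<and> f \<notin> I (Suc i))"
  shows "\<exists>g. independent_mod (I r) g {..<Suc r}"
  using I(1) step
proof (induction r)
  case 0
  let ?J = "{f :: ('v, 'k) mpoly. mpoly_eval f (\<lambda>_. 0) = 0}"
  note r = ring_mapD[OF ring_map_mpoly_eval[of "\<lambda>_. 0 :: 'k"]]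
  have J: "is_ideal ?J" by (rule is_idealI) (simp_all add: r)
  have "I 0 \<subseteq> ?J"
  proof
    fix f assume f: "f \<in> I 0"
    obtain N where N: "f = (\<Sum>s\<le>N. hom_part s f)" by (rule sum_hom_part)
    have "mpoly_eval (hom_part s f) (\<lambda>_. 0) = 0" for s
    proof (cases s)
      case 0
      have "hom_part 0 f = Const (Poly_Mapping.lookup (hom_part 0 f) 0)"
        by (rule homogeneous_0_Const[OF homogeneous_hom_part])
      then have "Poly_Mapping.lookup (hom_part 0 f) 0 = 0"
        using ideal_Const[OF hom_idealD(1)[OF I(2)]] hom_idealD(2)[OF I(2) f, of 0] is_primeD(2)[OF I(1), of 0]
        by (metis le0)
      then show ?thesis using \<open>hom_part 0 f = _\<close> 0 by (simp add: Const_simps r)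
    next
      case (Suc n)
      then show ?thesis
        using mpoly_eval_homogeneous_scale[OF homogeneous_hom_part, of s f "0::'k" "\<lambda>_. 0"] by simp
    qed
    then have "mpoly_eval f (\<lambda>_. 0) = 0" by (subst N) (simp add: mpoly_eval_sum)
    then show "f \<in> ?J" by simp
  qed
  moreover have "independent_mod ?J g {..<0}" for g :: "nat \<Rightarrow> ('v, 'k) mpoly"
    unfolding independent_mod_def
  proof (intro ballI impI)
    fix G :: "(nat, 'k) mpoly" assume G: "G \<in> mpolys {..<0}" "peval Const g G \<in> ?J"
    have "peval Const g G = peval Const (\<lambda>i. Const 0) G"
      by (rule peval_cong[OF G(1)]) simp
    also have "\<dots> = Const (mpoly_eval G (\<lambda>_. 0))"
      by (simp add: mpoly_eval_eq_peval peval_comp[OF ring_map_Const])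
    finally have *: "mpoly_eval G (\<lambda>_. 0) = 0" using G(2) by (simp add: mpoly_eval_Const)
    have "homogeneous 0 G" using G(1) by (auto simp: homogeneous_def mpolys_def mon_degree_def)
    from homogeneous_0_Const[OF this] * show "G = 0" by (metis Const_simps(1) mpoly_eval_Const)
  qed
  ultimately show ?case
    using I(3) 0(1)[of 0] J
    by (intro exI) (rule independent_mod_extend[where J = ?J and f = "Var v"], simp_all add: mpoly_eval_Var)
next
  case (Suc r)
  obtain g where g: "independent_mod (I r) g {..<Suc r}" using Suc.IH Suc.prems by (meson le_SucI less_SucI)
  obtain f where f: "I (Suc r) \<subseteq> I r" "f \<in> I r" "f \<notin> I (Suc r)" using Suc.prems(2)[of r] by blast
  have "is_prime (I (Suc r))" "is_ideal (I r)"
    using Suc.prems(1)[of "Suc r"] is_primeD(1)[OF Suc.prems(1)[of r]] by simp_all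
  then show ?case using independent_mod_extend[OF _ f(1) _ g f(2,3)] by blast
qed

section \<open>Vanishing ideals of sets of projective points\<close>

definition vanishing :: "('v \<Rightarrow> 'k::field) set set \<Rightarrow> ('v, 'k) mpoly set" where
  "vanishing Z = {f. \<forall>p\<in>Z. \<forall>x\<in>p. mpoly_eval f x = 0}"

lemma vanishing_is_ideal: "is_ideal (vanishing Z)"
  by (rule is_idealI) (simp_all add: vanishing_def ring_mapD[OF ring_map_mpoly_eval])

lemma proj_space_scale: "p \<in> proj_space V \<Longrightarrow> x \<in> p \<Longrightarrow> c \<noteq> 0 \<Longrightarrow> (\<lambda>v. c * x v) \<in> p"
  by (force simp: proj_space_def proj_point_def mult.assoc[symmetric])

lemma proj_space_outside: "p \<in> proj_space V \<Longrightarrow> x \<in> p \<Longrightarrow> v \<notin> V \<Longrightarrow> x v = 0"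
  by (auto simp: proj_space_def proj_point_def)

lemma proj_space_nonempty: "p \<in> proj_space V \<Longrightarrow> \<exists>x. x \<in> p \<and> (\<exists>v. x v \<noteq> 0)"
proof -
  assume "p \<in> proj_space V"
  then obtain x where x: "p = proj_point x" "\<exists>v. x v \<noteq> 0" by (auto simp: proj_space_def)
  have "x = (\<lambda>v. 1 * x v) \<and> (1 :: 'b) \<noteq> 0" by simp
  then have "x \<in> p" unfolding x(1) proj_point_def by blast
  then show ?thesis using x(2) by blast
qed

lemma proj_space_homogeneous:
  assumes "p \<in> proj_space V" "homogeneous s f" "x \<in> p" "y \<in> p" "mpoly_eval f x = 0"
  shows "mpoly_eval f y = 0"
proof -
  obtain z c d where "x = (\<lambda>v. c * z v)" "y = (\<lambda>v. d * z v)" "c \<noteq> 0"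
    using assms(1,3,4) by (auto simp: proj_space_def proj_point_def)
  then show ?thesis using assms(5) by (simp add: mpoly_eval_homogeneous_scale[OF assms(2)])
qed

text \<open>At a point x of the cone, f(c x) is a polynomial in c whose coefficients are the values
  of the components of \<open>f\<close>. It vanishes for all nonzero c, hence identically.\<close>

lemma hom_ideal_vanishing:
  fixes Z :: "('v \<Rightarrow> 'k::field_char_0) set set"
  assumes "Z \<subseteq> proj_space V"
  shows "hom_ideal (vanishing Z)"
  unfolding hom_ideal_def
proof (intro conjI ballI allI)
  fix f s assume f: "f \<in> vanishing Z"
  have "mpoly_eval (hom_part s f) x = 0" if p: "p \<in> Z" "x \<in> p" for p x
  proof -
    obtain N where N: "f = (\<Sum>s\<le>N. hom_part s f)" by (rule sum_hom_part)
    define q where "q = (\<Sum>s\<le>N. Polynomial.monom (mpoly_eval (hom_part s f) x) s)"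
    have q: "poly q c = mpoly_eval f (\<lambda>v. c * x v)" for c
      by (subst N) (simp add: q_def poly_sum poly_monom mpoly_eval_sum
          mpoly_eval_homogeneous_scale[OF homogeneous_hom_part] mult.commute)
    have "poly q c = 0" if "c \<noteq> 0" for c
      using f p proj_space_scale[OF _ p(2) that] assms unfolding q vanishing_def by blast
    then have "UNIV - {0} \<subseteq> {c. poly q c = 0}" by blast
    moreover have "infinite (UNIV - {0 :: 'k})" by (simp add: infinite_UNIV_char_0)
    ultimately have "q = 0" using poly_roots_finite finite_subset by blast
    show ?thesis
    proof (cases "s \<le> N")
      case True
      then show ?thesis using arg_cong[OF \<open>q = 0\<close>, of "\<lambda>q. coeff q s"] by (simp add: q_def coeff_sum)
    next
      case False
      have "hom_part s f = (\<Sum>t\<le>N. hom_part s (hom_part t f))"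
        by (subst N) (simp add: hom_part_sum)
      also have "\<dots> = 0"
        using False by (intro sum.neutral) (auto simp: hom_part_homogeneous[OF homogeneous_hom_part])
      finally show ?thesis by (simp add: mpoly_eval_0)
    qed
  qed
  then show "hom_part s f \<in> vanishing Z" by (simp add: vanishing_def)
qed (rule vanishing_is_ideal)

lemma topspace_zariski: "topspace (zariski V) = proj_space V"
proof
  have "closedin (zariski V) (topspace (zariski V))" by simp
  then show "topspace (zariski V) \<subseteq> proj_space V" unfolding closedin_zariski by auto
  have "closedin (zariski V) (proj_space V)"
    unfolding closedin_zariski by (rule exI[of _ "{}"]) auto
  then show "proj_space V \<subseteq> topspace (zariski V)" by (rule closedin_subset)
qed

text \<open>The retraction setting the variables outside \<open>V\<close> to zero. Ideals are kept
  in the ring of all variables, while the topologies are defined through \<open>mpolys V\<close>;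
  this map translates between them.\<close>

definition restrict_vars :: "'v set \<Rightarrow> ('v, 'k::comm_ring_1) mpoly \<Rightarrow> ('v, 'k) mpoly" where
  "restrict_vars V = peval Const (\<lambda>v. if v \<in> V then Var v else 0)"

lemma ring_map_restrict_vars: "ring_map (restrict_vars V)"
  unfolding restrict_vars_def by (rule ring_map_peval[OF ring_map_Const])

lemma restrict_vars_in: "restrict_vars V f \<in> mpolys V"
  unfolding restrict_vars_def
  by (rule peval_in_mpolys[OF mpolys_UNIV]) (auto simp: Const_in_mpolys Var_in_mpolys_iff mpolys_zero)

lemma restrict_vars_id: "f \<in> mpolys V \<Longrightarrow> restrict_vars V f = f"
  unfolding restrict_vars_def using peval_cong[of f V "\<lambda>v. if v \<in> V then Var v else 0" Var Const]
  by (simp add: peval_Const_Var)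

lemma homogeneous_restrict_vars: "homogeneous s f \<Longrightarrow> homogeneous s (restrict_vars V f)"
  unfolding restrict_vars_def
  using homogeneous_Var by (intro homogeneous_peval[OF _ mpolys_UNIV]) (auto simp: homogeneous_0 homogeneous_Const)

lemma mpoly_eval_restrict_vars:
  assumes "\<And>v. v \<notin> V \<Longrightarrow> x v = 0"
  shows "mpoly_eval (restrict_vars V f) x = mpoly_eval f x"
proof -
  have *: "(\<lambda>v. mpoly_eval (if v \<in> V then Var v else 0) x) = x"
    using assms by (intro ext) (simp add: mpoly_eval_Var mpoly_eval_0)
  then show ?thesis
    unfolding restrict_vars_def peval_comp[OF ring_map_mpoly_eval] * mpoly_eval_Const
    by (simp only: mpoly_eval_eq_peval)
qed

text \<open>Two forms with product in the ideal cover \<open>Z\<close> by two relatively closed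
  sets, because the vanishing of a form at a projective point does not depend on the
  representative.\<close>

lemma is_prime_vanishing:
  fixes Z :: "('v \<Rightarrow> 'k::field_char_0) set set"
  assumes Z: "Z \<subseteq> proj_space V" and irr: "irreducible_space (subtopology (zariski V) Z)"
  shows "is_prime (vanishing Z)"
proof (rule hom_ideal_is_primeI[OF hom_ideal_vanishing[OF Z]])
  have top: "topspace (subtopology (zariski V) Z) = Z" using Z by (auto simp: topspace_zariski)
  have ne: "Z \<noteq> {}" using irr unfolding irreducible_space_def top by blast
  then show "1 \<notin> vanishing Z"
    using proj_space_nonempty Z by (fastforce simp: vanishing_def ring_mapD[OF ring_map_mpoly_eval])
  fix f g :: "('v, 'k) mpoly" and s r
  assume f: "homogeneous s f" and g: "homogeneous r g" and fg: "f * g \<in> vanishing Z"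
  let ?C = "\<lambda>f. {p \<in> Z. \<forall>x\<in>p. mpoly_eval f x = 0}"
  have closed: "closedin (subtopology (zariski V) Z) (?C f)" if f: "homogeneous s f" for f s
  proof -
    let ?f = "restrict_vars V f"
    have "closedin (zariski V) {p \<in> proj_space V. \<forall>h\<in>{?f}. \<forall>x\<in>p. mpoly_eval h x = 0}"
      unfolding closedin_zariski
      using restrict_vars_in homogeneous_restrict_vars[OF f] by (intro exI[of _ "{?f}"]) auto
    moreover have "mpoly_eval ?f x = mpoly_eval f x" if "p \<in> Z" "x \<in> p" for p x
      using Z that by (intro mpoly_eval_restrict_vars) (auto intro: proj_space_outside)
    then have "?C f = {p \<in> proj_space V. \<forall>h\<in>{?f}. \<forall>x\<in>p. mpoly_eval h x = 0} \<inter> Z"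
      using Z by auto
    ultimately show ?thesis unfolding closedin_subtopology by blast
  qed
  have "p \<in> ?C f \<union> ?C g" if p: "p \<in> Z" for p
  proof -
    have pV: "p \<in> proj_space V" using p Z by blast
    then obtain x where x: "x \<in> p" using proj_space_nonempty by blast
    have "mpoly_eval f x * mpoly_eval g x = 0"
      using fg p x by (auto simp: vanishing_def mpoly_eval_mult)
    then have "mpoly_eval f x = 0 \<or> mpoly_eval g x = 0" by simp
    then show ?thesis
      using p proj_space_homogeneous[OF pV f x] proj_space_homogeneous[OF pV g x] by auto
  qed
  then have "?C f \<union> ?C g = Z" by blast
  then have "?C f = Z \<or> ?C g = Z"
    using irr closed[OF f] closed[OF g] unfolding irreducible_space_def top by blast
  then show "f \<in> vanishing Z \<or> g \<in> vanishing Z" by (auto simp: vanishing_def)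
qed

text \<open>A chain with r inclusions gives r + 1 independent elements modulo the ideal of its
  largest member. By the Nullstellensatz the forms cut that ideal, so r + 1 <= card A. The section
  is tested on the zeros of the ideal of \<open>B\<close>, that is, on the cone over its
  closure.\<close>

lemma krull_dim_le_of_linear_section:
  fixes B :: "('v::countable \<Rightarrow> complex) set set" and l :: "'i \<Rightarrow> ('v, complex) mpoly"
  assumes B: "B \<subseteq> proj_space V" "finite V"
    and l: "\<And>a. a \<in> A \<Longrightarrow> homogeneous 1 (l a)" and A: "finite A" "card A \<le> Suc n"
    and origin: "\<And>z. \<forall>f\<in>vanishing B. mpoly_eval f z = 0 \<Longrightarrow> \<forall>a\<in>A. mpoly_eval (l a) z = 0 \<Longrightarrow> z = (\<lambda>_. 0)"
  shows "krull_dim (subtopology (zariski V) B) \<le> ereal (real n)"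
  unfolding krull_dim_def
proof (rule Sup_least, clarsimp)
  fix r Z assume Z: "\<forall>i\<le>r. closedin (subtopology (zariski V) B) (Z i) \<and>
      irreducible_space (subtopology (subtopology (zariski V) B) (Z i))"
    and chain: "\<forall>i<r. Z i \<subset> Z (Suc i)"
  have ZB: "Z i \<subseteq> B" if "i \<le> r" for i
    using closedin_subset[of "subtopology (zariski V) B" "Z i"] Z that by auto
  have ZV: "Z i \<subseteq> proj_space V" if "i \<le> r" for i using ZB[OF that] B(1) by blast
  have irr: "irreducible_space (subtopology (zariski V) (Z i))" if "i \<le> r" for i
  proof -
    have "irreducible_space (subtopology (subtopology (zariski V) B) (Z i))" using Z that by blast
    moreover have "B \<inter> Z i = Z i" using ZB[OF that] by blast
    ultimately show ?thesis by (simp only: subtopology_subtopology)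
  qed
  let ?I = "\<lambda>i. vanishing (Z i)"
  have prime: "is_prime (?I i)" if "i \<le> r" for i by (rule is_prime_vanishing[OF ZV irr]) (rule that)+
  have "topspace (subtopology (zariski V) (Z 0)) \<noteq> {}" using irr[of 0] unfolding irreducible_space_def by blast
  then obtain p where p: "p \<in> Z 0" by auto
  then obtain x v where "x \<in> p" "x v \<noteq> 0" using ZV[of 0] proj_space_nonempty by blast
  then have v: "Var v \<notin> ?I 0" using p by (auto simp: vanishing_def mpoly_eval_Var)
  have step: "?I (Suc i) \<subseteq> ?I i \<and> (\<exists>f. f \<in> ?I i \<and> f \<notin> ?I (Suc i))" if i: "i < r" for i
  proof
    show "?I (Suc i) \<subseteq> ?I i" using chain i by (fastforce simp: vanishing_def)
    obtain p where p: "p \<in> Z (Suc i)" "p \<notin> Z i" using chain i by blast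
    have "closedin (subtopology (zariski V) B) (Z i)" using Z i by simp
    then obtain S where S: "S \<subseteq> {f \<in> mpolys V. \<exists>s. homogeneous s f}"
      "Z i = {p \<in> proj_space V. \<forall>f\<in>S. \<forall>x\<in>p. mpoly_eval f x = 0} \<inter> B"
      unfolding closedin_subtopology closedin_zariski by blast
    have "p \<in> proj_space V" "p \<in> B" using p(1) ZV[of "Suc i"] ZB[of "Suc i"] i by auto
    then obtain f where f: "f \<in> S" "\<exists>x\<in>p. mpoly_eval f x \<noteq> 0" using p(2) S(2) by blast
    then have "f \<in> ?I i" "f \<notin> ?I (Suc i)" using S(2) p(1) by (auto simp: vanishing_def)
    then show "\<exists>f. f \<in> ?I i \<and> f \<notin> ?I (Suc i)" by blast
  qed
  obtain g where g: "independent_mod (?I r) g {..<Suc r}"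
    using independent_of_prime_chain[of r ?I v, OF prime hom_ideal_vanishing[OF ZV] v step] by auto
  have hom: "hom_ideal (?I r)" by (rule hom_ideal_vanishing[OF ZV]) simp
  have "cuts (?I r) l A"
    unfolding cuts_def
  proof
    fix v
    show "\<exists>M. Var v ^ M \<in> gen_ideal (?I r) l A"
    proof (rule hom_nullstellensatz[OF hom_ideal_gen_ideal[OF hom l]])
      fix z assume z: "\<forall>f\<in>gen_ideal (?I r) l A. mpoly_eval f z = 0"
      have "\<forall>f\<in>vanishing B. mpoly_eval f z = 0"
      proof
        fix f assume "f \<in> vanishing B"
        then have "f \<in> ?I r" using ZB[of r] by (auto simp: vanishing_def)
        then show "mpoly_eval f z = 0" using z subset_gen_ideal by blast
      qed
      moreover have "\<forall>a\<in>A. mpoly_eval (l a) z = 0"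
        using z gen_ideal_gen[OF hom_idealD(1)[OF hom] A(1), of _ l] by blast
      ultimately show "z v = 0" using origin[of z] by simp
    qed
  qed
  moreover have "finite {v. Var v \<notin> ?I r}"
  proof (rule finite_subset[OF _ B(2)])
    show "{v. Var v \<notin> ?I r} \<subseteq> V"
      using ZV[of r] proj_space_outside by (fastforce simp: vanishing_def mpoly_eval_Var)
  qed
  ultimately have "\<not> card A < Suc r"
    using dependent_of_cuts[OF hom A(1) l, where W = "{..<Suc r}" and g = g] g by auto
  then show "r \<le> n" using A(2) by simp
qed

subsection \<open>Clearing denominators\<close>

definition of_complex :: "complex \<Rightarrow> complex poly fract" where "of_complex c = to_fract [:c:]"

definition fract_X :: "complex poly fract" where "fract_X = to_fract [:0, 1:]"

lemma ring_map_of_complex: "ring_map of_complex"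
  using ring_map_comp[OF ring_map_to_fract ring_map_const_poly] by (simp add: of_complex_def[abs_def] o_def)

lemma of_complex_eq_iff: "of_complex a = of_complex b \<longleftrightarrow> a = b"
  by (simp add: of_complex_def to_fract_eq_iff)

lemma of_complex_divide: "of_complex a / of_complex b = of_complex (a / b)"
proof (cases "b = 0")
  case False
  then have "of_complex (a / b) * of_complex b = of_complex a"
    using ring_mapD(4)[OF ring_map_of_complex, of "a / b" b] by simp
  moreover have "of_complex b \<noteq> 0"
    using False of_complex_eq_iff[of b 0] ring_mapD(1)[OF ring_map_of_complex] by simp
  ultimately show ?thesis by (simp add: field_simps)
qed (simp add: ring_mapD(1)[OF ring_map_of_complex])

lemma poly_map_of_complex: "poly (map_poly of_complex p) fract_X = to_fract p"
proof (induction p)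
  case (pCons c p)
  have "to_fract (pCons c p) = to_fract [:c:] + to_fract [:0, 1:] * to_fract p"
    by (simp add: ring_mapD[OF ring_map_to_fract, symmetric] del: to_fract_add to_fract_mult)
  then show ?case
    using pCons by (simp add: map_poly_pCons ring_mapD[OF ring_map_of_complex] of_complex_def fract_X_def)
qed simp

lemma fract_clear: "\<exists>a p. a \<noteq> 0 \<and> to_fract a * z = to_fract p" for z :: "complex poly fract"
proof (cases z)
  case (Fract p a)
  then have "to_fract a * z = to_fract p"
    by (simp add: to_fract_def mult_fract eq_fract mult.commute)
  then show ?thesis using Fract by blast
qed

lemma fract_clear_family:
  fixes z :: "'s \<Rightarrow> complex poly fract"
  assumes "finite S"
  shows "\<exists>a. a \<noteq> 0 \<and> (\<forall>s\<in>S. \<exists>p. to_fract a * z s = to_fract p)"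
  using assms
proof (induction S rule: finite_induct)
  case (insert s S)
  then obtain a where a: "a \<noteq> 0" "\<forall>s\<in>S. \<exists>p. to_fract a * z s = to_fract p" by blast
  obtain b p where b: "b \<noteq> 0" "to_fract b * z s = to_fract p" using fract_clear by blast
  show ?case
  proof (rule exI[of _ "a * b"], intro conjI ballI)
    fix t assume "t \<in> insert s S"
    then consider "t = s" | "t \<in> S" by blast
    then show "\<exists>p. to_fract (a * b) * z t = to_fract p"
    proof cases
      case 1
      then have "to_fract (a * b) * z t = to_fract (a * p)" using b(2) by (simp add: mult.assoc)
      then show ?thesis ..
    next
      case 2
      then obtain p where "to_fract a * z t = to_fract p" using a(2) by blast
      then have "to_fract (a * b) * z t = to_fract (b * p)" by (simp add: mult_ac)
      then show ?thesis ..
    qed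
  qed (use a b in simp)
qed (auto intro: exI[of _ 1])

text \<open>A common denominator of finitely many coefficients. No new exponents appear, so the set
  of variables is preserved.\<close>

lemma mpoly_clear:
  fixes G :: "('v, complex poly fract) mpoly"
  shows "\<exists>a G'. a \<noteq> 0 \<and> Poly_Mapping.keys G' \<subseteq> Poly_Mapping.keys G \<and>
    peval (\<lambda>p. Const (to_fract p)) Var G' = Const (to_fract a) * G"
proof -
  obtain a where a: "a \<noteq> 0" "\<forall>\<alpha>\<in>Poly_Mapping.keys G. \<exists>p. to_fract a * Poly_Mapping.lookup G \<alpha> = to_fract p"
    using fract_clear_family[OF finite_keys[of G], of "Poly_Mapping.lookup G"] by (elim exE conjE)
  from bchoice[OF a(2)] obtain p where
    p: "\<forall>\<alpha>\<in>Poly_Mapping.keys G. to_fract a * Poly_Mapping.lookup G \<alpha> = to_fract (p \<alpha>)" by (elim exE)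
  define G' where "G' = (\<Sum>\<alpha>\<in>Poly_Mapping.keys G. Poly_Mapping.single \<alpha> (p \<alpha>))"
  have r: "ring_map (\<lambda>p. Const (to_fract p) :: ('v, complex poly fract) mpoly)"
    using ring_map_comp[OF ring_map_Const ring_map_to_fract] by (simp add: o_def)
  have "peval (\<lambda>p. Const (to_fract p)) Var G' =
      (\<Sum>\<alpha>\<in>Poly_Mapping.keys G. Const (to_fract (p \<alpha>)) * Poly_Mapping.single \<alpha> 1)"
    by (simp add: G'_def peval_sum[OF r] peval_single[OF r] mon_eval_Var)
  also have "\<dots> = (\<Sum>\<alpha>\<in>Poly_Mapping.keys G. Const (to_fract a) * Poly_Mapping.single \<alpha> (Poly_Mapping.lookup G \<alpha>))"
  proof (rule sum.cong[OF refl])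
    fix \<alpha> assume "\<alpha> \<in> Poly_Mapping.keys G"
    with p have "to_fract (p \<alpha>) = to_fract a * Poly_Mapping.lookup G \<alpha>" by simp
    then show "Const (to_fract (p \<alpha>)) * Poly_Mapping.single \<alpha> 1 =
        Const (to_fract a) * Poly_Mapping.single \<alpha> (Poly_Mapping.lookup G \<alpha>)"
      by (simp add: Const_def mult_single)
  qed
  also have "\<dots> = Const (to_fract a) * G"
    unfolding sum_distrib_left[symmetric] mpoly_as_sum[of G, symmetric] ..
  finally have "peval (\<lambda>p. Const (to_fract p)) Var G' = Const (to_fract a) * G" .
  moreover have "Poly_Mapping.keys G' \<subseteq> Poly_Mapping.keys G"
  proof
    fix \<beta> assume "\<beta> \<in> Poly_Mapping.keys G'"
    then have "(\<Sum>\<alpha>\<in>Poly_Mapping.keys G. Poly_Mapping.lookup (Poly_Mapping.single \<alpha> (p \<alpha>)) \<beta>) \<noteq> 0"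
      by (simp add: G'_def in_keys_iff lookup_sum)
    then obtain \<alpha> where "\<alpha> \<in> Poly_Mapping.keys G" "Poly_Mapping.lookup (Poly_Mapping.single \<alpha> (p \<alpha>)) \<beta> \<noteq> 0"
      by (rule sum.not_neutral_contains_not_neutral)
    then show "\<beta> \<in> Poly_Mapping.keys G" by (auto simp: lookup_single when_def split: if_splits)
  qed
  ultimately show ?thesis using a(1) by blast
qed

text \<open>Polynomials over \<open>\<complex>[t]\<close> in the variables below \<open>q\<close> are written as complex
  polynomials, the variable \<open>q\<close> standing for \<open>t\<close>.\<close>

definition inclusion :: "nat \<Rightarrow> (nat, complex) mpoly \<Rightarrow> (nat, complex poly fract) mpoly" where
  "inclusion q = peval (\<lambda>c. Const (of_complex c)) (\<lambda>j. if j < q then Var j else Const fract_X)"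

lemma ring_map_Const_of_complex: "ring_map (\<lambda>c. Const (of_complex c))"
  using ring_map_comp[OF ring_map_Const ring_map_of_complex] by (simp add: o_def)

lemma ring_map_inclusion: "ring_map (inclusion q)"
  unfolding inclusion_def by (rule ring_map_peval[OF ring_map_Const_of_complex])

text \<open>The element p(t), with the variable \<open>q\<close> in the role of t.\<close>

definition scalar :: "nat \<Rightarrow> complex poly \<Rightarrow> (nat, complex) mpoly" where
  "scalar q p = poly (map_poly Const p) (Var q)"

lemma inclusion_scalar: "inclusion q (scalar q p) = Const (to_fract p)"
proof -
  have "inclusion q (scalar q p) = poly (map_poly (\<lambda>c. Const (of_complex c)) p) (Const fract_X)"
    unfolding scalar_def ring_map_map_poly_poly[OF ring_map_inclusion] map_poly_comp[OF ring_map_inclusion ring_map_Const]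
    by (simp add: inclusion_def peval_Const[OF ring_map_Const_of_complex] peval_Var[OF ring_map_Const_of_complex])
  also have "\<dots> = Const (poly (map_poly of_complex p) fract_X)"
    unfolding ring_map_map_poly_poly[OF ring_map_Const] map_poly_comp[OF ring_map_Const ring_map_of_complex] ..
  finally show ?thesis by (simp add: poly_map_of_complex)
qed

lemma scalar_in_mpolys: "scalar q p \<in> mpolys {..q}"
proof -
  have "(Var q :: (nat, complex) mpoly) ^ i \<in> mpolys {..q}" for i
    by (induction i) (auto simp: mpolys_one Var_in_mpolys_iff intro!: mpolys_mult)
  then show ?thesis
    unfolding scalar_def poly_altdef coeff_map_poly_ring[OF ring_map_Const]
    by (intro mpolys_sum mpolys_mult Const_in_mpolys)
qed

lemma inclusion_clear:
  assumes "G \<in> mpolys {..<q}"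
  shows "\<exists>a G'. a \<noteq> 0 \<and> G' \<in> mpolys {..q} \<and> inclusion q G' = Const (to_fract a) * G"
proof -
  obtain a F where F: "a \<noteq> 0" "Poly_Mapping.keys F \<subseteq> Poly_Mapping.keys G"
    "peval (\<lambda>p. Const (to_fract p)) Var F = Const (to_fract a) * G" using mpoly_clear by blast
  have Fq: "F \<in> mpolys {..<q}" using assms F(2) by (auto simp: mpolys_def)
  let ?G = "peval (scalar q) Var F"
  have "inclusion q ?G = peval (\<lambda>p. Const (to_fract p)) (\<lambda>v. inclusion q (Var v)) F"
    by (simp add: peval_comp[OF ring_map_inclusion] inclusion_scalar)
  also have "\<dots> = peval (\<lambda>p. Const (to_fract p)) Var F"
    by (rule peval_cong[OF Fq]) (simp add: inclusion_def peval_Var[OF ring_map_Const_of_complex])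
  finally have "inclusion q ?G = Const (to_fract a) * G" by (simp add: F(3))
  moreover have "?G \<in> mpolys {..q}"
    by (rule peval_in_mpolys[OF Fq]) (auto simp: scalar_in_mpolys Var_in_mpolys_iff)
  ultimately show ?thesis using F(1) by blast
qed

lemma inclusion_clear_poly:
  assumes "\<And>i. coeff p i \<in> mpolys {..<q}"
  shows "\<exists>a p'. a \<noteq> 0 \<and> (\<forall>i. coeff p' i \<in> mpolys {..q}) \<and>
    map_poly (inclusion q) p' = smult (Const (to_fract a)) p"
  using assms
proof (induction p)
  case 0
  show ?case
    by (intro exI[of _ 1] exI[of _ 0]) (simp add: mpolys_zero)
next
  case (pCons c p)
  have "c \<in> mpolys {..<q}" using pCons.prems[of 0] by simp
  then obtain a c' where c: "a \<noteq> 0" "c' \<in> mpolys {..q}" "inclusion q c' = Const (to_fract a) * c"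
    using inclusion_clear by blast
  have "coeff p i \<in> mpolys {..<q}" for i using pCons.prems[of "Suc i"] by simp
  then obtain b p' where p: "b \<noteq> 0" "\<forall>i. coeff p' i \<in> mpolys {..q}"
    "map_poly (inclusion q) p' = smult (Const (to_fract b)) p" using pCons.IH by blast
  let ?p = "pCons (scalar q b * c') (smult (scalar q a) p')"
  have "map_poly (inclusion q) (smult (scalar q a) p') = map_poly (inclusion q) ([:scalar q a:] * p')" by simp
  also have "\<dots> = [:Const (to_fract a):] * smult (Const (to_fract b)) p"
    unfolding ring_mapD(4)[OF ring_map_map_poly[OF ring_map_inclusion]] p(3)
    by (simp add: map_poly_pCons ring_mapD[OF ring_map_inclusion] inclusion_scalar)
  finally have "map_poly (inclusion q) ?p = smult (Const (to_fract (a * b))) (pCons c p)"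
    by (simp add: map_poly_pCons ring_mapD[OF ring_map_inclusion] inclusion_scalar c(3) Const_simps mult_ac)
  moreover have "coeff ?p i \<in> mpolys {..q}" for i
    using c(2) p(2) by (cases i) (auto intro!: mpolys_mult scalar_in_mpolys)
  ultimately show ?case using c(1) p(1) by (intro exI[of _ "a * b"] exI[of _ ?p]) simp
qed

text \<open>The rational root theorem, that is, C[t] is integrally closed: the reduced denominator
  divides a power of the numerator.\<close>

lemma monic_root_fract:
  fixes p :: "complex poly poly"
  assumes "lead_coeff p = 1" "poly (map_poly to_fract p) z = 0"
  shows "\<exists>y. z = to_fract y"
proof -
  define a b where "a = fst (quot_of_fract z)" and "b = snd (quot_of_fract z)"
  have b: "b \<noteq> 0" and cop: "coprime a b"
    by (simp_all add: a_def b_def snd_quot_of_fract_nonzero coprime_quot_of_fract)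
  have z: "z = to_fract a / to_fract b"
    using quot_to_fract_quot_of_fract[of z]
    by (simp add: a_def b_def quot_to_fract_def case_prod_unfold to_fract_def)
  have b': "to_fract b \<noteq> 0" using b by simp
  define e where "e = degree p"
  have "degree (map_poly to_fract p) = e" unfolding e_def by (rule degree_map_poly) simp
  then have "0 = to_fract b ^ e * (\<Sum>i\<le>e. to_fract (coeff p i) * z ^ i)"
    using assms(2) by (simp add: poly_altdef coeff_map_poly_ring[OF ring_map_to_fract])
  also have "\<dots> = (\<Sum>i\<le>e. to_fract (coeff p i * a ^ i * b ^ (e - i)))"
    unfolding sum_distrib_left
  proof (rule sum.cong[OF refl])
    fix i assume "i \<in> {..e}"
    then have "to_fract b ^ e = to_fract b ^ i * to_fract b ^ (e - i)" by (simp add: power_add[symmetric])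
    then show "to_fract b ^ e * (to_fract (coeff p i) * z ^ i) = to_fract (coeff p i * a ^ i * b ^ (e - i))"
      using b' by (simp add: z power_divide ring_map_power[OF ring_map_to_fract])
  qed
  also have "\<dots> = to_fract (\<Sum>i\<le>e. coeff p i * a ^ i * b ^ (e - i))"
    by (simp add: ring_map_sum[OF ring_map_to_fract])
  finally have "(\<Sum>i\<le>e. coeff p i * a ^ i * b ^ (e - i)) = 0" by (metis to_fract_eq_0_iff)
  moreover have "(\<Sum>i\<le>e. coeff p i * a ^ i * b ^ (e - i)) = (\<Sum>i<e. coeff p i * a ^ i * b ^ (e - i)) + a ^ e"
    using assms(1) by (simp only: lessThan_Suc_atMost[symmetric] sum.lessThan_Suc e_def) simp
  ultimately have eq: "a ^ e = - (\<Sum>i<e. coeff p i * a ^ i * b ^ (e - i))"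
    by (simp only: eq_neg_iff_add_eq_0 add.commute)
  have "b dvd coeff p i * a ^ i * b ^ (e - i)" if "i < e" for i
    using dvd_power[of "e - i" b] that by (intro dvd_mult) simp
  then have "b dvd (\<Sum>i<e. coeff p i * a ^ i * b ^ (e - i))" by (intro dvd_sum) simp
  then have "b dvd a ^ e" unfolding eq by (simp only: dvd_minus_iff)
  moreover have "coprime b (a ^ e)" using cop by (simp add: coprime_commute)
  ultimately have "b dvd 1" by (intro coprime_common_divisor[of b "a ^ e"]) auto
  then obtain c where c: "1 = b * c" by (rule dvdE)
  have "to_fract b * to_fract c = 1" by (simp only: to_fract_mult[symmetric] c[symmetric] to_fract_1)
  then have "z = to_fract (a * c)" using b' by (simp add: z field_simps)
  then show ?thesis ..
qed

subsection \<open>Integral relations of minimal degree\<close>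

lemma coeff_mult_bounded:
  fixes p q :: "'a::comm_ring_1 poly"
  assumes "degree p \<le> a" "degree q \<le> b"
  shows "coeff (p * q) (a + b) = coeff p a * coeff q b"
proof -
  have "coeff (p * q) (a + b) = (\<Sum>i\<le>a + b. if i = a then coeff p a * coeff q b else 0)"
    unfolding coeff_mult
  proof (rule sum.cong[OF refl])
    fix i assume "i \<in> {..a + b}"
    consider "i < a" | "i = a" | "i > a" by linarith
    then show "coeff p i * coeff q (a + b - i) = (if i = a then coeff p a * coeff q b else 0)"
    proof cases
      case 1
      then have "coeff q (a + b - i) = 0" using assms(2) by (intro coeff_eq_0) auto
      then show ?thesis using 1 by simp
    next
      case 3
      then have "coeff p i = 0" using assms(1) by (intro coeff_eq_0) auto
      then show ?thesis using 3 by simp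
    qed simp
  qed
  then show ?thesis by (simp add: sum.delta)
qed

lemma top_coeff_power:
  fixes p :: "'a::comm_ring_1 poly"
  assumes "degree p \<le> 1"
  shows "degree (p ^ k) \<le> k \<and> coeff (p ^ k) k = coeff p 1 ^ k"
proof (induction k)
  case (Suc k)
  have "degree (p * p ^ k) \<le> 1 + k" using degree_mult_le[of p "p ^ k"] assms Suc by linarith
  moreover have "coeff (p * p ^ k) (1 + k) = coeff p 1 * coeff (p ^ k) k"
    using assms Suc by (intro coeff_mult_bounded) auto
  ultimately show ?case using Suc by simp
qed simp

lemma top_coeff_prod:
  fixes p :: "'i \<Rightarrow> 'a::comm_ring_1 poly"
  assumes "\<And>i. i \<in> A \<Longrightarrow> degree (p i) \<le> d i"
  shows "degree (prod p A) \<le> sum d A \<and> coeff (prod p A) (sum d A) = (\<Prod>i\<in>A. coeff (p i) (d i))"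
  using assms
proof (induction A rule: infinite_finite_induct)
  case (insert i A)
  then have IH: "degree (prod p A) \<le> sum d A" "coeff (prod p A) (sum d A) = (\<Prod>i\<in>A. coeff (p i) (d i))" by auto
  have "degree (p i * prod p A) \<le> d i + sum d A"
    using degree_mult_le[of "p i" "prod p A"] insert.prems[of i] IH(1) by simp
  moreover have "coeff (p i * prod p A) (d i + sum d A) = coeff (p i) (d i) * coeff (prod p A) (sum d A)"
    using insert.prems IH by (intro coeff_mult_bounded) auto
  ultimately show ?case using insert.hyps IH by simp
qed auto

text \<open>When linear polynomials with top coefficients \<kappa> a are substituted into a form of
  degree e, only these contribute to degree e. A generic \<kappa> thus makes a relation monic up to
  a constant, as in Noether normalisation.\<close>

lemma top_coeff_peval:
  fixes lin :: "'w \<Rightarrow> ('v, 'k::comm_ring_1) mpoly poly"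
  assumes G: "homogeneous e G" and lin: "\<And>a. degree (lin a) \<le> 1" "\<And>a. coeff (lin a) 1 = Const (\<kappa> a)"
  shows "degree (peval (\<lambda>c. [:Const c:]) lin G) \<le> e"
    and "coeff (peval (\<lambda>c. [:Const c:]) lin G) e = Const (mpoly_eval G \<kappa>)"
proof -
  have mon: "degree (mon_eval \<alpha> lin) \<le> e \<and> coeff (mon_eval \<alpha> lin) e = Const (mon_eval \<alpha> \<kappa>)"
    if "\<alpha> \<in> Poly_Mapping.keys G" for \<alpha>
  proof -
    have "degree (lin a ^ Poly_Mapping.lookup \<alpha> a) \<le> Poly_Mapping.lookup \<alpha> a" for a
      using top_coeff_power[OF lin(1)] by blast
    from top_coeff_prod[of "Poly_Mapping.keys \<alpha>", OF this]
    have "degree (mon_eval \<alpha> lin) \<le> mon_degree \<alpha>"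
      "coeff (mon_eval \<alpha> lin) (mon_degree \<alpha>) =
        (\<Prod>a\<in>Poly_Mapping.keys \<alpha>. coeff (lin a ^ Poly_Mapping.lookup \<alpha> a) (Poly_Mapping.lookup \<alpha> a))"
      by (simp_all add: mon_eval_def mon_degree_def)
    moreover have "mon_degree \<alpha> = e" using G that by (simp add: homogeneous_def)
    moreover have "(\<Prod>a\<in>Poly_Mapping.keys \<alpha>. coeff (lin a ^ Poly_Mapping.lookup \<alpha> a) (Poly_Mapping.lookup \<alpha> a)) =
        mon_eval \<alpha> (\<lambda>a. Const (\<kappa> a))"
      using top_coeff_power[OF lin(1)] lin(2) by (simp add: mon_eval_def)
    ultimately show ?thesis by (simp add: ring_map_mon_eval[OF ring_map_Const])
  qed
  show "degree (peval (\<lambda>c. [:Const c:]) lin G) \<le> e"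
    unfolding peval_def
  proof (rule degree_sum_le[OF finite_keys])
    fix \<alpha> assume "\<alpha> \<in> Poly_Mapping.keys G"
    then show "degree ([:Const (Poly_Mapping.lookup G \<alpha>):] * mon_eval \<alpha> lin) \<le> e"
      using mon[of \<alpha>] degree_smult_le[of "Const (Poly_Mapping.lookup G \<alpha>)" "mon_eval \<alpha> lin"] by simp
  qed
  show "coeff (peval (\<lambda>c. [:Const c:]) lin G) e = Const (mpoly_eval G \<kappa>)"
    unfolding peval_def coeff_sum mpoly_eval_def ring_map_sum[OF ring_map_Const]
    by (rule sum.cong[OF refl]) (simp add: mon Const_simps)
qed

text \<open>G(l_0, ..., l_{q-1}, t, t, ...). Thus complex polynomials encode the elements of the
  ring generated over C by t and the forms.\<close>

definition at_forms :: "(nat \<Rightarrow> (nat, complex poly fract) mpoly) \<Rightarrow> nat \<Rightarrow> (nat, complex) mpoly \<Rightarrow> (nat, complex poly fract) mpoly" where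
  "at_forms l q = peval (\<lambda>c. Const (of_complex c)) (\<lambda>j. if j < q then l j else Const fract_X)"

lemma ring_map_at_forms: "ring_map (at_forms l q)"
  unfolding at_forms_def by (rule ring_map_peval[OF ring_map_Const_of_complex])

lemma at_forms_inclusion: "at_forms l q G = peval Const l (inclusion q G)"
proof -
  have "(\<lambda>j. peval Const l (if j < q then Var j else Const fract_X)) = (\<lambda>j. if j < q then l j else Const fract_X)"
    by (intro ext) (simp add: peval_Const peval_Var ring_map_Const)
  then show ?thesis
    unfolding inclusion_def peval_comp[OF ring_map_peval[OF ring_map_Const]] at_forms_def
    by (simp add: peval_Const[OF ring_map_Const])
qed

lemma map_at_forms_inclusion: "map_poly (at_forms l q) p = map_poly (peval Const l) (map_poly (inclusion q) p)"
  unfolding map_poly_comp[OF ring_map_peval[OF ring_map_Const] ring_map_inclusion] at_forms_inclusion ..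

text \<open>Substituting \<open>Y / a\<close> for \<open>Y\<close> keeps a monic relation monic while clearing
  the denominator \<open>a\<close>.\<close>

lemma monic_relation_clear:
  fixes l :: "nat \<Rightarrow> (nat, complex poly fract) mpoly"
  assumes p: "degree p \<le> e" "coeff p e = 1" "\<And>i. coeff p i \<in> mpolys {..<q}"
    and I: "is_ideal I" "poly (map_poly (peval Const l) p) x \<in> I"
  shows "\<exists>c \<Phi>. c \<noteq> 0 \<and> lead_coeff \<Phi> = 1 \<and> degree \<Phi> = e \<and> poly (map_poly (at_forms l q) \<Phi>) (Const c * x) \<in> I"
proof -
  obtain a p' where a: "a \<noteq> 0" "map_poly (inclusion q) p' = smult (Const (to_fract a)) p"
    using inclusion_clear_poly[OF p(3)] by blast
  let ?\<sigma> = "peval Const l :: (nat, complex poly fract) mpoly \<Rightarrow> _"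
  have r: "ring_map ?\<sigma>" by (rule ring_map_peval[OF ring_map_Const])
  define c where "c = to_fract a"
  have p': "at_forms l q (coeff p' i) = Const c * ?\<sigma> (coeff p i)" for i
  proof -
    have "inclusion q (coeff p' i) = Const c * coeff p i"
      using arg_cong[OF a(2), of "\<lambda>p. coeff p i"] by (simp add: coeff_map_poly_ring[OF ring_map_inclusion] c_def)
    then show ?thesis unfolding at_forms_inclusion by (simp add: ring_mapD[OF r] peval_Const[OF ring_map_Const])
  qed
  have s: "at_forms l q (scalar q a) = Const c"
    unfolding at_forms_inclusion inclusion_scalar by (simp add: peval_Const[OF ring_map_Const] c_def)
  \<comment> \<open>This is a^e p(Y / a): its coefficient of Y^k is a^(e - k) p_k, and
    \<open>coeff p' k\<close> already contains one factor a.\<close>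
  define \<Phi> where "\<Phi> = Polynomial.monom 1 e + (\<Sum>k<e. Polynomial.monom (scalar q a ^ (e - Suc k) * coeff p' k) k)"
  have d: "degree (\<Sum>k<e. Polynomial.monom (scalar q a ^ (e - Suc k) * coeff p' k) k) < e" if "e > 0"
    using that by (intro degree_sum_less) (auto intro: le_less_trans[OF degree_monom_le])
  have deg: "degree \<Phi> = e \<and> lead_coeff \<Phi> = 1"
  proof (cases "e = 0")
    case False
    then have lt: "degree (\<Sum>k<e. Polynomial.monom (scalar q a ^ (e - Suc k) * coeff p' k) k) < degree (Polynomial.monom (1 :: (nat, complex) mpoly) e)"
      using d by (simp add: degree_monom_eq)
    have "degree \<Phi> = e" using degree_add_eq_left[OF lt] by (simp add: \<Phi>_def degree_monom_eq)
    moreover have "coeff \<Phi> e = 1"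
      unfolding \<Phi>_def using d False by (simp only: coeff_add coeff_eq_0) simp
    ultimately show ?thesis by simp
  qed (simp add: \<Phi>_def)
  note rE = ring_map_map_poly[OF ring_map_at_forms, of l q]
  have mon: "map_poly (at_forms l q) (Polynomial.monom u k) = Polynomial.monom (at_forms l q u) k" for u k
    by (rule map_poly_monom) (simp add: ring_mapD[OF ring_map_at_forms])
  have "poly (map_poly (at_forms l q) \<Phi>) (Const c * x) =
      (Const c * x) ^ e + (\<Sum>k<e. Const c ^ (e - Suc k) * (Const c * ?\<sigma> (coeff p k)) * (Const c * x) ^ k)"
    unfolding \<Phi>_def ring_mapD(3)[OF rE] ring_map_sum[OF rE] mon poly_add poly_sum poly_monom
      ring_mapD[OF ring_map_at_forms] ring_map_power[OF ring_map_at_forms] s p' by simp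
  also have "(\<Sum>k<e. Const c ^ (e - Suc k) * (Const c * ?\<sigma> (coeff p k)) * (Const c * x) ^ k) =
      (\<Sum>k<e. Const c ^ e * (?\<sigma> (coeff p k) * x ^ k))"
  proof (rule sum.cong[OF refl])
    fix k assume "k \<in> {..<e}"
    then have "Const c ^ e = Const c ^ (e - Suc k) * Const c * (Const c ^ k :: (nat, complex poly fract) mpoly)"
      by (simp add: power_add[symmetric] power_Suc2[symmetric] del: power_Suc)
    then show "Const c ^ (e - Suc k) * (Const c * ?\<sigma> (coeff p k)) * (Const c * x) ^ k = Const c ^ e * (?\<sigma> (coeff p k) * x ^ k)"
      by (simp add: power_mult_distrib mult_ac)
  qed
  also have "(Const c * x) ^ e + \<dots> = Const c ^ e * (\<Sum>k\<le>e. ?\<sigma> (coeff p k) * x ^ k)"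
    using p(2) by (simp add: lessThan_Suc_atMost[symmetric] power_mult_distrib sum_distrib_left ring_mapD[OF r] algebra_simps)
  also have "(\<Sum>k\<le>e. ?\<sigma> (coeff p k) * x ^ k) = poly (map_poly ?\<sigma> p) x"
  proof -
    have "degree (map_poly ?\<sigma> p) \<le> e"
      using p(1) by (intro degree_le) (simp add: coeff_map_poly_ring[OF r] coeff_eq_0 ring_mapD[OF r])
    then have "poly (map_poly ?\<sigma> p) x = (\<Sum>k\<le>e. coeff (map_poly ?\<sigma> p) k * x ^ k)"
      unfolding poly_altdef by (intro sum.mono_neutral_left) (auto simp: coeff_eq_0)
    then show ?thesis by (simp add: coeff_map_poly_ring[OF r])
  qed
  finally have "poly (map_poly (at_forms l q) \<Phi>) (Const c * x) \<in> I"
    using is_idealD(3)[OF I] by simp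
  moreover have "c \<noteq> 0" using a(1) by (simp add: c_def)
  ultimately show ?thesis using deg by blast
qed

lemma homogeneous_1_linear:
  fixes F :: "('v, 'k::comm_ring_1) mpoly"
  assumes F: "homogeneous 1 F" "F \<in> mpolys A" and A: "finite A"
  shows "F = (\<Sum>j\<in>A. Const (Poly_Mapping.lookup F (Poly_Mapping.single j 1)) * Var j)" (is "F = ?S")
proof (rule poly_mapping_eqI)
  fix \<alpha>
  have S: "Poly_Mapping.lookup ?S \<alpha> = (\<Sum>j\<in>A. if Poly_Mapping.single j 1 = \<alpha> then Poly_Mapping.lookup F \<alpha> else 0)"
    unfolding lookup_sum Const_def Var_def mult_single
    by (rule sum.cong) (auto simp: lookup_single when_def)
  show "Poly_Mapping.lookup F \<alpha> = Poly_Mapping.lookup ?S \<alpha>"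
  proof (cases "\<alpha> \<in> Poly_Mapping.keys F")
    case False
    then show ?thesis unfolding S by (simp add: in_keys_iff cong: if_cong)
  next
    case True
    then have d: "mon_degree \<alpha> = 1" and k: "Poly_Mapping.keys \<alpha> \<subseteq> A" using F by (auto simp: homogeneous_def mpolys_def)
    then have "\<alpha> \<noteq> 0" by (auto simp: mon_degree_def)
    then obtain j where j: "j \<in> Poly_Mapping.keys \<alpha>" by (metis ex_in_conv keys_eq_empty)
    have sum: "Poly_Mapping.lookup \<alpha> j + (\<Sum>v\<in>Poly_Mapping.keys \<alpha> - {j}. Poly_Mapping.lookup \<alpha> v) = 1"
      using d j by (simp add: mon_degree_def sum.remove[OF finite_keys j])
    moreover have "Poly_Mapping.lookup \<alpha> j > 0" using j by (simp add: in_keys_iff)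
    ultimately have 1: "Poly_Mapping.lookup \<alpha> j = 1"
      and 0: "(\<Sum>v\<in>Poly_Mapping.keys \<alpha> - {j}. Poly_Mapping.lookup \<alpha> v) = 0" by linarith+
    have "\<forall>v\<in>Poly_Mapping.keys \<alpha> - {j}. Poly_Mapping.lookup \<alpha> v = 0"
      using 0 by (subst (asm) sum_eq_0_iff) auto
    then have "Poly_Mapping.lookup \<alpha> v = 0" if "v \<noteq> j" for v
      using that by (cases "v \<in> Poly_Mapping.keys \<alpha>") (blast, simp add: in_keys_iff)
    then have "\<alpha> = Poly_Mapping.single j 1"
      using 1 by (intro poly_mapping_eqI) (auto simp: lookup_single when_def)
    moreover have "(\<Sum>i\<in>A. if Poly_Mapping.single i (1::nat) = Poly_Mapping.single j 1 then Poly_Mapping.lookup F \<alpha> else 0) =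
        (\<Sum>i\<in>A. if i = j then Poly_Mapping.lookup F \<alpha> else 0)"
      by (rule sum.cong) (auto dest: arg_cong[of _ _ Poly_Mapping.keys])
    ultimately show ?thesis unfolding S using j k A by auto
  qed
qed

subsection \<open>A line avoiding the variety\<close>

lemma monic_map_poly:
  assumes "ring_map h" "lead_coeff p = 1"
  shows "degree (map_poly h p) = degree p" "lead_coeff (map_poly h p) = 1"
proof -
  show "degree (map_poly h p) = degree p"
    using assms(2) by (intro antisym degree_le le_degree)
      (simp_all add: coeff_map_poly_ring[OF assms(1)] coeff_eq_0 ring_mapD[OF assms(1)])
  then show "lead_coeff (map_poly h p) = 1"
    by (simp add: coeff_map_poly_ring[OF assms(1)] assms(2) ring_mapD[OF assms(1)])
qed

lemma map_poly_cong_coeff: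
  assumes "\<And>i. g (coeff p i) = h (coeff p i)" "ring_map g" "ring_map h"
  shows "map_poly g p = map_poly h p"
  using assms by (simp add: poly_eq_iff coeff_map_poly_ring)

definition linear_form :: "nat \<Rightarrow> (nat \<Rightarrow> complex) \<Rightarrow> (nat, complex poly fract) mpoly" where
  "linear_form n c = (\<Sum>j\<le>n. Const (of_complex (c j)) * Var j)"

lemma homogeneous_linear_form: "homogeneous 1 (linear_form n c)"
  unfolding linear_form_def by (intro homogeneous_sum homogeneous_Const_mult homogeneous_Var)

lemma linear_form_diff: "linear_form n c - Const (of_complex a) * linear_form n d = linear_form n (\<lambda>j. c j - a * d j)"
  by (simp add: linear_form_def sum_distrib_left sum_subtractf[symmetric] Const_simps
      ring_map_diff[OF ring_map_of_complex] ring_mapD[OF ring_map_of_complex] algebra_simps)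

lemma Var_linear_form: "i \<le> n \<Longrightarrow> Var i = linear_form n (\<lambda>j. if j = i then 1 else 0)"
proof -
  assume i: "i \<le> n"
  have "linear_form n (\<lambda>j. if j = i then 1 else 0) = (\<Sum>j\<le>n. if j = i then Var j else 0)"
    unfolding linear_form_def
    by (rule sum.cong) (auto simp: ring_mapD[OF ring_map_of_complex] Const_simps)
  then show ?thesis using i by simp
qed

lemma linear_form_in_mpolys: "linear_form n c \<in> mpolys {..n}"
  unfolding linear_form_def by (intro mpolys_sum mpolys_mult Const_in_mpolys) (simp add: Var_in_mpolys_iff)

lemma inj_of_complex: "inj of_complex"
  by (simp add: inj_def of_complex_eq_iff)

text \<open>The ideal lives in the ring of all variables x_0, x_1, ...; those above n belong to it,
  so that x_0, ..., x_n generate everything modulo \<open>P\<close>.\<close>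

locale variety =
  fixes n :: nat and P :: "(nat, complex poly fract) mpoly set"
  assumes prime: "is_prime P" and hom: "hom_ideal P"
    and outside: "\<And>v. v > n \<Longrightarrow> Var v \<in> P" and proper: "\<exists>v. Var v \<notin> P"
begin

sublocale linear_system "range of_complex" "range (linear_form n)"
proof
  show "infinite (range of_complex)"
    using inj_of_complex infinite_UNIV_char_0 finite_imageD by blast
  show "\<forall>a\<in>range of_complex. \<forall>b\<in>range of_complex. a / b \<in> range of_complex"
    by (auto simp: of_complex_divide)
qed (auto simp: homogeneous_linear_form[unfolded One_nat_def] linear_form_diff)

text \<open>A stand-in for dim X + 1. Minimality makes a cutting system of \<open>q\<close> forms
  independent, which produces a chain of \<open>q\<close> primes and so q - 1 <= m.\<close>

definition q :: nat where "q = (LEAST q. cut_by P q)"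

lemma idealP: "is_ideal P" using prime by (rule is_primeD)

lemma finite_vars_P: "finite {v. Var v \<notin> P}"
proof (rule finite_subset)
  show "{v. Var v \<notin> P} \<subseteq> {..n}" using outside by (auto simp: not_le[symmetric])
qed simp

lemma cut_by_q: "cut_by P q"
proof -
  have "cuts P Var {..<Suc n}"
    unfolding cuts_def
  proof
    fix v :: nat
    have "Var v \<in> gen_ideal P Var {..<Suc n}"
      using outside[of v] gen_ideal_gen[OF idealP finite_lessThan, of v "Suc n" Var] subset_gen_ideal[of "Var v" P]
      by (cases "v > n") auto
    then show "\<exists>M. Var v ^ M \<in> gen_ideal P Var {..<Suc n}" by (intro exI[of _ 1]) simp
  qed
  then have "cut_by P (Suc n)"
    unfolding cut_by_def using Var_linear_form[of _ n] by (intro exI[of _ Var]) (auto simp: less_Suc_eq_le)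
  then show ?thesis unfolding q_def by (rule LeastI)
qed

lemma not_cut_by: "r < q \<Longrightarrow> \<not> cut_by P r"
  unfolding q_def by (rule not_less_Least)

lemma q_pos: "q > 0"
proof (rule ccontr)
  assume "\<not> q > 0"
  then obtain l where l: "cuts P l {..<(0::nat)}" using cut_by_q by (auto simp: cut_by_def)
  obtain v where v: "Var v \<notin> P" using proper ..
  obtain M where "Var v ^ M \<in> P" using l by (auto simp: cuts_def gen_ideal_def)
  then show False using v is_prime_power[OF prime] by blast
qed

definition system :: "(nat \<Rightarrow> (nat, complex poly fract) mpoly) \<Rightarrow> bool" where
  "system l \<longleftrightarrow> (\<forall>i<q. l i \<in> range (linear_form n)) \<and> cuts P l {..<q}"

lemma system_exists: "\<exists>l. system l"
  using cut_by_q by (simp add: cut_by_def system_def)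

lemma system_independent: "system l \<Longrightarrow> independent_mod P l {..<q}"
  using minimal_independent[OF hom is_primeD(2)[OF prime], of q l] not_cut_by by (simp add: system_def)

text \<open>An equation of integral dependence for c x over the ring generated over C by t and the
  forms. The factor \<open>c\<close> from C(t) absorbs denominators, which lets the coefficients be
  complex polynomials.\<close>

definition relation :: "(nat \<Rightarrow> (nat, complex poly fract) mpoly) \<Rightarrow> (nat, complex poly fract) mpoly \<Rightarrow> nat \<Rightarrow> bool" where
  "relation l x e \<longleftrightarrow> (\<exists>c \<Phi>. c \<noteq> 0 \<and> lead_coeff \<Phi> = 1 \<and> degree \<Phi> = e \<and>
    poly (map_poly (at_forms l q) \<Phi>) (Const c * x) \<in> P)"

text \<open>Noether normalisation for one coordinate x. The q + 1 elements l, x satisfy a form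
  \<open>G\<close>; projecting along x, with l' = l - \<kappa> x and G(\<kappa>) nonzero, makes the
  relation monic in x. Complex \<kappa> keep the forms complex.\<close>

lemma integral_system:
  assumes l: "system l" and i: "i \<le> n" and span: "Var i \<notin> span_mod P l {..<q}"
  shows "\<exists>l' e. system l' \<and> Var i \<notin> span_mod P l' {..<q} \<and> relation l' (Var i) e"
proof -
  let ?x = "Var i :: (nat, complex poly fract) mpoly"
  let ?L = "range (linear_form n)"
  have xL: "?x \<in> ?L" using Var_linear_form[OF i] by blast
  define g where "g = l(q := ?x)"
  have gL: "\<forall>j<Suc q. g j \<in> ?L" using l xL by (simp add: g_def system_def less_Suc_eq)
  have "\<not> independent_mod P g {..<Suc q}"
    using l by (intro dependent_of_cuts[OF hom finite_lessThan _ _ finite_vars_P, of q l])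
      (auto simp: system_def intro: L_homogeneous[unfolded One_nat_def])
  then obtain G0 where G0: "G0 \<in> mpolys {..<Suc q}" "peval Const g G0 \<in> P" "G0 \<noteq> 0"
    by (auto simp: independent_mod_def)
  from hom_part_relation[OF hom gL G0] obtain e where
    e: "hom_part e G0 \<in> mpolys {..<Suc q} \<and> homogeneous e (hom_part e G0) \<and> hom_part e G0 \<noteq> 0 \<and>
      peval Const g (hom_part e G0) \<in> P" by (elim exE)
  define G where "G = hom_part e G0"
  have G: "G \<in> mpolys {..<Suc q}" "homogeneous e G" "G \<noteq> 0" "peval Const g G \<in> P"
    using e unfolding G_def by blast+
  have cutsg: "cuts P g {..<Suc q}"
  proof (rule cuts_mono[OF _ idealP])
    show "cuts P l {..<q}" using l by (simp add: system_def)
    fix a assume "a \<in> {..<q}"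
    then show "l a \<in> gen_ideal P g {..<Suc q}"
      using gen_ideal_gen[OF idealP finite_lessThan, of a "Suc q" g] by (simp add: g_def)
  qed (rule subset_gen_ideal)
  have "q \<in> {..<Suc q}" by simp
  from drop_form[OF idealP finite_lessThan cutsg this G infinite_k0 k0_divide] obtain \<kappa> where
    \<kappa>: "\<forall>a. \<kappa> a \<in> range of_complex" "\<kappa> q = 1" "mpoly_eval G \<kappa> \<noteq> 0"
      "cuts P (\<lambda>a. g a - Const (\<kappa> a) * g q) ({..<Suc q} - {q})" by (elim exE conjE)
  define l' where "l' a = g a - Const (\<kappa> a) * g q" for a
  have l': "l' a = l a - Const (\<kappa> a) * ?x" if "a < q" for a using that by (simp add: l'_def g_def)
  have sys: "system l'"
    unfolding system_def
  proof (intro conjI allI impI)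
    fix a assume "a < q"
    then have "l a \<in> ?L" using l by (simp add: system_def)
    then show "l' a \<in> ?L" unfolding l'[OF \<open>a < q\<close>] using xL \<kappa>(1) by (intro L_closed) auto
  next
    have "{..<Suc q} - {q} = {..<q}" by auto
    then show "cuts P l' {..<q}" using \<kappa>(4) by (simp add: l'_def[abs_def])
  qed
  \<comment> \<open>A combination of the l' equal to x reads s x = combination of the l modulo
    \<open>P\<close>. If s is nonzero, x was in the old span; if s = 0, independence of the l kills
    all coefficients, whence s = 1.\<close>
  have span': "?x \<notin> span_mod P l' {..<q}"
  proof
    assume "?x \<in> span_mod P l' {..<q}"
    then obtain a where a: "?x - (\<Sum>j<q. Const (a j) * l' j) \<in> P" by (auto simp: span_mod_def)
    define s where "s = 1 + (\<Sum>j<q. a j * \<kappa> j)"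
    have "(\<Sum>j<q. Const (a j) * l' j) = (\<Sum>j<q. Const (a j) * l j - Const (a j * \<kappa> j) * ?x)"
      by (rule sum.cong) (simp_all add: l' Const_simps algebra_simps)
    also have "\<dots> = (\<Sum>j<q. Const (a j) * l j) - Const (\<Sum>j<q. a j * \<kappa> j) * ?x"
      by (simp add: sum_subtractf ring_map_sum[OF ring_map_Const] sum_distrib_right)
    finally have "?x - (\<Sum>j<q. Const (a j) * l' j) = Const s * ?x - (\<Sum>j<q. Const (a j) * l j)"
      by (simp add: s_def Const_simps algebra_simps)
    with a have sx: "Const s * ?x - (\<Sum>j<q. Const (a j) * l j) \<in> P" by simp
    show False
    proof (cases "s = 0")
      case False
      have "Const s * ?x \<in> span_mod P l {..<q}"
        unfolding span_mod_def by (intro CollectI exI[of _ a] sx)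
      from span_mod_scale[OF idealP this, of "inverse s"] show False
        using span unfolding Const_inverse[OF False] by simp
    next
      case True
      then have "- (\<Sum>j<q. Const (a j) * l j) \<in> P" using sx by (simp add: Const_simps)
      then have "(\<Sum>j<q. Const (a j) * l j) \<in> P" using is_idealD(5)[OF idealP, of "- (\<Sum>j<q. Const (a j) * l j)"] by simp
      moreover have "(\<Sum>j<q. Const (a j) * l j) = peval Const l (\<Sum>j<q. Const (a j) * Var j)"
        by (simp add: peval_sum ring_map_Const peval_mult peval_Const peval_Var)
      moreover have "(\<Sum>j<q. Const (a j) * Var j) \<in> mpolys {..<q}"
        by (intro mpolys_sum mpolys_mult Const_in_mpolys) (simp add: Var_in_mpolys_iff)
      ultimately have 0: "(\<Sum>j<q. Const (a j) * Var j :: (nat, complex poly fract) mpoly) = 0"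
        using system_independent[OF l] unfolding independent_mod_def by simp
      have "a j = 0" if "j < q" for j
      proof -
        have "mpoly_eval (\<Sum>j<q. Const (a j) * Var j) (\<lambda>k. if k = j then 1 else 0) = (\<Sum>k<q. if k = j then a j else 0)"
          unfolding mpoly_eval_sum
          by (rule sum.cong) (auto simp: mpoly_eval_mult mpoly_eval_Const mpoly_eval_Var)
        then show ?thesis using that by (simp add: 0 mpoly_eval_0)
      qed
      then have "s = 1" by (simp add: s_def)
      then show False using True by simp
    qed
  qed
  \<comment> \<open>This undoes the projection: l j = l' j + \<kappa> j x with x as polynomial
    variable, so \<Psi> at x is G(l, x).\<close>
  define lin where "lin = (\<lambda>j. if j < q then [:Var j, Const (\<kappa> j):] else [:0, 1:] :: (nat, complex poly fract) mpoly poly)"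
  define \<kappa>' where "\<kappa>' j = (if j < q then \<kappa> j else 1)" for j
  have lin: "degree (lin j) \<le> 1" "coeff (lin j) 1 = Const (\<kappa>' j)" for j
    by (simp_all add: lin_def \<kappa>'_def Const_simps)
  define \<Psi> where "\<Psi> = peval (\<lambda>c. [:Const c:]) lin G"
  define u where "u = mpoly_eval G \<kappa>"
  have "mpoly_eval G \<kappa>' = u"
    unfolding mpoly_eval_eq_peval u_def by (rule peval_cong[OF G(1)]) (auto simp: \<kappa>'_def \<kappa>(2) less_Suc_eq)
  then have \<Psi>: "degree \<Psi> \<le> e" "coeff \<Psi> e = Const u"
    using top_coeff_peval[OF G(2) lin] by (simp_all add: \<Psi>_def)
  have \<Psi>c: "coeff \<Psi> k \<in> mpolys {..<q}" for k
  proof -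
    let ?S = "{p :: (nat, complex poly fract) mpoly poly. \<forall>i. coeff p i \<in> mpolys {..<q}}"
    have "\<Psi> \<in> ?S"
      unfolding \<Psi>_def
    proof (rule peval_in[OF _ _ _ _ _ _ G(1)])
      fix p p' assume "p \<in> ?S" "p' \<in> ?S"
      then show "p * p' \<in> ?S" by (auto simp: coeff_mult intro!: mpolys_sum mpolys_mult)
    qed (auto simp: mpolys_zero mpolys_one mpolys_add coeff_1 coeff_pCons Const_in_mpolys Var_in_mpolys_iff lin_def
        split: nat.splits)
    then show ?thesis by simp
  qed
  have \<Psi>x: "poly (map_poly (peval Const l') \<Psi>) ?x \<in> P"
  proof -
    have r: "ring_map (peval Const l')" by (rule ring_map_peval[OF ring_map_Const])
    have r': "ring_map (\<lambda>p. poly (map_poly (peval Const l') p) ?x)"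
      using ring_map_comp[OF ring_map_poly ring_map_map_poly[OF r]] by (simp add: o_def)
    have "poly (map_poly (peval Const l') \<Psi>) ?x = peval Const (\<lambda>j. poly (map_poly (peval Const l') (lin j)) ?x) G"
      unfolding \<Psi>_def peval_comp[OF r']
      by (simp add: map_poly_pCons ring_mapD[OF r] peval_Const[OF ring_map_Const])
    also have "\<dots> = peval Const g G"
    proof (rule peval_cong[OF G(1)])
      fix j assume "j \<in> {..<Suc q}"
      then show "poly (map_poly (peval Const l') (lin j)) ?x = g j"
        by (cases "j < q")
          (auto simp: lin_def map_poly_pCons ring_mapD[OF r] peval_Const[OF ring_map_Const] peval_Var[OF ring_map_Const]
            l' g_def less_Suc_eq)
    qed
    finally show ?thesis using G(4) by simp
  qed
  define \<Psi>' where "\<Psi>' = smult (Const (inverse u)) \<Psi>"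
  have "u \<noteq> 0" using \<kappa>(3) by (simp add: u_def)
  then have "coeff \<Psi>' e = 1" using Const_inverse[of u 1] \<Psi>(2) by (simp add: \<Psi>'_def)
  moreover have "degree \<Psi>' \<le> e" using \<Psi>(1) degree_smult_le[of "Const (inverse u)" \<Psi>] by (simp add: \<Psi>'_def)
  moreover have "coeff \<Psi>' k \<in> mpolys {..<q}" for k
    using \<Psi>c by (simp add: \<Psi>'_def mpolys_mult Const_in_mpolys)
  moreover have "poly (map_poly (peval Const l') \<Psi>') ?x \<in> P"
  proof -
    have r: "ring_map (peval Const l')" by (rule ring_map_peval[OF ring_map_Const])
    have "\<Psi>' = [:Const (inverse u):] * \<Psi>" by (simp add: \<Psi>'_def)
    then have "map_poly (peval Const l') \<Psi>' = map_poly (peval Const l') [:Const (inverse u):] * map_poly (peval Const l') \<Psi>"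
      by (simp only: ring_mapD(4)[OF ring_map_map_poly[OF r]])
    then have "poly (map_poly (peval Const l') \<Psi>') ?x = peval Const l' (Const (inverse u)) * poly (map_poly (peval Const l') \<Psi>) ?x"
      by (simp add: map_poly_pCons ring_mapD[OF r])
    then show ?thesis using is_idealD(3)[OF idealP \<Psi>x] by simp
  qed
  ultimately have "relation l' ?x e"
    unfolding relation_def by (intro monic_relation_clear[OF _ _ _ idealP])
  then show ?thesis using sys span' by blast
qed

end

definition line_form :: "(nat \<Rightarrow> complex) \<Rightarrow> (nat \<Rightarrow> complex) \<Rightarrow> nat \<Rightarrow> (nat, complex) mpoly \<Rightarrow> complex poly" where
  "line_form A B q = peval (\<lambda>c. [:c:]) (\<lambda>j. if j < q then [:A j, B j:] else [:0, 1:])"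

lemma ring_map_line_form: "ring_map (line_form A B q)"
  unfolding line_form_def by (rule ring_map_peval[OF ring_map_const_poly])

lemma at_forms_on_line:
  assumes E: "ring_map E" "\<And>c. E (Const c) = c" "\<And>j. j < q \<Longrightarrow> E (l j) = to_fract [:A j, B j:]"
  shows "E (at_forms l q G) = to_fract (line_form A B q G)"
proof -
  have "(\<lambda>j. E (if j < q then l j else Const fract_X)) = (\<lambda>j. to_fract (if j < q then [:A j, B j:] else [:0, 1:]))"
    by (intro ext) (simp add: E fract_X_def)
  then show ?thesis
    unfolding at_forms_def line_form_def peval_comp[OF E(1)] peval_comp[OF ring_map_to_fract]
    by (simp add: E(2) of_complex_def)
qed

text \<open>\<open>at_forms\<close> sends all variables from \<open>q\<close> on to t, so they may
  be identified. Afterwards only the coordinates 0, ..., q matter when coefficients are evaluated at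
  points or on lines.\<close>

definition collapse :: "nat \<Rightarrow> (nat, complex) mpoly \<Rightarrow> (nat, complex) mpoly" where
  "collapse q = peval Const (\<lambda>j. Var (min j q))"

lemma ring_map_collapse: "ring_map (collapse q)"
  unfolding collapse_def by (rule ring_map_peval[OF ring_map_Const])

lemma collapse_in_mpolys: "collapse q G \<in> mpolys {..q}"
  unfolding collapse_def by (rule peval_in_mpolys[OF mpolys_UNIV]) (auto simp: Const_in_mpolys Var_in_mpolys_iff)

lemma at_forms_collapse: "at_forms l q (collapse q G) = at_forms l q G"
proof -
  have "(\<lambda>j. at_forms l q (Var (min j q))) = (\<lambda>j. if j < q then l j else Const fract_X)"
    by (intro ext) (auto simp: at_forms_def peval_Var[OF ring_map_Const_of_complex] min_def)
  then show ?thesis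
    unfolding collapse_def peval_comp[OF ring_map_at_forms]
    by (simp add: at_forms_def peval_Const[OF ring_map_Const_of_complex])
qed

text \<open>The relation is divided by \<open>w\<close>, which lies outside the prime
  \<open>I\<close>, until its constant term is nonzero.\<close>

lemma strip_constant_term:
  assumes "poly (map_poly h p) w \<in> I" "p \<noteq> 0" "ring_map h" "is_prime I" "w \<notin> I" "\<And>i. coeff p i \<in> S"
  shows "\<exists>a p'. a \<noteq> 0 \<and> a \<in> S \<and> h a + w * poly (map_poly h p') w \<in> I"
  using assms(1,2,6)
proof (induction p)
  case (pCons a p)
  have eq: "h a + w * poly (map_poly h p) w \<in> I"
    using pCons.prems(1) by (simp add: map_poly_pCons ring_mapD[OF assms(3)])
  show ?case
  proof (cases "a = 0")
    case False
    then show ?thesis using eq pCons.prems(3)[of 0] by auto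
  next
    case True
    then have "w * poly (map_poly h p) w \<in> I" using eq by (simp add: ring_mapD[OF assms(3)])
    then have "poly (map_poly h p) w \<in> I" using is_primeD(3)[OF assms(4)] assms(5) by blast
    moreover have "p \<noteq> 0" using True pCons.prems(2) by simp
    moreover have "coeff p i \<in> S" for i using pCons.prems(3)[of "Suc i"] by simp
    ultimately show ?thesis by (rule pCons.IH)
  qed
qed simp

context variety
begin

text \<open>The derivative divided by e is monic of degree e - 1. For minimal e it therefore cannot
  vanish at the root modulo \<open>P\<close>, which makes the root generically simple.\<close>

lemma relation_derivative:
  assumes \<Phi>: "lead_coeff \<Phi> = 1" "degree \<Phi> = e" "c \<noteq> 0"
    and rel: "poly (map_poly (at_forms l q) (pderiv \<Phi>)) (Const c * x) \<in> P"
  shows "e > 0 \<Longrightarrow> relation l x (e - 1)"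
proof -
  assume e: "e > 0"
  define \<Phi>' where "\<Phi>' = smult (Const (1 / of_nat e)) (pderiv \<Phi>)"
  have "(Const (1 / of_nat e) :: (nat, complex) mpoly) * of_nat e = 1"
    using e by (simp only: ring_map_of_nat[OF ring_map_Const, symmetric] Const_simps(4)[symmetric]) (simp add: Const_simps)
  then have 1: "coeff \<Phi>' (e - 1) = 1"
    using e \<Phi> by (simp add: \<Phi>'_def coeff_pderiv)
  have "degree \<Phi>' \<le> e - 1"
    using \<Phi>(2) by (intro degree_le) (auto simp: \<Phi>'_def coeff_pderiv coeff_eq_0)
  moreover have "e - 1 \<le> degree \<Phi>'" using 1 by (intro le_degree) simp
  ultimately have "degree \<Phi>' = e - 1" by simp
  moreover have "poly (map_poly (at_forms l q) \<Phi>') (Const c * x) \<in> P"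
  proof -
    have "\<Phi>' = [:Const (1 / of_nat e):] * pderiv \<Phi>" by (simp add: \<Phi>'_def)
    then have "poly (map_poly (at_forms l q) \<Phi>') (Const c * x) =
        poly (map_poly (at_forms l q) [:Const (1 / of_nat e):]) (Const c * x) * poly (map_poly (at_forms l q) (pderiv \<Phi>)) (Const c * x)"
      by (simp only: ring_mapD(4)[OF ring_map_map_poly[OF ring_map_at_forms]] poly_mult)
    then show ?thesis using is_idealD(3)[OF idealP rel] by simp
  qed
  ultimately show ?thesis unfolding relation_def using 1 \<Phi>(3)
    by (intro exI[of _ c] exI[of _ \<Phi>']) simp
qed

text \<open>A root \<open>g\<close> splits off a linear factor; the cofactor is monic of smaller
  degree and cannot vanish, by minimality.\<close>

lemma relation_root:
  assumes \<Phi>: "lead_coeff \<Phi> = 1" "degree \<Phi> = e" "c \<noteq> 0"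
    and rel: "poly (map_poly (at_forms l q) \<Phi>) (Const c * x) \<in> P"
    and g: "poly \<Phi> g = 0" and minimal: "\<And>d. d < e \<Longrightarrow> \<not> relation l x d"
  shows "Const c * x - at_forms l q g \<in> P"
proof -
  obtain H where H: "\<Phi> = [:- g, 1:] * H" using g by (metis dvdE poly_eq_0_iff_dvd)
  have "H \<noteq> 0" using H \<Phi>(1) by auto
  then have d: "degree \<Phi> = Suc (degree H)"
    unfolding H by (subst degree_mult_eq) auto
  have "lead_coeff H = 1" using \<Phi>(1) unfolding H lead_coeff_mult by simp
  have "poly (map_poly (at_forms l q) \<Phi>) (Const c * x) =
      (Const c * x - at_forms l q g) * poly (map_poly (at_forms l q) H) (Const c * x)"
    unfolding H ring_mapD(4)[OF ring_map_map_poly[OF ring_map_at_forms]] poly_mult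
    by (simp add: map_poly_pCons ring_mapD[OF ring_map_at_forms] ring_map_uminus[OF ring_map_at_forms])
  then have "Const c * x - at_forms l q g \<in> P \<or> poly (map_poly (at_forms l q) H) (Const c * x) \<in> P"
    using rel is_primeD(3)[OF prime] by metis
  moreover have "poly (map_poly (at_forms l q) H) (Const c * x) \<notin> P"
    using minimal[of "degree H"] d \<Phi>(2,3) \<open>lead_coeff H = 1\<close> unfolding relation_def by auto
  ultimately show ?thesis by blast
qed

text \<open>In degree 1 only the part of \<open>g\<close> that is linear in the forms remains, with
  coefficients in C(t), and it must agree with c x modulo \<open>P\<close>.\<close>

lemma span_of_at_forms:
  assumes l: "system l" and x: "homogeneous 1 x" and c: "c \<noteq> 0" and "Const c * x - at_forms l q g \<in> P"
  shows "x \<in> span_mod P l {..<q}"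
proof -
  have ig: "inclusion q g \<in> mpolys {..<q}"
    unfolding inclusion_def by (rule peval_in_mpolys[OF mpolys_UNIV]) (auto simp: Const_in_mpolys Var_in_mpolys_iff)
  define F where "F = hom_part 1 (inclusion q g)"
  have "hom_part 1 (Const c * x - at_forms l q g) \<in> P" by (rule hom_idealD(2)[OF hom assms(4)])
  moreover have "hom_part 1 (at_forms l q g) = peval Const l F"
    unfolding at_forms_inclusion F_def using l
    by (intro hom_part_peval[OF ig]) (auto simp: system_def homogeneous_Const ring_map_Const intro: L_homogeneous[unfolded One_nat_def])
  moreover have "hom_part 1 (Const c * x) = Const c * x"
    using hom_part_homogeneous[OF homogeneous_Const_mult[OF x, of c], of 1] by simp
  ultimately have "Const c * x - peval Const l F \<in> P" by (simp add: hom_part_diff)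
  moreover have "peval Const l F = (\<Sum>j<q. Const (Poly_Mapping.lookup F (Poly_Mapping.single j 1)) * l j)"
    by (subst homogeneous_1_linear[OF _ _ finite_lessThan, of F q])
      (simp_all add: F_def homogeneous_hom_part[of 1, unfolded One_nat_def] hom_part_in_mpolys[OF ig] peval_sum ring_map_Const peval_mult peval_Const peval_Var)
  ultimately have "Const c * x \<in> span_mod P l {..<q}"
    unfolding span_mod_def by (intro CollectI exI[of _ "\<lambda>j. Poly_Mapping.lookup F (Poly_Mapping.single j 1)"]) simp
  from span_mod_scale[OF idealP this, of "inverse c"] show ?thesis
    unfolding Const_inverse[OF c] .
qed

text \<open>A substitute for the discriminant: a relation for \<open>w\<close> over the forms whose
  constant term \<Delta> is nonzero. With the derivative of the equation at its root as
  \<open>w\<close>, this derivative is nonzero wherever \<Delta> is.\<close>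

lemma discriminant:
  assumes l: "system l" and w: "w \<notin> P"
  shows "\<exists>\<Delta> p. \<Delta> \<noteq> 0 \<and> \<Delta> \<in> mpolys {..q} \<and> at_forms l q \<Delta> + w * poly (map_poly (at_forms l q) p) w \<in> P"
proof -
  have "\<not> independent_mod P (l(q := w)) {..<Suc q}"
    using l by (intro dependent_of_cuts[OF hom finite_lessThan _ _ finite_vars_P, of q l])
      (auto simp: system_def intro: L_homogeneous[unfolded One_nat_def])
  then obtain G where G: "G \<in> mpolys {..<Suc q}" "peval Const (l(q := w)) G \<in> P" "G \<noteq> 0"
    by (auto simp: independent_mod_def)
  define \<Psi> where "\<Psi> = unpack q G"
  have \<Psi>: "\<Psi> \<noteq> 0" using G(3) unpack_inj[of q G] by (auto simp: \<Psi>_def)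
  have "coeff \<Psi> i \<in> mpolys {..<q}" for i
    using G(1) unfolding \<Psi>_def by (intro coeff_unpack_in_mpolys) (simp add: lessThan_Suc)
  from inclusion_clear_poly[OF this] obtain a p where
    p: "a \<noteq> 0" "\<forall>i. coeff p i \<in> mpolys {..q}" "map_poly (inclusion q) p = smult (Const (to_fract a)) \<Psi>"
    by (elim exE conjE)
  have "smult (Const (to_fract a)) \<Psi> \<noteq> 0" using p(1) \<Psi> Const_eq_0_iff[of "to_fract a"] by simp
  then have "p \<noteq> 0" using p(3) by auto
  moreover have "poly (map_poly (at_forms l q) p) w \<in> P"
  proof -
    have r: "ring_map (peval Const l)" by (rule ring_map_peval[OF ring_map_Const])
    have "smult (Const (to_fract a)) \<Psi> = [:Const (to_fract a):] * \<Psi>" by simp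
    then have "poly (map_poly (at_forms l q) p) w =
        poly (map_poly (peval Const l) [:Const (to_fract a):]) w * poly (map_poly (peval Const l) \<Psi>) w"
      unfolding map_at_forms_inclusion p(3) by (simp only: ring_mapD(4)[OF ring_map_map_poly[OF r]] poly_mult)
    moreover have "poly (map_poly (peval Const l) \<Psi>) w \<in> P"
      unfolding \<Psi>_def poly_unpack[OF ring_map_Const] by (rule G(2))
    ultimately show ?thesis using is_idealD(3)[OF idealP] by simp
  qed
  ultimately show ?thesis
    using strip_constant_term[of "at_forms l q" p w P "mpolys {..q}", OF _ _ ring_map_at_forms prime w] p(2) by blast
qed

text \<open>\<open>E\<close> is evaluation at a rational point of the cone whose forms take the
  values of the given line. It carries the integral equation to one over C[t], so E y is a
  polynomial by \<open>monic_root_fract\<close>, and \<Delta> makes its initial value a simple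
  root.\<close>

lemma lines_have_roots:
  assumes l: "system l" and \<Phi>: "lead_coeff \<Phi> = 1" "\<And>i. coeff \<Phi> i \<in> mpolys {..q}"
    and rel: "poly (map_poly (at_forms l q) \<Phi>) y \<in> P"
    and \<Delta>: "\<Delta> \<in> mpolys {..q}" "mpoly_eval \<Delta> p \<noteq> 0"
      "at_forms l q \<Delta> + poly (map_poly (at_forms l q) (pderiv \<Phi>)) y *
        poly (map_poly (at_forms l q) \<Psi>) (poly (map_poly (at_forms l q) (pderiv \<Phi>)) y) \<in> P"
    and a: "v q \<noteq> 0"
    and E: "ring_map E" "\<And>c. E (Const c) = c" "\<And>f. f \<in> P \<Longrightarrow> E f = 0"
      "\<And>j. j < q \<Longrightarrow> E (l j) = to_fract [:p j - p q * v j / v q, v j / v q:]"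
  shows "\<exists>y. poly (map_poly (peval (\<lambda>c. [:c:]) (\<lambda>i. [:p i, v i:])) \<Phi>) y = 0 \<and>
    poly (map_poly (\<lambda>G. mpoly_eval G p) (pderiv \<Phi>)) (poly y 0) \<noteq> 0"
proof -
  \<comment> \<open>The complex line p + T v in the coordinates (l_0, ..., l_{q-1}, t),
    reparametrised by its last coordinate t = p q + T v q.\<close>
  define A where "A j = p j - p q * v j / v q" for j
  define B where "B j = v j / v q" for j
  let ?\<kappa> = "line_form A B q"
  note r\<kappa> = ring_map_line_form[of A B q]
  have EE: "E (at_forms l q G) = to_fract (?\<kappa> G)" for G
    using E(4) by (intro at_forms_on_line[OF E(1,2)]) (simp_all add: A_def B_def)
  have Epoly: "E (poly (map_poly (at_forms l q) r) x) = poly (map_poly to_fract (map_poly ?\<kappa> r)) (E x)" for r x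
    unfolding ring_map_map_poly_poly[OF E(1)] map_poly_comp[OF E(1) ring_map_at_forms]
      map_poly_comp[OF ring_map_to_fract r\<kappa>] EE ..
  have tf: "poly (map_poly to_fract r) (to_fract x) = to_fract (poly r x)" for r and x :: "complex poly"
    by (rule ring_map_map_poly_poly[OF ring_map_to_fract, symmetric])
  have root: "poly (map_poly to_fract (map_poly ?\<kappa> \<Phi>)) (E y) = 0"
    using E(3)[OF rel] unfolding Epoly .
  from monic_root_fract[OF monic_map_poly(2)[OF r\<kappa> \<Phi>(1)] root] obtain Y where Y: "E y = to_fract Y" ..
  have Yroot: "poly (map_poly ?\<kappa> \<Phi>) Y = 0" using root unfolding Y tf by simp
  define W where "W = poly (map_poly ?\<kappa> (pderiv \<Phi>)) Y"
  have Ew: "E (poly (map_poly (at_forms l q) (pderiv \<Phi>)) y) = to_fract W"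
    unfolding Epoly Y tf W_def ..
  have "to_fract (?\<kappa> \<Delta> + W * poly (map_poly ?\<kappa> \<Psi>) W) = 0"
    using E(3)[OF \<Delta>(3)] unfolding ring_mapD(3,4)[OF E(1)] EE Ew Epoly[of \<Psi>] tf
    by (simp only: ring_mapD(3,4)[OF ring_map_to_fract])
  then have disc: "?\<kappa> \<Delta> + W * poly (map_poly ?\<kappa> \<Psi>) W = 0" by (simp only: to_fract_eq_0_iff)
  have at: "poly (?\<kappa> G) (p q) = mpoly_eval G p" if "G \<in> mpolys {..q}" for G
    unfolding line_form_def peval_comp[OF ring_map_poly] mpoly_eval_eq_peval
    using a by (simp, intro peval_cong[OF that]) (auto simp: A_def B_def le_less)
  have "poly W (p q) \<noteq> 0"
  proof
    assume "poly W (p q) = 0"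
    then have "poly (?\<kappa> \<Delta>) (p q) = 0" using arg_cong[OF disc, of "\<lambda>r. poly r (p q)"] by simp
    then show False using at[OF \<Delta>(1)] \<Delta>(2) by simp
  qed
  \<comment> \<open>Back from t to the parameter T, which is 0 at \<open>p\<close>.\<close>
  define s where "s = [:p q, v q:]"
  let ?line = "peval (\<lambda>c. [:c:]) (\<lambda>i. [:p i, v i:]) :: (nat, complex) mpoly \<Rightarrow> _"
  have rs: "ring_map (\<lambda>r. pcompose r s)"
    by (rule ring_mapI) (simp_all add: pcompose_add pcompose_mult pcompose_1)
  have line: "pcompose (?\<kappa> G) s = ?line G" if "G \<in> mpolys {..q}" for G
    unfolding line_form_def peval_comp[OF rs]
    using a by (simp add: pcompose_const, intro peval_cong[OF that])
      (auto simp: A_def B_def s_def le_less pcompose_pCons field_simps)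
  have rline: "ring_map ?line" by (rule ring_map_peval[OF ring_map_const_poly])
  have "map_poly ?line \<Phi> = map_poly (\<lambda>r. pcompose r s) (map_poly ?\<kappa> \<Phi>)"
    unfolding map_poly_comp[OF rs r\<kappa>]
    by (rule map_poly_cong_coeff) (use line \<Phi>(2) rline ring_map_comp[OF rs r\<kappa>] in \<open>simp_all add: o_def\<close>)
  then have "poly (map_poly ?line \<Phi>) (pcompose Y s) = pcompose (poly (map_poly ?\<kappa> \<Phi>) Y) s"
    using ring_map_map_poly_poly[OF rs, of "map_poly ?\<kappa> \<Phi>" Y] by simp
  then have 1: "poly (map_poly ?line \<Phi>) (pcompose Y s) = 0" by (simp add: Yroot)
  have "coeff (pderiv \<Phi>) i \<in> mpolys {..q}" for i
    unfolding coeff_pderiv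
    using \<Phi>(2)[of "Suc i"] by (intro mpolys_mult)
      (auto simp only: ring_map_of_nat[OF ring_map_Const, symmetric] Const_in_mpolys)
  then have "map_poly (\<lambda>G. mpoly_eval G p) (pderiv \<Phi>) = map_poly (\<lambda>r. poly r (p q)) (map_poly ?\<kappa> (pderiv \<Phi>))"
    unfolding map_poly_comp[OF ring_map_poly r\<kappa>]
    by (intro map_poly_cong_coeff) (use at ring_map_mpoly_eval ring_map_comp[OF ring_map_poly r\<kappa>] in \<open>simp_all add: o_def\<close>)
  then have "poly (map_poly (\<lambda>G. mpoly_eval G p) (pderiv \<Phi>)) (poly Y (p q)) = poly W (p q)"
    unfolding W_def using ring_map_map_poly_poly[OF ring_map_poly[of "p q"], of "map_poly ?\<kappa> (pderiv \<Phi>)" Y] by simp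
  moreover have "poly (pcompose Y s) 0 = poly Y (p q)" by (simp add: poly_pcompose s_def)
  ultimately have 2: "poly (map_poly (\<lambda>G. mpoly_eval G p) (pderiv \<Phi>)) (poly (pcompose Y s) 0) \<noteq> 0"
    using \<open>poly W (p q) \<noteq> 0\<close> by simp
  show ?thesis using 1 2 by blast
qed

text \<open>If all admissible lines carried points, \<open>root_of_roots_on_lines\<close> would give
  a root of the minimal equation in the coefficient ring, and x_i would be a combination of the
  forms. The conditions on A and B, a nonzero first entry of A + B t and first two entries
  independent over C, allow proportionality to the line to be written as linear equations.\<close>

theorem line_without_points:
  assumes l: "system l" and i: "i \<le> n" and span: "Var i \<notin> span_mod P l {..<q}" and rel: "relation l (Var i) e0"
  shows "\<exists>A B. (A 0 \<noteq> 0 \<or> B 0 \<noteq> 0) \<and> (1 < q \<longrightarrow> A 0 * B 1 \<noteq> A 1 * B 0) \<and>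
    \<not> (\<exists>E. ring_map E \<and> (\<forall>c. E (Const c) = c) \<and> (\<forall>f\<in>P. E f = 0) \<and> (\<forall>j<q. E (l j) = to_fract [:A j, B j:]))"
proof (rule ccontr)
  assume contra: "\<not> ?thesis"
  have point: "\<exists>E. ring_map E \<and> (\<forall>c. E (Const c) = c) \<and> (\<forall>f\<in>P. E f = 0) \<and> (\<forall>j<q. E (l j) = to_fract [:A j, B j:])"
    if "A 0 \<noteq> 0 \<or> B 0 \<noteq> 0" "1 < q \<Longrightarrow> A 0 * B 1 \<noteq> A 1 * B 0" for A B
  proof (rule ccontr)
    assume no: "\<not> ?thesis"
    have "1 < q \<longrightarrow> A 0 * B 1 \<noteq> A 1 * B 0" using that(2) by (rule impI)
    from contra[unfolded not_ex, THEN spec[of _ A], THEN spec[of _ B]] that(1) this no show False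
      by (simp only: simp_thms not_ex)
  qed
  define e where "e = (LEAST e. relation l (Var i) e)"
  have "relation l (Var i) e" unfolding e_def by (rule LeastI[of "relation l (Var i)", OF rel])
  then obtain c \<Phi>0 where \<Phi>0: "c \<noteq> 0" "lead_coeff \<Phi>0 = 1" "degree \<Phi>0 = e"
    "poly (map_poly (at_forms l q) \<Phi>0) (Const c * Var i) \<in> P" unfolding relation_def by blast
  have minimal: "\<not> relation l (Var i) d" if "d < e" for d using that unfolding e_def by (rule not_less_Least)
  define y where "y = Const c * (Var i :: (nat, complex poly fract) mpoly)"
  define \<Phi> where "\<Phi> = map_poly (collapse q) \<Phi>0"
  have \<Phi>: "lead_coeff \<Phi> = 1" "degree \<Phi> = e"
    using monic_map_poly[OF ring_map_collapse \<Phi>0(2)] \<Phi>0(3) by (simp_all add: \<Phi>_def)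
  have \<Phi>q: "coeff \<Phi> k \<in> mpolys {..q}" for k
    by (simp add: \<Phi>_def coeff_map_poly_ring[OF ring_map_collapse] collapse_in_mpolys)
  have \<Phi>y: "poly (map_poly (at_forms l q) \<Phi>) y \<in> P"
    using \<Phi>0(4) unfolding \<Phi>_def map_poly_comp[OF ring_map_at_forms ring_map_collapse] at_forms_collapse y_def .
  define w where "w = poly (map_poly (at_forms l q) (pderiv \<Phi>)) y"
  have "e > 0"
  proof (rule ccontr)
    assume "\<not> e > 0"
    then obtain a where "\<Phi> = [:a:]" using \<Phi>(2) degree_eq_zeroE[of \<Phi>] by auto
    then have "\<Phi> = 1" using \<Phi>(1) by (simp add: one_pCons)
    then show False using \<Phi>y is_primeD(2)[OF prime] by (simp add: ring_mapD[OF ring_map_map_poly[OF ring_map_at_forms]])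
  qed
  then have "w \<notin> P"
    using relation_derivative[OF \<Phi> \<Phi>0(1), of l "Var i"] minimal[of "e - 1"] by (auto simp: w_def y_def)
  from discriminant[OF l this] obtain \<Delta> \<Psi> where
    \<Delta>: "\<Delta> \<noteq> 0" "\<Delta> \<in> mpolys {..q}" "at_forms l q \<Delta> + w * poly (map_poly (at_forms l q) \<Psi>) w \<in> P"
    by (elim exE conjE)
  \<comment> \<open>A nonzero p 0 guarantees that A 0 or B 0 is nonzero: if v 0 = 0, then A 0 = p
    0.\<close>
  have "\<Delta> * Var 0 \<noteq> 0" using \<Delta>(1) Var_neq_0 by simp
  then obtain p where "mpoly_eval (\<Delta> * Var 0) p \<noteq> 0"
    using mpoly_nonvanishing[OF infinite_UNIV_char_0] by blast
  then have p: "mpoly_eval \<Delta> p \<noteq> 0" "p 0 \<noteq> 0" by (simp_all add: mpoly_eval_mult mpoly_eval_Var)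
  \<comment> \<open>\<open>h\<close> excludes directions along which t is constant and, for q >= 2,
    those where A 0 B 1 - A 1 B 0 = (p 0 v 1 - p 1 v 0) / v q is zero. For q = 1 the index 1 stands
    for t and not for a form.\<close>
  define h :: "(nat, complex) mpoly" where
    "h = (if q = 1 then Var q else Var q * (Const (p 0) * Var 1 - Const (p 1) * Var 0))"
  have h: "mpoly_eval h v = (if q = 1 then v q else v q * (p 0 * v 1 - p 1 * v 0))" for v
    by (simp add: h_def mpoly_eval_mult mpoly_eval_Var mpoly_eval_Const ring_map_diff[OF ring_map_mpoly_eval])
  have "mpoly_eval h (\<lambda>j. if j = 0 then 0 else 1) \<noteq> 0" using q_pos p(2) by (simp add: h)
  then have "h \<noteq> 0" by (auto simp: mpoly_eval_0)
  have "\<exists>g. poly \<Phi> g = 0"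
  proof (rule root_of_roots_on_lines[OF \<Phi>(1) \<open>h \<noteq> 0\<close>])
    fix v assume hv: "mpoly_eval h v \<noteq> 0"
    then have vq: "v q \<noteq> 0" by (auto simp: h split: if_splits)
    let ?A = "\<lambda>j. p j - p q * v j / v q" and ?B = "\<lambda>j. v j / v q"
    have "?A 0 \<noteq> 0 \<or> ?B 0 \<noteq> 0" using p(2) by auto
    moreover have "?A 0 * ?B 1 \<noteq> ?A 1 * ?B 0" if "1 < q"
      using hv that vq by (simp add: h field_simps)
    ultimately have "\<exists>E. ring_map E \<and> (\<forall>c. E (Const c) = c) \<and> (\<forall>f\<in>P. E f = 0) \<and>
        (\<forall>j<q. E (l j) = to_fract [:?A j, ?B j:])"
      by (intro point) simp_all
    then obtain E where E: "ring_map E" "\<forall>c. E (Const c) = c" "\<forall>f\<in>P. E f = 0"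
      "\<forall>j<q. E (l j) = to_fract [:?A j, ?B j:]" by (elim exE conjE)
    show "\<exists>y. poly (map_poly (peval (\<lambda>c. [:c:]) (\<lambda>i. [:p i, v i:])) \<Phi>) y = 0 \<and>
        poly (map_poly (\<lambda>G. mpoly_eval G p) (pderiv \<Phi>)) (poly y 0) \<noteq> 0"
      by (rule lines_have_roots[where v = v and E = E, OF l \<Phi>(1) \<Phi>q \<Phi>y \<Delta>(2) p(1) \<Delta>(3)[unfolded w_def] vq E(1)]) (use E in auto)
  qed
  then obtain g where "poly \<Phi> g = 0" ..
  then have "Const c * Var i - at_forms l q g \<in> P"
    using relation_root[OF \<Phi> \<Phi>0(1) \<Phi>y[unfolded y_def]] minimal by blast
  then have "Var i \<in> span_mod P l {..<q}" using span_of_at_forms[OF l homogeneous_Var \<Phi>0(1)] by blast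
  then show False using span by blast
qed

end

subsection \<open>Linear varieties have degree one\<close>

text \<open>The classes of the \<open>e m\<close> form a basis of U / U0. Coefficient families are
  used because independence and spanning modulo an ideal come in this shape.\<close>

lemma (in vector_space) dim_eq_add_complement:
  assumes U: "subspace U" "U \<subseteq> span F" "finite F" and U0: "subspace U0" "U0 \<subseteq> U"
    and M: "finite M" "\<And>m. m \<in> M \<Longrightarrow> e m \<in> U"
    and indep: "\<And>d. (\<Sum>m\<in>M. scale (d m) (e m)) \<in> U0 \<Longrightarrow> \<forall>m\<in>M. d m = 0"
    and span: "\<And>f. f \<in> U \<Longrightarrow> \<exists>d. f - (\<Sum>m\<in>M. scale (d m) (e m)) \<in> U0"
  shows "dim U = dim U0 + card M"
proof -
  obtain B where B: "B \<subseteq> U0" "independent B" "U0 \<subseteq> span B" "card B = dim U0"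
    using basis_exists[of U0] by blast
  have "B \<subseteq> span F" using B(1) U0(2) U(2) by blast
  then have finB: "finite B" using independent_span_bound[OF U(3) B(2)] by simp
  have single: "e k \<notin> U0" if "k \<in> M" for k
  proof
    assume "e k \<in> U0"
    moreover have "(\<Sum>m\<in>M. scale (if m = k then 1 else 0) (e m)) = (\<Sum>m\<in>M. if m = k then e m else 0)"
      by (rule sum.cong) auto
    ultimately have "(\<Sum>m\<in>M. scale (if m = k then 1 else 0) (e m)) \<in> U0" using M(1) that by simp
    from indep[OF this] that show False by auto
  qed
  have inj: "inj_on e M"
  proof (rule inj_onI, rule ccontr)
    fix k k' assume k: "k \<in> M" "k' \<in> M" "e k = e k'" "k \<noteq> k'"
    define d :: "_ \<Rightarrow> 'a" where "d m = (if m = k then 1 else 0) - (if m = k' then 1 else 0)" for m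
    have "(\<Sum>m\<in>M. scale (d m) (e m)) = (\<Sum>m\<in>M. (if m = k then e m else 0) - (if m = k' then e m else 0))"
      by (rule sum.cong) (auto simp: d_def)
    also have "\<dots> = 0" using k M(1) by (simp add: sum_subtractf)
    finally have "(\<Sum>m\<in>M. scale (d m) (e m)) \<in> U0" using subspace_0[OF U0(1)] by simp
    from indep[OF this] k show False by (auto simp: d_def)
  qed
  have disj: "B \<inter> e ` M = {}" using single B(1) by blast
  have fin: "finite (B \<union> e ` M)" using finB M(1) by simp
  have "independent (B \<union> e ` M)"
    unfolding dependent_finite[OF fin]
  proof (intro notI, elim exE conjE)
    fix u assume ex: "\<exists>v\<in>B \<union> e ` M. u v \<noteq> 0" and "(\<Sum>v\<in>B \<union> e ` M. scale (u v) v) = 0"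
    then have sum: "(\<Sum>v\<in>B. scale (u v) v) + (\<Sum>m\<in>M. scale (u (e m)) (e m)) = 0"
      using finB M(1) disj by (simp add: sum.union_disjoint sum.reindex[OF inj])
    then have "(\<Sum>m\<in>M. scale (u (e m)) (e m)) = - (\<Sum>v\<in>B. scale (u v) v)"
      by (simp add: eq_neg_iff_add_eq_0 add.commute)
    moreover have "- (\<Sum>v\<in>B. scale (u v) v) \<in> U0"
      using B(1) by (intro subspace_neg[OF U0(1)] subspace_sum[OF U0(1)] subspace_scale[OF U0(1)]) auto
    ultimately have "(\<Sum>m\<in>M. scale (u (e m)) (e m)) \<in> U0" by simp
    from indep[OF this] have 0: "\<forall>m\<in>M. u (e m) = 0" .
    then have "(\<Sum>v\<in>B. scale (u v) v) = 0" using sum by simp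
    then have "\<forall>v\<in>B. u v = 0" using B(2) unfolding dependent_finite[OF finB] by blast
    then show False using ex 0 by blast
  qed
  moreover have "U \<subseteq> local.span (B \<union> e ` M)"
  proof
    fix f assume "f \<in> U"
    then obtain d where "f - (\<Sum>m\<in>M. scale (d m) (e m)) \<in> U0" using span by blast
    then have "f - (\<Sum>m\<in>M. scale (d m) (e m)) \<in> local.span (B \<union> e ` M)"
      using B(3) span_mono[of B "B \<union> e ` M"] by blast
    moreover have "(\<Sum>m\<in>M. scale (d m) (e m)) \<in> local.span (B \<union> e ` M)"
      by (intro span_sum span_scale span_base) auto
    ultimately have "(f - (\<Sum>m\<in>M. scale (d m) (e m))) + (\<Sum>m\<in>M. scale (d m) (e m)) \<in> local.span (B \<union> e ` M)"
      by (rule span_add)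
    then show "f \<in> local.span (B \<union> e ` M)" by simp
  qed
  moreover have "B \<union> e ` M \<subseteq> U" using B(1) U0(2) M(2) by blast
  moreover have "card (B \<union> e ` M) = dim U0 + card M"
    using finB M(1) disj B(4) by (simp add: card_Un_disjoint card_image[OF inj])
  ultimately show ?thesis by (intro dim_unique)
qed

text \<open>Stars and bars, through lists of length \<open>q\<close> with sum
  \<open>s\<close>.\<close>

lemma card_exponents:
  assumes "q > 0"
  shows "card {\<alpha> :: nat \<Rightarrow>\<^sub>0 nat. Poly_Mapping.keys \<alpha> \<subseteq> {..<q} \<and> mon_degree \<alpha> = s} = (s + (q - 1)) choose (q - 1)"
proof -
  let ?E = "{\<alpha> :: nat \<Rightarrow>\<^sub>0 nat. Poly_Mapping.keys \<alpha> \<subseteq> {..<q} \<and> mon_degree \<alpha> = s}"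
  let ?f = "\<lambda>\<alpha>. map (Poly_Mapping.lookup \<alpha>) [0..<q]"
  have deg: "mon_degree \<alpha> = sum_list (?f \<alpha>)" if "Poly_Mapping.keys \<alpha> \<subseteq> {..<q}" for \<alpha>
    using mon_degree_superset[OF finite_lessThan that] by (simp add: interv_sum_list_conv_sum_set_nat lessThan_atLeast0)
  have "bij_betw ?f ?E {l. length l = q \<and> sum_list l = s}"
  proof (rule bij_betwI')
    fix \<alpha> \<beta> assume ab: "\<alpha> \<in> ?E" "\<beta> \<in> ?E"
    show "?f \<alpha> = ?f \<beta> \<longleftrightarrow> \<alpha> = \<beta>"
    proof
      assume eq: "?f \<alpha> = ?f \<beta>"
      show "\<alpha> = \<beta>"
      proof (rule poly_mapping_eqI)
        fix v show "Poly_Mapping.lookup \<alpha> v = Poly_Mapping.lookup \<beta> v"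
        proof (cases "v < q")
          case True
          then show ?thesis using arg_cong[OF eq, of "\<lambda>l. l ! v"] by simp
        next
          case False
          then have "v \<notin> Poly_Mapping.keys \<alpha>" "v \<notin> Poly_Mapping.keys \<beta>" using ab by auto
          then show ?thesis by (simp add: in_keys_iff)
        qed
      qed
    qed simp
  next
    fix \<alpha> assume "\<alpha> \<in> ?E"
    then show "?f \<alpha> \<in> {l. length l = q \<and> sum_list l = s}" using deg[of \<alpha>] by simp
  next
    fix l :: "nat list" assume "l \<in> {l. length l = q \<and> sum_list l = s}"
    then have l: "length l = q" "sum_list l = s" by auto
    define \<alpha> where "\<alpha> = (\<Sum>i<q. Poly_Mapping.single i (l ! i))"
    have lk: "Poly_Mapping.lookup \<alpha> v = (if v < q then l ! v else 0)" for v
      by (simp add: \<alpha>_def lookup_sum lookup_single when_def sum.delta)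
    have k: "Poly_Mapping.keys \<alpha> \<subseteq> {..<q}" by (auto simp: in_keys_iff lk split: if_splits)
    have "l = ?f \<alpha>" using l(1) by (intro nth_equalityI) (simp_all add: lk)
    then show "\<exists>\<alpha>\<in>?E. l = ?f \<alpha>" using k deg[OF k] l(2) by (intro bexI[of _ \<alpha>]) auto
  qed
  then have "card ?E = card {l :: nat list. length l = q \<and> sum_list l = s}" by (rule bij_betw_same_card)
  also have "\<dots> = (s + q - 1) choose s" by (rule card_length_sum_list)
  also have "\<dots> = (s + (q - 1)) choose (q - 1)"
    using assms binomial_symmetric[of s "s + (q - 1)"] by simp
  finally show ?thesis .
qed

text \<open>This is the Hilbert function of projective r-space, a polynomial with leading
  coefficient 1 / r!. The Hilbert polynomial agrees with it at infinitely many integers and so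
  equals it.\<close>

lemma degree_one_of_hilbert_function:
  fixes X :: "('v, 'k::field) mpoly set set"
  assumes "has_degree V X d" "\<And>s. hilbert_function V X s = (s + r) choose r"
  shows "d = 1"
proof -
  obtain p where p: "is_hilbert_polynomial V X p" "of_nat d = fact (degree p) * lead_coeff p"
    using assms(1) unfolding has_degree_def by blast
  \<comment> \<open>The binomial coefficient (s + r choose r) as a polynomial in s.\<close>
  define g :: "rat poly" where "g = smult (1 / fact r) (\<Prod>i<r. [:of_nat (Suc i), 1:])"
  have g: "poly g (of_nat s) = of_nat ((s + r) choose r)" for s
  proof -
    have "(of_nat ((s + r) choose r) :: rat) = of_nat (s + r) gchoose r" by (rule binomial_gbinomial)
    also have "\<dots> = pochhammer (of_nat s + 1) r / fact r" by (simp add: gbinomial_pochhammer')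
    also have "\<dots> = (\<Prod>i<r. of_nat (Suc i) + of_nat s) / fact r"
      by (simp add: pochhammer_prod atLeast0LessThan add_ac)
    finally show ?thesis by (simp add: g_def poly_prod)
  qed
  have "degree (\<Prod>i<r. [:of_nat (Suc i), 1 :: rat:]) = r"
    by (subst degree_prod_eq_sum_degree) auto
  then have dg: "degree g = r" by (simp add: g_def)
  have "lead_coeff g = 1 / fact r"
    by (simp add: g_def lead_coeff_prod del: of_nat_Suc)
  then have lg: "fact (degree g) * lead_coeff g = (1 :: rat)" by (simp add: dg)
  obtain N where N: "\<And>s. s \<ge> N \<Longrightarrow> of_nat (hilbert_function V X s) = poly p (of_nat s)"
    using p(1) unfolding is_hilbert_polynomial_def eventually_sequentially by blast
  have "(of_nat :: nat \<Rightarrow> rat) ` {N..} \<subseteq> {x. poly (p - g) x = 0}"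
    using N by (auto simp: assms(2) g)
  moreover have "infinite ((of_nat :: nat \<Rightarrow> rat) ` {N..})"
    using finite_imageD[of "of_nat :: nat \<Rightarrow> rat" "{N..}"] by (auto simp: inj_on_def infinite_Ici)
  ultimately have "p - g = 0" using poly_roots_finite finite_subset by blast
  then have "of_nat d = (1 :: rat)" using p(2) lg by simp
  then show ?thesis by simp
qed

lemma mpoly_scale_eq: "mpoly_scale c f = Const c * f"
  by (simp add: mpoly_scale_def Const_def)

lemma mpolys_prod: "(\<And>a. a \<in> A \<Longrightarrow> f a \<in> mpolys V) \<Longrightarrow> prod f A \<in> mpolys V"
  for f :: "'a \<Rightarrow> ('v, 'k::comm_ring_1) mpoly"
  by (induction A rule: infinite_finite_induct) (auto simp: mpolys_one mpolys_mult)

lemma span_mod_mon_eval: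
  fixes l :: "nat \<Rightarrow> ('v, 'k::comm_ring_1) mpoly"
  assumes I: "is_ideal I" and x: "\<And>v. Var v \<in> span_mod I l {..<q}"
  shows "\<exists>F\<in>mpolys {..<q}. homogeneous (mon_degree \<alpha>) F \<and> Poly_Mapping.single \<alpha> 1 - peval Const l F \<in> I"
proof -
  have "\<forall>v. \<exists>a. Var v - (\<Sum>j<q. Const (a j) * l j) \<in> I" using x by (simp add: span_mod_def)
  from choice[OF this] obtain a where a: "\<And>v. Var v - (\<Sum>j<q. Const (a v j) * l j) \<in> I" by blast
  define u where "u v = (\<Sum>j<q. Const (a v j) * Var j :: (nat, 'k) mpoly)" for v
  define F where "F = mon_eval \<alpha> u"
  have pu: "peval Const l (u v) = (\<Sum>j<q. Const (a v j) * l j)" for v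
    by (simp add: u_def peval_sum ring_map_Const peval_mult peval_Const peval_Var)
  have "peval Const l F = mon_eval \<alpha> (\<lambda>v. \<Sum>j<q. Const (a v j) * l j)"
    unfolding F_def ring_map_mon_eval[OF ring_map_peval[OF ring_map_Const]] pu ..
  moreover have "mon_eval \<alpha> Var - mon_eval \<alpha> (\<lambda>v. \<Sum>j<q. Const (a v j) * l j) \<in> I"
    unfolding mon_eval_def by (intro ideal_cong_prod[OF I] ideal_cong_power[OF I] a)
  moreover have "homogeneous 1 (u v)" for v
    unfolding u_def by (intro homogeneous_sum homogeneous_Const_mult homogeneous_Var)
  then have "homogeneous (mon_degree \<alpha>) F" unfolding F_def by (intro homogeneous_mon_eval)
  moreover have "u v \<in> mpolys {..<q}" for v
    unfolding u_def by (intro mpolys_sum mpolys_mult Const_in_mpolys) (simp add: Var_in_mpolys_iff)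
  then have "u v ^ k \<in> mpolys {..<q}" for v k by (induction k) (auto intro: mpolys_one mpolys_mult)
  then have "F \<in> mpolys {..<q}"
    unfolding F_def mon_eval_def by (intro mpolys_prod)
  ultimately show ?thesis by (intro bexI[of _ F]) (simp_all add: mon_eval_Var)
qed

text \<open>If the forms span all coordinates modulo \<open>P\<close>, the coordinate ring is a
  polynomial ring in the \<open>q\<close> independent forms; in degree s their monomials form a
  basis of a complement of the ideal of \<open>X\<close>.\<close>

lemma (in variety) hilbert_function_linear:
  assumes l: "system l" and lin: "\<And>i. i \<le> n \<Longrightarrow> Var i \<in> span_mod P l {..<q}"
    and van: "vanishing_ideal {..n} X = P \<inter> mpolys {..n}"
  shows "hilbert_function {..n} X s = (s + (q - 1)) choose (q - 1)"
proof -
  interpret vs: vector_space "mpoly_scale :: complex poly fract \<Rightarrow> (nat, complex poly fract) mpoly \<Rightarrow> _"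
    by (rule vector_space_mpoly_scale)
  let ?U = "{f :: (nat, complex poly fract) mpoly. f \<in> mpolys {..n} \<and> homogeneous s f}"
  let ?W = "{f \<in> vanishing_ideal {..n} X. homogeneous s f}"
  let ?F = "(\<lambda>\<alpha>. Poly_Mapping.single \<alpha> (1 :: complex poly fract)) ` {\<alpha>. Poly_Mapping.keys \<alpha> \<subseteq> {..n} \<and> mon_degree \<alpha> \<le> s}"
  let ?M = "{\<alpha> :: nat \<Rightarrow>\<^sub>0 nat. Poly_Mapping.keys \<alpha> \<subseteq> {..<q} \<and> mon_degree \<alpha> = s}"
  let ?e = "\<lambda>\<alpha>. mon_eval \<alpha> l"
  have finM: "finite ?M" by (rule finite_subset[OF _ finite_exponents[of "{..<q}" s]]) auto
  have lL: "l j \<in> range (linear_form n)" if "j < q" for j using l that by (simp add: system_def)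
  have l1: "homogeneous 1 (l j)" if "j < q" for j by (rule L_homogeneous[OF lL[OF that]])
  have ln: "l j \<in> mpolys {..n}" if "j < q" for j using lL[OF that] linear_form_in_mpolys by auto
  have U: "vs.subspace ?U"
    by (auto simp: vs.subspace_def mpolys_zero homogeneous_0 mpolys_add homogeneous_add mpoly_scale_eq
        intro!: mpolys_mult Const_in_mpolys homogeneous_Const_mult)
  have U0: "vs.subspace ?W"
    by (auto simp: van vs.subspace_def mpolys_zero homogeneous_0 mpolys_add homogeneous_add mpoly_scale_eq
        is_idealD[OF idealP] intro!: mpolys_mult Const_in_mpolys homogeneous_Const_mult)
  have span: "?U \<subseteq> vs.span ?F"
  proof
    fix f assume f: "f \<in> ?U"
    have "f = (\<Sum>\<alpha>\<in>Poly_Mapping.keys f. mpoly_scale (Poly_Mapping.lookup f \<alpha>) (Poly_Mapping.single \<alpha> 1))"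
      by (subst mpoly_as_sum) (simp add: mpoly_scale_def mult_single)
    moreover have "(\<Sum>\<alpha>\<in>Poly_Mapping.keys f. mpoly_scale (Poly_Mapping.lookup f \<alpha>) (Poly_Mapping.single \<alpha> 1)) \<in> vs.span ?F"
      using f by (intro vs.span_sum vs.span_scale vs.span_base imageI) (auto simp: mpolys_def homogeneous_def)
    ultimately show "f \<in> vs.span ?F" by simp
  qed
  have e: "?e \<alpha> \<in> ?U" if "\<alpha> \<in> ?M" for \<alpha>
  proof -
    have "homogeneous (mon_degree \<alpha>) (?e \<alpha>)" using that l1 by (intro homogeneous_mon_eval) auto
    moreover have "l v ^ k \<in> mpolys {..n}" if "v < q" for v k
      using ln[OF that] by (induction k) (auto intro: mpolys_one mpolys_mult)
    then have "?e \<alpha> \<in> mpolys {..n}" unfolding mon_eval_def using that by (intro mpolys_prod) auto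
    ultimately show ?thesis using that by auto
  qed
  have comb: "(\<Sum>\<alpha>\<in>?M. mpoly_scale (d \<alpha>) (?e \<alpha>)) = peval Const l (\<Sum>\<alpha>\<in>?M. Poly_Mapping.single \<alpha> (d \<alpha>))" for d
    by (simp add: peval_sum[OF ring_map_Const] peval_single[OF ring_map_Const] mpoly_scale_eq)
  have indep: "\<forall>\<alpha>\<in>?M. d \<alpha> = 0" if "(\<Sum>\<alpha>\<in>?M. mpoly_scale (d \<alpha>) (?e \<alpha>)) \<in> ?W" for d
  proof
    fix \<alpha> assume \<alpha>: "\<alpha> \<in> ?M"
    let ?G = "\<Sum>\<alpha>\<in>?M. Poly_Mapping.single \<alpha> (d \<alpha>)"
    have "peval Const l ?G \<in> P" using that unfolding comb van by blast
    moreover have "?G \<in> mpolys {..<q}" by (intro mpolys_sum) (auto simp: mpolys_def)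
    ultimately have "?G = 0" using system_independent[OF l] unfolding independent_mod_def by blast
    moreover have "Poly_Mapping.lookup ?G \<alpha> = (\<Sum>\<beta>\<in>?M. if \<beta> = \<alpha> then d \<beta> else 0)"
      unfolding lookup_sum by (rule sum.cong) (auto simp: lookup_single when_def)
    ultimately show "d \<alpha> = 0" using \<alpha> finM by simp
  qed
  have cover: "\<exists>d. f - (\<Sum>\<alpha>\<in>?M. mpoly_scale (d \<alpha>) (?e \<alpha>)) \<in> ?W" if f: "f \<in> ?U" for f
  proof -
    have "Var v \<in> span_mod P l {..<q}" for v
      using lin[of v] span_mod_zero[OF idealP outside[of v]] by (cases "v \<le> n") auto
    from span_mod_mon_eval[OF idealP this]
    have "\<forall>\<alpha>. \<exists>F. F \<in> mpolys {..<q} \<and> homogeneous (mon_degree \<alpha>) F \<and> Poly_Mapping.single \<alpha> 1 - peval Const l F \<in> P"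
      by blast
    from choice[OF this] obtain F where
      F: "\<And>\<alpha>. F \<alpha> \<in> mpolys {..<q}" "\<And>\<alpha>. homogeneous (mon_degree \<alpha>) (F \<alpha>)"
        "\<And>\<alpha>. Poly_Mapping.single \<alpha> 1 - peval Const l (F \<alpha>) \<in> P" by blast
    define G where "G = (\<Sum>\<alpha>\<in>Poly_Mapping.keys f. Const (Poly_Mapping.lookup f \<alpha>) * F \<alpha>)"
    have Gq: "G \<in> mpolys {..<q}" unfolding G_def by (intro mpolys_sum mpolys_mult Const_in_mpolys F(1))
    have Gs: "homogeneous s G"
      unfolding G_def
    proof (intro homogeneous_sum homogeneous_Const_mult)
      fix \<alpha> assume "\<alpha> \<in> Poly_Mapping.keys f"
      then have "mon_degree \<alpha> = s" using f by (simp add: homogeneous_def)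
      then show "homogeneous s (F \<alpha>)" using F(2)[of \<alpha>] by simp
    qed
    have "f = (\<Sum>\<alpha>\<in>Poly_Mapping.keys f. Const (Poly_Mapping.lookup f \<alpha>) * Poly_Mapping.single \<alpha> 1)"
      by (subst mpoly_as_sum) (simp add: Const_def mult_single)
    then have "f - peval Const l G = (\<Sum>\<alpha>\<in>Poly_Mapping.keys f. Const (Poly_Mapping.lookup f \<alpha>) *
        (Poly_Mapping.single \<alpha> 1 - peval Const l (F \<alpha>)))"
      by (simp add: G_def peval_sum[OF ring_map_Const] peval_mult[OF ring_map_Const] peval_Const[OF ring_map_Const]
          right_diff_distrib sum_subtractf)
    also have "\<dots> \<in> P" by (intro ideal_sum[OF idealP] is_idealD(3)[OF idealP] F(3))
    finally have fP: "f - peval Const l G \<in> P" .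
    have "Poly_Mapping.keys G \<subseteq> ?M" using Gq Gs by (auto simp: mpolys_def homogeneous_def)
    then have "peval Const l G = (\<Sum>\<alpha>\<in>?M. mpoly_scale (Poly_Mapping.lookup G \<alpha>) (?e \<alpha>))"
      using peval_superset[OF ring_map_Const finM, of G l] by (simp add: mpoly_scale_eq)
    moreover have "f - peval Const l G \<in> mpolys {..n}"
      using f ln by (intro mpolys_diff peval_in_mpolys[OF Gq]) (auto simp: Const_in_mpolys)
    moreover have "homogeneous s (peval Const l G)"
      by (rule homogeneous_peval[OF Gs Gq]) (auto simp: homogeneous_Const intro: l1[unfolded One_nat_def])
    then have "homogeneous s (f - peval Const l G)" using f by (intro homogeneous_diff) simp_all
    ultimately show ?thesis using fP unfolding van by (intro exI[of _ "Poly_Mapping.lookup G"]) simp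
  qed
  have U0U: "?W \<subseteq> ?U" unfolding van by blast
  have "vs.dim ?U = vs.dim ?W + card ?M"
    by (rule vs.dim_eq_add_complement[OF U span _ U0 U0U finM e indep cover])
      (auto intro: finite_exponents)
  then show ?thesis by (simp add: hilbert_function_def card_exponents[OF q_pos])
qed

subsection \<open>From the scheme to a prime ideal\<close>

text \<open>The preimage under the retraction: an ideal of k[V] is carried to the ring of all
  variables by adding the variables outside \<open>V\<close>.\<close>

definition full_ideal :: "'v set \<Rightarrow> ('v, 'k::comm_ring_1) mpoly set \<Rightarrow> ('v, 'k) mpoly set" where
  "full_ideal V I = {f. restrict_vars V f \<in> I}"

lemma hom_part_restrict_vars: "hom_part s (restrict_vars V f) = restrict_vars V (hom_part s f)"
  unfolding restrict_vars_def
  by (rule hom_part_peval[OF mpolys_UNIV])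
    (auto simp: homogeneous_Var[unfolded One_nat_def] homogeneous_0 homogeneous_Const ring_map_Const)

lemma full_ideal_Proj:
  fixes \<pp> :: "('v, 'k::field) mpoly set"
  assumes "\<pp> \<in> Proj_points V"
  shows "is_prime (full_ideal V \<pp>)" "hom_ideal (full_ideal V \<pp>)"
proof -
  have p: "primeideal \<pp> (mpoly_ring V)" and h: "\<And>f s. f \<in> \<pp> \<Longrightarrow> hom_part s f \<in> \<pp>"
    using assms by (auto simp: Proj_points_def)
  interpret primeideal \<pp> "mpoly_ring V" by (rule p)
  have [simp]: "carrier (mpoly_ring V :: ('v, 'k) mpoly ring) = mpolys V"
    "mult (mpoly_ring V :: ('v, 'k) mpoly ring) = (*)" "one (mpoly_ring V :: ('v, 'k) mpoly ring) = 1"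
    "zero (mpoly_ring V :: ('v, 'k) mpoly ring) = 0" "add (mpoly_ring V :: ('v, 'k) mpoly ring) = (+)"
    by (simp_all add: mpoly_ring_def)
  note r = ring_mapD[OF ring_map_restrict_vars]
  have add: "f + g \<in> \<pp>" if "f \<in> \<pp>" "g \<in> \<pp>" for f g using additive_subgroup.a_closed[OF additive_subgroup_axioms that] by simp
  have mult: "f * g \<in> \<pp>" if "g \<in> \<pp>" "f \<in> mpolys V" for f g using I_l_closed[of g f] that by simp
  have "0 \<in> \<pp>" using additive_subgroup.zero_closed[OF additive_subgroup_axioms] by simp
  then have i: "is_ideal (full_ideal V \<pp>)"
    by (intro is_idealI) (auto simp: full_ideal_def r add mult restrict_vars_in)
  then show "hom_ideal (full_ideal V \<pp>)"
    using h by (simp add: hom_ideal_def full_ideal_def hom_part_restrict_vars[symmetric])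
  show "is_prime (full_ideal V \<pp>)"
    unfolding is_prime_def
    using i primeideal_mpoly_ringD(1)[OF p] primeideal_mpoly_ringD(2)[OF p restrict_vars_in restrict_vars_in]
    by (simp add: full_ideal_def r)
qed

lemma mpolys_full_ideal: "f \<in> mpolys V \<Longrightarrow> f \<in> full_ideal V I \<longleftrightarrow> f \<in> I"
  by (simp add: full_ideal_def restrict_vars_id)

lemma Var_in_full_ideal: "v \<notin> V \<Longrightarrow> 0 \<in> I \<Longrightarrow> Var v \<in> full_ideal V I"
  by (simp add: full_ideal_def restrict_vars_def peval_Var[OF ring_map_Const])

text \<open>The linear form outside \<open>Q\<close> shows that the irrelevant ideal is not
  contained in the contraction.\<close>

lemma Proj_point_of_prime:
  fixes Q :: "('v, 'k::field) mpoly set"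
  assumes Q: "is_prime Q" "hom_ideal Q" and f: "f \<in> mpolys V" "homogeneous 1 f" "f \<notin> Q"
  shows "Q \<inter> mpolys V \<in> Proj_points V"
proof -
  let ?R = "mpoly_ring V :: ('v, 'k) mpoly ring"
  have [simp]: "carrier ?R = mpolys V" "mult ?R = (*)" "one ?R = 1" "zero ?R = 0" "add ?R = (+)"
    by (simp_all add: mpoly_ring_def)
  note Qi = is_idealD[OF is_primeD(1)[OF Q(1)]]
  interpret cring ?R by (rule cring_mpoly_ring)
  have "ideal (Q \<inter> mpolys V) ?R"
  proof (rule idealI[OF ring_axioms])
    show "subgroup (Q \<inter> mpolys V) (add_monoid ?R)"
    proof (rule group.subgroupI[OF add.group_axioms])
      fix a assume a: "a \<in> Q \<inter> mpolys V"
      then have "- a \<in> mpolys V" "- a + a = 0" by (auto intro: mpolys_minus)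
      then have "\<ominus>\<^bsub>?R\<^esub> a = - a" using a by (intro minus_equality) auto
      then show "inv\<^bsub>add_monoid ?R\<^esub> a \<in> Q \<inter> mpolys V"
        using a Qi(5) mpolys_minus by (auto simp: a_inv_def)
    next
      show "Q \<inter> mpolys V \<noteq> {}" using Qi(1) mpolys_zero by blast
    qed (use Qi(2) mpolys_add in auto)
  qed (use Qi(3,4) mpolys_mult in auto)
  then have "primeideal (Q \<inter> mpolys V) ?R"
    using is_primeD(2,3)[OF Q(1)] mpolys_one by (intro primeidealI cring_mpoly_ring) auto
  moreover have "\<forall>g\<in>Q \<inter> mpolys V. \<forall>s. hom_part s g \<in> Q \<inter> mpolys V"
    using hom_idealD(2)[OF Q(2)] hom_part_in_mpolys by blast
  moreover have "f \<in> irrelevant_ideal V"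
  proof -
    have "0 \<notin> Poly_Mapping.keys f" using f(2) by (auto simp: homogeneous_def mon_degree_def)
    then show ?thesis using f(1) by (simp add: irrelevant_ideal_def in_keys_iff)
  qed
  ultimately show ?thesis using f(3) unfolding Proj_points_def by blast
qed

lemma mpoly_eval_at_0: "mpoly_eval f (\<lambda>_. 0) = Poly_Mapping.lookup f 0" for f :: "('v, 'k::comm_ring_1) mpoly"
proof -
  have "mon_eval \<alpha> (\<lambda>_. 0 :: 'k) = (if \<alpha> = 0 then 1 else 0)" for \<alpha> :: "'v \<Rightarrow>\<^sub>0 nat"
  proof (cases "\<alpha> = 0")
    case False
    then obtain v where v: "v \<in> Poly_Mapping.keys \<alpha>" by (metis ex_in_conv keys_eq_empty)
    then have "(0 :: 'k) ^ Poly_Mapping.lookup \<alpha> v = 0" by (simp add: in_keys_iff power_0_left)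
    then have "mon_eval \<alpha> (\<lambda>_. 0 :: 'k) = 0"
      unfolding mon_eval_def using prod_zero[OF finite_keys, of \<alpha> "\<lambda>v. (0 :: 'k) ^ Poly_Mapping.lookup \<alpha> v"] v by blast
    then show ?thesis using False by simp
  qed (simp add: mon_eval_0)
  then have "mpoly_eval f (\<lambda>_. 0) = (\<Sum>\<alpha>\<in>Poly_Mapping.keys f. if \<alpha> = 0 then Poly_Mapping.lookup f \<alpha> else 0)"
    unfolding mpoly_eval_def by (intro sum.cong) auto
  then show ?thesis by (simp add: sum.delta in_keys_iff)
qed

lemma topspace_Proj: "topspace (Proj V) = Proj_points V"
proof
  have "closedin (Proj V) (topspace (Proj V))" by simp
  then show "topspace (Proj V) \<subseteq> Proj_points V" unfolding closedin_Proj by auto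
  have "closedin (Proj V) (Proj_points V)"
    unfolding closedin_Proj by (rule exI[of _ "{}"]) auto
  then show "Proj_points V \<subseteq> topspace (Proj V)" by (rule closedin_subset)
qed

text \<open>If every variable lay in the ideal, so would every polynomial without constant term,
  hence the irrelevant ideal.\<close>

lemma Proj_points_proper:
  fixes \<pp> :: "('v, 'k::field) mpoly set"
  assumes p: "\<pp> \<in> Proj_points V"
  shows "\<exists>v. Var v \<notin> full_ideal V \<pp>"
proof (rule ccontr)
  assume *: "\<not> ?thesis"
  note I = is_primeD(1)[OF full_ideal_Proj(1)[OF p]]
  obtain f where f: "f \<in> mpolys V" "Poly_Mapping.lookup f 0 = 0" "f \<notin> \<pp>"
    using p by (auto simp: Proj_points_def irrelevant_ideal_def)
  have "peval Const Var f - peval Const (\<lambda>_. Const 0) f \<in> full_ideal V \<pp>"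
    using * by (intro ideal_cong_peval[OF I mpolys_UNIV]) (simp add: Const_simps)
  moreover have "peval Const (\<lambda>_. Const 0) f = (Const (mpoly_eval f (\<lambda>_. 0)) :: ('v, 'k) mpoly)"
    by (simp add: mpoly_eval_eq_peval peval_comp[OF ring_map_Const])
  ultimately have "f \<in> full_ideal V \<pp>" by (simp add: peval_Const_Var mpoly_eval_at_0 f(2) Const_simps)
  then show False using f(1,3) by (simp add: mpolys_full_ideal)
qed

locale irreducible_variety =
  fixes n :: nat and X :: "(nat, complex poly fract) mpoly set set"
  assumes X: "irreducible_projective_variety {..n} X"
begin

definition P :: "(nat, complex poly fract) mpoly set" where
  "P = full_ideal {..n} (vanishing_ideal {..n} X)"

lemma closed_X: "closedin (Proj {..n}) X" and irreducible_X: "irreducible_space (subtopology (Proj {..n}) X)"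
  using X by (auto simp: irreducible_projective_variety_def)

lemma X_points: "X \<subseteq> Proj_points {..n}"
  using closedin_subset[OF closed_X] by (simp add: topspace_Proj)

lemma topspace_X: "topspace (subtopology (Proj {..n}) X) = X"
  using X_points by (auto simp: topspace_Proj)

lemma P_iff: "f \<in> P \<longleftrightarrow> (\<forall>\<pp>\<in>X. f \<in> full_ideal {..n} \<pp>)"
  by (simp add: P_def full_ideal_def vanishing_ideal_def restrict_vars_in)

lemma vanishing_ideal_eq: "vanishing_ideal {..n} X = P \<inter> mpolys {..n}"
proof -
  have "vanishing_ideal {..n} X \<subseteq> mpolys {..n}" by (auto simp: vanishing_ideal_def)
  then show ?thesis unfolding P_def using mpolys_full_ideal[of _ "{..n}" "vanishing_ideal {..n} X"] by blast
qed

lemma X_eq: "X = {\<pp> \<in> Proj_points {..n}. P \<inter> mpolys {..n} \<subseteq> \<pp>}"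
proof
  show "X \<subseteq> {\<pp> \<in> Proj_points {..n}. P \<inter> mpolys {..n} \<subseteq> \<pp>}"
    using X_points by (auto simp: vanishing_ideal_eq[symmetric] vanishing_ideal_def)
  obtain S where S: "S \<subseteq> {f \<in> mpolys {..n}. \<exists>s. homogeneous s f}" "X = {\<pp> \<in> Proj_points {..n}. S \<subseteq> \<pp>}"
    using closed_X unfolding closedin_Proj by blast
  then have "S \<subseteq> vanishing_ideal {..n} X" by (auto simp: vanishing_ideal_def)
  then show "{\<pp> \<in> Proj_points {..n}. P \<inter> mpolys {..n} \<subseteq> \<pp>} \<subseteq> X"
    unfolding vanishing_ideal_eq[symmetric] using S(2) by blast
qed

lemma full_ideal_point:
  assumes "\<pp> \<in> X" shows "is_prime (full_ideal {..n} \<pp>)" "hom_ideal (full_ideal {..n} \<pp>)"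
  using full_ideal_Proj[of \<pp> "{..n}"] assms X_points by auto

lemma hom_ideal_P: "hom_ideal P"
  unfolding hom_ideal_def
proof (intro conjI ballI allI is_idealI)
  note I = is_idealD[OF is_primeD(1)[OF full_ideal_point(1)]]
  show "0 \<in> P" using I(1) by (simp add: P_iff)
  show "a + b \<in> P" if "a \<in> P" "b \<in> P" for a b using that I(2) by (simp add: P_iff)
  show "r * a \<in> P" if "a \<in> P" for a r using that I(3) by (simp add: P_iff)
  show "hom_part s f \<in> P" if "f \<in> P" for f s
    using that hom_idealD(2)[OF full_ideal_point(2)] by (simp add: P_iff)
qed

text \<open>Irreducibility of \<open>X\<close> enters here: two forms with product in
  \<open>P\<close> cover \<open>X\<close> by two closed subsets.\<close>

sublocale variety n P
proof
  have ne: "X \<noteq> {}" using irreducible_X unfolding irreducible_space_def topspace_X by blast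
  then obtain \<pp> where \<pp>: "\<pp> \<in> X" "\<pp> \<in> Proj_points {..n}" using X_points by blast
  show "hom_ideal P" by (rule hom_ideal_P)
  show "is_prime P"
  proof (rule hom_ideal_is_primeI[OF hom_ideal_P])
    show "1 \<notin> P" using \<pp>(1) is_primeD(2)[OF full_ideal_point(1)[OF \<pp>(1)]] unfolding P_iff by blast
    fix f g s r assume f: "homogeneous s f" and g: "homogeneous r g" and fg: "f * g \<in> P"
    let ?C = "\<lambda>f. {\<pp> \<in> X. f \<in> full_ideal {..n} \<pp>}"
    have closed: "closedin (subtopology (Proj {..n}) X) (?C f)" if "homogeneous s f" for f s
    proof -
      have "closedin (Proj {..n}) {\<pp> \<in> Proj_points {..n}. {restrict_vars {..n} f} \<subseteq> \<pp>}"
        unfolding closedin_Proj using restrict_vars_in homogeneous_restrict_vars[OF that]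
        by (intro exI[of _ "{restrict_vars {..n} f}"]) auto
      moreover have "?C f = {\<pp> \<in> Proj_points {..n}. {restrict_vars {..n} f} \<subseteq> \<pp>} \<inter> X"
        using X_points by (auto simp: full_ideal_def)
      ultimately show ?thesis unfolding closedin_subtopology by blast
    qed
    have "\<pp> \<in> ?C f \<union> ?C g" if "\<pp> \<in> X" for \<pp>
      using fg is_primeD(3)[OF full_ideal_point(1)[OF that], of f g] that by (simp add: P_iff)
    then have "?C f \<union> ?C g = X" by blast
    then have "?C f = X \<or> ?C g = X"
      using irreducible_X closed[OF f] closed[OF g] unfolding irreducible_space_def topspace_X by blast
    then show "f \<in> P \<or> g \<in> P" by (auto simp: P_iff)
  qed
  show "Var v \<in> P" if "v > n" for v
    using that Var_in_full_ideal[of v "{..n}" "vanishing_ideal {..n} X"] is_idealD(1)[OF hom_idealD(1)[OF hom_ideal_P]]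
    by (simp add: P_def full_ideal_def restrict_vars_id mpolys_zero)
  show "\<exists>v. Var v \<notin> P" using Proj_points_proper[OF \<pp>(2)] \<pp>(1) unfolding P_iff by blast
qed

text \<open>The zero sets of the primes from \<open>chain_of_primes\<close> are irreducible closed
  subsets of \<open>X\<close>. Larger primes have smaller zero sets, so the indexing of the primes
  already gives an ascending chain of sets.\<close>

lemma q_le_krull_dim: "ereal (real (q - 1)) \<le> krull_dim (subtopology (Proj {..n}) X)"
proof -
  let ?V = "{..n}"
  obtain l where l: "system l" using system_exists ..
  have q: "Suc (q - 1) = q" using q_pos by simp
  have lL: "l i \<in> range (linear_form n)" if "i \<le> q - 1" for i
    using l that q_pos by (simp add: system_def)
  have ind: "independent_mod P l {..<Suc (q - 1)}" and cut: "cuts P l {..<Suc (q - 1)}"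
    using l system_independent[OF l] unfolding q by (simp_all add: system_def)
  have "\<exists>R. R (q - 1) = P \<and> (\<forall>i\<le>q - 1. is_prime (R i) \<and> hom_ideal (R i) \<and> l 0 \<notin> R i \<and> P \<subseteq> R i) \<and>
      (\<forall>i<q - 1. R (Suc i) \<subseteq> R i \<and> (\<exists>f\<in>range (linear_form n). f \<in> R i \<and> f \<notin> R (Suc i)))"
    by (rule chain_of_primes[OF prime hom finite_vars_P _ ind cut]) (rule lL)
  then obtain R where
    R1: "\<forall>i\<le>q - 1. is_prime (R i) \<and> hom_ideal (R i) \<and> l 0 \<notin> R i \<and> P \<subseteq> R i" and
    R2: "\<forall>i<q - 1. R (Suc i) \<subseteq> R i \<and> (\<exists>f\<in>range (linear_form n). f \<in> R i \<and> f \<notin> R (Suc i))"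
    by (elim exE conjE)
  note R = R1[rule_format] R2[rule_format]
  have l0: "l 0 \<in> mpolys ?V" "homogeneous 1 (l 0)"
    using lL[of 0] linear_form_in_mpolys homogeneous_linear_form by auto
  have pt: "R i \<inter> mpolys ?V \<in> Proj_points ?V" if "i \<le> q - 1" for i
    using R(1)[OF that] l0 by (intro Proj_point_of_prime[of _ "l 0"]) auto
  define Z where "Z i = {\<pp> \<in> Proj_points ?V. R i \<inter> mpolys ?V \<subseteq> \<pp>}" for i
  have ZX: "Z i \<subseteq> X" if "i \<le> q - 1" for i
  proof -
    have "Z i \<subseteq> {\<pp> \<in> Proj_points ?V. P \<inter> mpolys ?V \<subseteq> \<pp>}" unfolding Z_def using R(1)[OF that] by blast
    also have "\<dots> \<subseteq> X" by (rule equalityD2[OF X_eq])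
    finally show ?thesis .
  qed
  have in_Z: "R i \<inter> mpolys ?V \<in> Z i" if "i \<le> q - 1" for i using pt[OF that] by (simp add: Z_def)
  have closed: "closedin (Proj ?V) (Z i)" if i: "i \<le> q - 1" for i
  proof -
    \<comment> \<open>Closed sets are given by homogeneous polynomials only. As \<open>R i\<close>
      and the points of Proj are homogeneous ideals, this changes nothing.\<close>
    let ?S = "{f \<in> R i \<inter> mpolys ?V. \<exists>s. homogeneous s f}"
    have "R i \<inter> mpolys ?V \<subseteq> \<pp>" if p: "\<pp> \<in> Proj_points ?V" "?S \<subseteq> \<pp>" for \<pp>
    proof
      fix f assume f: "f \<in> R i \<inter> mpolys ?V"
      have "hom_part s f \<in> full_ideal ?V \<pp>" for s
      proof -
        have "hom_part s f \<in> R i" using f R(1)[OF i] by (intro hom_idealD(2)) auto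
        moreover have m: "hom_part s f \<in> mpolys ?V" using f by (intro hom_part_in_mpolys) auto
        moreover have "\<exists>r. homogeneous r (hom_part s f)" using homogeneous_hom_part by (rule exI)
        ultimately have "hom_part s f \<in> ?S" by simp
        then have "hom_part s f \<in> \<pp>" using p(2) by (rule subsetD[rotated])
        then show ?thesis using m by (simp add: mpolys_full_ideal)
      qed
      then have "f \<in> full_ideal ?V \<pp>" using hom_ideal_mem_iff[OF full_ideal_Proj(2)[OF p(1)], of f] by blast
      then show "f \<in> \<pp>" using f by (simp add: mpolys_full_ideal)
    qed
    then have "Z i = {\<pp> \<in> Proj_points ?V. ?S \<subseteq> \<pp>}" unfolding Z_def by blast
    then show ?thesis unfolding closedin_Proj by (intro exI[of _ ?S]) blast
  qed
  have irr: "irreducible_space (subtopology (Proj ?V) (Z i))" if i: "i \<le> q - 1" for i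
  proof -
    have top: "topspace (subtopology (Proj ?V) (Z i)) = Z i" by (auto simp: topspace_Proj Z_def)
    \<comment> \<open>The contraction of \<open>R i\<close> is the generic point of
      \<open>Z i\<close>.\<close>
    have whole: "C = Z i" if C: "closedin (subtopology (Proj ?V) (Z i)) C" "R i \<inter> mpolys ?V \<in> C" for C
    proof -
      obtain S where S: "C = {\<pp> \<in> Proj_points ?V. S \<subseteq> \<pp>} \<inter> Z i"
        using C(1) unfolding closedin_subtopology closedin_Proj by blast
      then have "S \<subseteq> R i \<inter> mpolys ?V" using C(2) by blast
      then show ?thesis unfolding S Z_def by blast
    qed
    show ?thesis
      unfolding irreducible_space_def top using in_Z[OF i] whole by blast
  qed
  have strict: "Z i \<subset> Z (Suc i)" if i: "i < q - 1" for i
  proof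
    show "Z i \<subseteq> Z (Suc i)" using R(2)[OF i] by (auto simp: Z_def)
    obtain f where f: "f \<in> range (linear_form n)" "f \<in> R i" "f \<notin> R (Suc i)" using R(2)[OF i] by blast
    then have "f \<in> mpolys ?V" using linear_form_in_mpolys by auto
    then have "R (Suc i) \<inter> mpolys ?V \<notin> Z i" using f by (auto simp: Z_def)
    then show "Z i \<noteq> Z (Suc i)" using in_Z[of "Suc i"] i by auto
  qed
  have "closedin (subtopology (Proj ?V) X) (Z i) \<and> irreducible_space (subtopology (subtopology (Proj ?V) X) (Z i))"
    if "i \<le> q - 1" for i
  proof
    have XZ: "X \<inter> Z i = Z i" using ZX[OF that] by blast
    show "closedin (subtopology (Proj ?V) X) (Z i)"
      unfolding closedin_subtopology using closed[OF that] XZ by (intro exI[of _ "Z i"]) blast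
    show "irreducible_space (subtopology (subtopology (Proj ?V) X) (Z i))"
      using irr[OF that] by (simp only: subtopology_subtopology XZ)
  qed
  then show ?thesis
    unfolding krull_dim_def using strict
    by (intro Sup_upper CollectI exI[of _ "q - 1"] exI[of _ Z]) auto
qed

text \<open>This is where d >= 2 enters: if the forms spanned every coordinate, \<open>X\<close>
  would be a linear space, of degree 1.\<close>

lemma nonlinear:
  assumes d: "has_degree {..n} X d" "d \<ge> 2" and l: "system l"
  shows "\<exists>i\<le>n. Var i \<notin> span_mod P l {..<q}"
proof (rule ccontr)
  assume "\<not> ?thesis"
  then have "Var i \<in> span_mod P l {..<q}" if "i \<le> n" for i using that by blast
  then have "hilbert_function {..n} X s = (s + (q - 1)) choose (q - 1)" for s
    by (intro hilbert_function_linear[OF l _ vanishing_ideal_eq])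
  from degree_one_of_hilbert_function[OF d(1) this] show False using d(2) by simp
qed

lemma rational_point_zero:
  assumes "p \<in> rational_points {..n} X" "x \<in> p" "f \<in> P" "homogeneous s f"
  shows "mpoly_eval f x = 0"
proof -
  have p: "p \<in> proj_space {..n}" "point_ideal {..n} p \<in> X" using assms(1) by (auto simp: rational_points_def)
  have "f \<in> full_ideal {..n} (point_ideal {..n} p)" using assms(3) p(2) by (simp add: P_iff)
  then have "mpoly_eval (hom_part s (restrict_vars {..n} f)) x = 0"
    using assms(2) by (auto simp: full_ideal_def point_ideal_def)
  then have "mpoly_eval (restrict_vars {..n} f) x = 0"
    by (simp add: hom_part_homogeneous[OF homogeneous_restrict_vars[OF assms(4)]])
  then show ?thesis
    using proj_space_outside[OF p(1) assms(2)] by (subst (asm) mpoly_eval_restrict_vars) auto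
qed

end

context variety
begin

text \<open>For nonzero s, x / s would be a point over the forbidden line. So s = 0, all forms
  vanish at x, and \<open>cuts\<close> forces x = 0. The vector x need not come from a coprime
  tuple, since points of the cone over the closure of X(b) have to be covered.\<close>

lemma no_common_point:
  assumes l: "system l" and AB: "A 0 \<noteq> 0 \<or> B 0 \<noteq> 0"
    and empty: "\<not> (\<exists>E. ring_map E \<and> (\<forall>c. E (Const c) = c) \<and> (\<forall>f\<in>P. E f = 0) \<and> (\<forall>j<q. E (l j) = to_fract [:A j, B j:]))"
    and x: "\<And>f s. f \<in> P \<Longrightarrow> homogeneous s f \<Longrightarrow> mpoly_eval f x = 0"
    and lx: "\<And>j. j < q \<Longrightarrow> mpoly_eval (l j) x = s * to_fract [:A j, B j:]"
  shows "x v = 0"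
proof -
  have kill: "mpoly_eval f (\<lambda>v. c * x v) = 0" if f: "f \<in> P" for f c
  proof -
    obtain N where N: "f = (\<Sum>s\<le>N. hom_part s f)" by (rule sum_hom_part)
    have "mpoly_eval (hom_part s f) (\<lambda>v. c * x v) = 0" for s
      using x[OF hom_idealD(2)[OF hom f] homogeneous_hom_part]
      by (simp add: mpoly_eval_homogeneous_scale[OF homogeneous_hom_part])
    then show ?thesis by (subst N) (simp add: mpoly_eval_sum)
  qed
  have s: "s = 0"
  proof (rule ccontr)
    assume "s \<noteq> 0"
    let ?E = "\<lambda>f. mpoly_eval f (\<lambda>v. inverse s * x v)"
    have "?E (l j) = to_fract [:A j, B j:]" if "j < q" for j
    proof -
      have "homogeneous 1 (l j)" using l that by (intro L_homogeneous) (simp add: system_def)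
      from mpoly_eval_homogeneous_scale[OF this, of "inverse s" x] lx[OF that] \<open>s \<noteq> 0\<close>
      show ?thesis by simp
    qed
    then have "\<exists>E. ring_map E \<and> (\<forall>c. E (Const c) = c) \<and> (\<forall>f\<in>P. E f = 0) \<and> (\<forall>j<q. E (l j) = to_fract [:A j, B j:])"
      using kill[of _ "inverse s"] by (intro exI[of _ ?E]) (simp add: ring_map_mpoly_eval mpoly_eval_Const)
    then show False using empty by contradiction
  qed
  obtain M where "Var v ^ M \<in> gen_ideal P l {..<q}" using l by (auto simp: system_def cuts_def)
  then obtain h where h: "Var v ^ M - (\<Sum>j<q. h j * l j) \<in> P" by (auto simp: gen_ideal_def)
  have "mpoly_eval (Var v ^ M - (\<Sum>j<q. h j * l j)) x = 0" using kill[OF h, of 1] by simp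
  then have "x v ^ M = (\<Sum>j<q. mpoly_eval (h j) x * mpoly_eval (l j) x)"
    by (simp add: ring_map_diff[OF ring_map_mpoly_eval] ring_map_power[OF ring_map_mpoly_eval] mpoly_eval_Var
        mpoly_eval_sum mpoly_eval_mult)
  also have "\<dots> = 0" by (simp add: lx s)
  finally show ?thesis by simp
qed

end

subsection \<open>Points of bounded height\<close>

text \<open>Write the factor between two representatives in lowest terms a / b. Then a divides all
  \<open>y i\<close> and b divides all \<open>x i\<close>, so both are constants; hence
  \<open>height\<close> is well defined.\<close>

lemma coprime_rep_scale:
  assumes x: "coprime_rep n p x" and y: "coprime_rep n p y"
  shows "degree (y i) = degree (x i)"
proof -
  have eq: "proj_point (\<lambda>i. to_fract (x i)) = proj_point (\<lambda>i. to_fract (y i))"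
    using x y by (simp add: coprime_rep_def)
  have "(\<lambda>i. 1 * to_fract (y i)) \<in> proj_point (\<lambda>i. to_fract (y i))"
    unfolding proj_point_def by (intro CollectI exI[of _ 1]) simp
  then obtain c where c: "c \<noteq> 0" "\<And>i. to_fract (y i) = c * to_fract (x i)"
    unfolding eq[symmetric] proj_point_def by (auto simp: fun_eq_iff)
  define a b where "a = fst (quot_of_fract c)" and "b = snd (quot_of_fract c)"
  have b: "b \<noteq> 0" and cop: "coprime a b"
    by (simp_all add: a_def b_def snd_quot_of_fract_nonzero coprime_quot_of_fract)
  have cab: "c = to_fract a / to_fract b"
    using quot_to_fract_quot_of_fract[of c]
    by (simp add: a_def b_def quot_to_fract_def case_prod_unfold to_fract_def)
  have a: "a \<noteq> 0" using c(1) cab by auto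
  have rel: "b * y i = a * x i" for i
  proof -
    have "to_fract b * to_fract (y i) = to_fract a * to_fract (x i)"
      using c(2)[of i] b by (simp add: cab field_simps)
    then have "to_fract (b * y i) = to_fract (a * x i)" by simp
    then show ?thesis by (simp only: to_fract_eq_iff)
  qed
  have "a dvd y i" for i
  proof -
    have "a dvd b * y i" unfolding rel by simp
    then show ?thesis using cop by (simp add: coprime_dvd_mult_right_iff)
  qed
  then have ua: "is_unit a" using y by (simp add: coprime_rep_def)
  have "b dvd x i" for i
  proof -
    have "b dvd a * x i" unfolding rel[symmetric] by simp
    then show ?thesis using cop by (simp add: coprime_dvd_mult_right_iff coprime_commute)
  qed
  then have ub: "is_unit b" using x by (simp add: coprime_rep_def)
  have da: "degree a = 0" "degree b = 0" using ua ub is_unit_iff_degree[OF a] is_unit_iff_degree[OF b] by auto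
  have "x i = 0 \<longleftrightarrow> y i = 0" using rel[of i] a b by auto
  moreover have "degree (y i) = degree (x i)" if "x i \<noteq> 0" "y i \<noteq> 0"
    using arg_cong[OF rel[of i], of degree] that a b da by (simp add: degree_mult_eq)
  ultimately show ?thesis by (cases "x i = 0") auto
qed

lemma degree_le_height:
  assumes "coprime_rep n p x" "i \<le> n"
  shows "degree (x i) \<le> height n p"
proof -
  have "height n p = Max ((\<lambda>i. degree (x i)) ` {..n})"
    unfolding height_def
  proof (rule the_equality)
    show "\<exists>y. coprime_rep n p y \<and> Max ((\<lambda>i. degree (x i)) ` {..n}) = Max ((\<lambda>i. degree (y i)) ` {..n})"
      using assms(1) by blast
    fix h assume "\<exists>y. coprime_rep n p y \<and> h = Max ((\<lambda>i. degree (y i)) ` {..n})"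
    then show "h = Max ((\<lambda>i. degree (x i)) ` {..n})"
      using coprime_rep_scale[OF assms(1)] by auto
  qed
  then show ?thesis using assms(2) by simp
qed

lemma coprime_rep_nonzero: "coprime_rep n p x \<Longrightarrow> \<exists>i\<le>n. x i \<noteq> 0"
proof (rule ccontr)
  assume x: "coprime_rep n p x" and "\<not> (\<exists>i\<le>n. x i \<noteq> 0)"
  then have "\<forall>i\<le>n. 0 dvd x i" by simp
  then have "is_unit (0 :: complex poly)" using x unfolding coprime_rep_def by blast
  then show False by simp
qed

text \<open>The inverse of \<open>coeff_vector\<close>. The ring is arbitrary so that
  \<open>tuple n b Var\<close> is the generic tuple, whose coefficients are the coordinates of the
  ambient projective space.\<close>

definition tuple :: "nat \<Rightarrow> nat \<Rightarrow> (nat \<times> nat \<Rightarrow> 'a::comm_ring_1) \<Rightarrow> nat \<Rightarrow> 'a poly" where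
  "tuple n b z i = (if i \<le> n then \<Sum>j<b. Polynomial.monom (z (i, j)) j else 0)"

lemma coeff_tuple: "coeff (tuple n b z i) k = (if i \<le> n \<and> k < b then z (i, k) else 0)"
  by (simp add: tuple_def coeff_sum)

lemma map_poly_tuple: "ring_map h \<Longrightarrow> map_poly h (tuple n b z i) = tuple n b (\<lambda>v. h (z v)) i"
  by (simp add: poly_eq_iff coeff_map_poly_ring coeff_tuple ring_mapD)

lemma tuple_coeff_vector:
  assumes x: "coprime_rep n p x" "height n p < b"
  shows "tuple n b (\<lambda>v. c * coeff_vector n b x v) i = smult c (x i)"
proof (rule poly_eqI)
  fix k show "coeff (tuple n b (\<lambda>v. c * coeff_vector n b x v) i) k = coeff (smult c (x i)) k"
  proof (cases "i \<le> n")
    case True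
    then have "k \<ge> b \<Longrightarrow> coeff (x i) k = 0"
      using degree_le_height[OF x(1) True] x(2) by (intro coeff_eq_0) simp
    then show ?thesis using True by (simp add: coeff_tuple coeff_vector_def)
  next
    case False
    then show ?thesis using x(1) by (simp add: coeff_tuple coprime_rep_def)
  qed
qed

text \<open>An equation of \<open>X\<close> at the generic tuple as a polynomial in t; its
  coefficients are the equations of X(b).\<close>

definition expand :: "nat \<Rightarrow> nat \<Rightarrow> (nat, complex poly) mpoly \<Rightarrow> (nat \<times> nat, complex) mpoly poly" where
  "expand n b = peval (map_poly Const) (tuple n b Var)"

lemma map_poly_expand: "map_poly (\<lambda>G. mpoly_eval G z) (expand n b F) = mpoly_eval F (tuple n b z)"
proof -
  note r = ring_map_mpoly_eval[of z]
  have "map_poly (\<lambda>G. mpoly_eval G z) (map_poly Const p) = p" for p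
    unfolding map_poly_comp[OF r ring_map_Const] by (simp add: mpoly_eval_Const)
  moreover have "map_poly (\<lambda>G. mpoly_eval G z) (tuple n b Var i) = tuple n b z i" for i
    unfolding map_poly_tuple[OF r] by (simp add: mpoly_eval_Var)
  moreover have "map_poly (\<lambda>G. mpoly_eval G z) (expand n b F) = peval (\<lambda>p. map_poly (\<lambda>G. mpoly_eval G z) (map_poly Const p))
      (\<lambda>i. map_poly (\<lambda>G. mpoly_eval G z) (tuple n b Var i)) F"
    unfolding expand_def by (rule peval_comp[OF ring_map_map_poly[OF r]])
  ultimately show ?thesis by (simp only: mpoly_eval_eq_peval[of F])
qed

lemma to_fract_mpoly_eval:
  "to_fract (mpoly_eval F x) = mpoly_eval (peval (\<lambda>p. Const (to_fract p)) Var F) (\<lambda>i. to_fract (x i))"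
  for F :: "(nat, complex poly) mpoly"
  by (simp add: peval_comp[OF ring_map_mpoly_eval] mpoly_eval_Const mpoly_eval_Var)
    (simp add: mpoly_eval_eq_peval peval_comp[OF ring_map_to_fract])

definition tuple_form :: "nat \<Rightarrow> (nat \<Rightarrow> complex) \<Rightarrow> (nat \<Rightarrow> complex poly) \<Rightarrow> complex poly" where
  "tuple_form n c x = (\<Sum>i\<le>n. smult (c i) (x i))"

lemma to_fract_tuple_form:
  "to_fract (tuple_form n c x) = mpoly_eval (linear_form n c) (\<lambda>i. to_fract (x i))"
proof -
  have "to_fract (smult a p) = of_complex a * to_fract p" for a p
    unfolding of_complex_def by (simp only: to_fract_mult[symmetric]) simp
  then show ?thesis
    by (simp add: tuple_form_def linear_form_def ring_map_sum[OF ring_map_to_fract] mpoly_eval_sum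
        mpoly_eval_mult mpoly_eval_Const mpoly_eval_Var)
qed

definition coeff_form :: "nat \<Rightarrow> nat \<Rightarrow> (nat \<Rightarrow> complex) \<Rightarrow> nat \<Rightarrow> (nat \<times> nat, complex) mpoly" where
  "coeff_form n b c k = (\<Sum>i\<le>n. Const (c i) * coeff (tuple n b Var i) k)"

lemma homogeneous_coeff_form: "homogeneous 1 (coeff_form n b c k)"
  unfolding coeff_form_def
  by (intro homogeneous_sum homogeneous_Const_mult)
    (simp add: coeff_tuple homogeneous_0 homogeneous_Var[unfolded One_nat_def])

lemma mpoly_eval_coeff_form: "mpoly_eval (coeff_form n b c k) z = coeff (tuple_form n c (tuple n b z)) k"
proof -
  have "mpoly_eval (coeff (tuple n b Var i) k) z = coeff (tuple n b z i) k" for i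
    by (simp add: coeff_tuple mpoly_eval_Var mpoly_eval_0)
  then show ?thesis
    by (simp add: coeff_form_def tuple_form_def mpoly_eval_sum mpoly_eval_mult mpoly_eval_Const coeff_sum)
qed

lemma coeff_tuple_form_eq_0: "k \<ge> b \<Longrightarrow> coeff (tuple_form n c (tuple n b z)) k = 0"
  by (simp add: tuple_form_def coeff_sum coeff_tuple)

text \<open>The conditions forcing \<open>(u\<^sub>0, \<dots>, u\<^sub>q\<^sub>-\<^sub>1)\<close> to be proportional to
  \<open>A + B t\<close>: one relation of degree \<open>1\<close> in \<open>t\<close> between \<open>u\<^sub>0\<close> and \<open>u\<^sub>1\<close>,
  and constant relations expressing the other \<open>u\<^sub>j\<close> through these two.\<close>

definition line_condition ::
    "nat \<Rightarrow> nat \<Rightarrow> (nat \<Rightarrow> nat \<Rightarrow> complex) \<Rightarrow> (nat \<Rightarrow> complex) \<Rightarrow> (nat \<Rightarrow> complex) \<Rightarrow> nat \<times> nat \<Rightarrow> (nat \<times> nat, complex) mpoly" where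
  "line_condition n b c A B = (\<lambda>(j, k). if j = 0
    then Const (A 1) * coeff_form n b (c 0) k - Const (A 0) * coeff_form n b (c 1) k +
      (if k = 0 then 0 else Const (B 1) * coeff_form n b (c 0) (k - 1) - Const (B 0) * coeff_form n b (c 1) (k - 1))
    else Const (A 0 * B 1 - A 1 * B 0) * coeff_form n b (c j) k
      - Const (A j * B 1 - B j * A 1) * coeff_form n b (c 0) k
      - Const (A 0 * B j - B 0 * A j) * coeff_form n b (c 1) k)"

lemma homogeneous_line_condition: "homogeneous 1 (line_condition n b c A B a)"
proof (cases a)
  case (Pair j k)
  show ?thesis
    unfolding line_condition_def Pair prod.case
    by (simp only: split: if_split)
      (intro conjI impI homogeneous_add homogeneous_diff homogeneous_Const_mult homogeneous_coeff_form homogeneous_0)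
qed

text \<open>In the first relation both sides have degree at most b, whence the indices 0, ..., b;
  the others have degree below b. All remaining coefficients vanish automatically.\<close>

lemma line_condition_zero:
  fixes n b :: nat and c :: "nat \<Rightarrow> nat \<Rightarrow> complex" and z :: "nat \<times> nat \<Rightarrow> complex"
  defines "u \<equiv> \<lambda>j. tuple_form n (c j) (tuple n b z)"
  assumes zero: "\<And>a. a \<in> {2..<q} \<times> {..<b} \<union> {0} \<times> {..b} \<Longrightarrow> mpoly_eval (line_condition n b c A B a) z = 0"
  shows "[:A 1, B 1:] * u 0 = [:A 0, B 0:] * u 1"
    and "\<And>j. 2 \<le> j \<Longrightarrow> j < q \<Longrightarrow> smult (A 0 * B 1 - A 1 * B 0) (u j) =
      smult (A j * B 1 - B j * A 1) (u 0) + smult (A 0 * B j - B 0 * A j) (u 1)"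
proof -
  note e = ring_map_diff[OF ring_map_mpoly_eval] mpoly_eval_add mpoly_eval_mult mpoly_eval_Const mpoly_eval_0
    mpoly_eval_coeff_form
  show "[:A 1, B 1:] * u 0 = [:A 0, B 0:] * u 1"
  proof (rule poly_eqI)
    fix k
    show "coeff ([:A 1, B 1:] * u 0) k = coeff ([:A 0, B 0:] * u 1) k"
    proof (cases "k \<le> b")
      case True
      have "mpoly_eval (line_condition n b c A B (0, k)) z = 0" using True by (intro zero) simp
      then show ?thesis
        by (cases k) (simp_all add: line_condition_def e u_def coeff_pCons algebra_simps)
    next
      case False
      then show ?thesis
        by (cases k) (simp_all add: u_def coeff_pCons coeff_tuple_form_eq_0)
    qed
  qed
  fix j assume j: "2 \<le> j" "j < q"
  show "smult (A 0 * B 1 - A 1 * B 0) (u j) =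
      smult (A j * B 1 - B j * A 1) (u 0) + smult (A 0 * B j - B 0 * A j) (u 1)"
  proof (rule poly_eqI)
    fix k
    show "coeff (smult (A 0 * B 1 - A 1 * B 0) (u j)) k =
      coeff (smult (A j * B 1 - B j * A 1) (u 0) + smult (A 0 * B j - B 0 * A j) (u 1)) k"
    proof (cases "k < b")
      case True
      then have "mpoly_eval (line_condition n b c A B (j, k)) z = 0" using j by (intro zero) simp
      then show ?thesis using j
        by (simp add: line_condition_def e u_def algebra_simps)
    qed (simp add: u_def coeff_tuple_form_eq_0)
  qed
qed

section \<open>The dimension bound for points of bounded height\<close>

theorem theorem1:
  fixes n m d b :: nat
    and X :: "(nat, complex poly fract) mpoly set set"
  assumes "irreducible_projective_variety {..n} X"
    and "krull_dim (subtopology (Proj {..n}) X) = ereal (real m)"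
    and "has_degree {..n} X d"
    and "d \<ge> 2"
    and "b \<ge> 1"
  shows "krull_dim (subtopology (zariski ({..n} \<times> {..<b})) (bounded_points n X b))
    \<le> ereal (real (m * b))"
proof -
  interpret irreducible_variety n X by unfold_locales (rule assms(1))
  let ?B = "bounded_points n X b" and ?W = "{..n} \<times> {..<b}"
  have "ereal (real (q - 1)) \<le> ereal (real m)" using q_le_krull_dim assms(2) by simp
  then have qm: "q - 1 \<le> m" by simp
  obtain l0 where l0: "system l0" using system_exists ..
  obtain i0 where i0: "i0 \<le> n" "Var i0 \<notin> span_mod P l0 {..<q}"
    using nonlinear[OF assms(3,4) l0] by blast
  obtain l e where l: "system l" and i: "Var i0 \<notin> span_mod P l {..<q}" and rel: "relation l (Var i0) e"
    using integral_system[OF l0 i0] by blast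
  obtain A B where AB: "A 0 \<noteq> 0 \<or> B 0 \<noteq> 0" "1 < q \<longrightarrow> A 0 * B 1 \<noteq> A 1 * B 0"
    and empty: "\<not> (\<exists>E. ring_map E \<and> (\<forall>c. E (Const c) = c) \<and> (\<forall>f\<in>P. E f = 0) \<and> (\<forall>j<q. E (l j) = to_fract [:A j, B j:]))"
    using line_without_points[OF l i0(1) i rel] by (elim exE conjE)
  have "\<forall>j. \<exists>c. j < q \<longrightarrow> l j = linear_form n c" using l by (auto simp: system_def)
  from choice[OF this] obtain c where c: "\<And>j. j < q \<Longrightarrow> l j = linear_form n (c j)" by blast
  have BE: "\<exists>p x. p \<in> rational_points {..n} X \<and> height n p < b \<and> coprime_rep n p x \<and> pt = proj_point (coeff_vector n b x)"
    if "pt \<in> ?B" for pt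
    using that unfolding bounded_points_def by blast
  have BW: "?B \<subseteq> proj_space ?W"
  proof
    fix pt assume "pt \<in> ?B"
    then obtain p x where x: "height n p < b" "coprime_rep n p x" "pt = proj_point (coeff_vector n b x)"
      using BE by blast
    obtain i where i: "i \<le> n" "x i \<noteq> 0" using coprime_rep_nonzero[OF x(2)] by blast
    have "coeff_vector n b x (i, degree (x i)) \<noteq> 0"
      using i degree_le_height[OF x(2) i(1)] x(1) by (simp add: coeff_vector_def)
    moreover have "\<forall>v. v \<notin> ?W \<longrightarrow> coeff_vector n b x v = 0" by (auto simp: coeff_vector_def)
    ultimately show "pt \<in> proj_space ?W" unfolding proj_space_def x(3) by blast
  qed
  \<comment> \<open>The equations of \<open>X\<close> expanded in t belong to the ideal of X(b), so
    they still hold at the points of the cone over its closure.\<close>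
  have expand_vanishing: "coeff (expand n b F) k \<in> vanishing ?B"
    if F: "peval (\<lambda>p. Const (to_fract p)) Var F \<in> P" "homogeneous s (peval (\<lambda>p. Const (to_fract p)) Var F :: (nat, complex poly fract) mpoly)" for F k s
    unfolding vanishing_def
  proof (intro CollectI ballI)
    fix pt z assume pt: "pt \<in> ?B" and z: "z \<in> pt"
    obtain p x where x: "p \<in> rational_points {..n} X" "height n p < b" "coprime_rep n p x"
      "pt = proj_point (coeff_vector n b x)" using BE[OF pt] by blast
    obtain a where a: "a \<noteq> 0" "z = (\<lambda>v. a * coeff_vector n b x v)"
      using z unfolding x(4) proj_point_def by blast
    have tz: "tuple n b z = (\<lambda>i. smult a (x i))"
      unfolding a(2) using tuple_coeff_vector[OF x(3,2)] by blast
    have "(\<lambda>i. to_fract (tuple n b z i)) = (\<lambda>i. of_complex a * to_fract (x i))"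
      unfolding tz of_complex_def by (intro ext) (simp only: to_fract_mult[symmetric], simp)
    moreover have "of_complex a \<noteq> 0"
      using a(1) of_complex_eq_iff[of a 0] ring_mapD(1)[OF ring_map_of_complex] by simp
    then have "(\<lambda>i. of_complex a * to_fract (x i)) \<in> p"
      using x(3) unfolding coprime_rep_def proj_point_def by blast
    ultimately have "to_fract (mpoly_eval F (tuple n b z)) = 0"
      unfolding to_fract_mpoly_eval using rational_point_zero[OF x(1) _ F] by simp
    then have "mpoly_eval F (tuple n b z) = 0" by (simp only: to_fract_eq_0_iff)
    then have "coeff (map_poly (\<lambda>G. mpoly_eval G z) (expand n b F)) k = 0" by (simp add: map_poly_expand)
    then show "mpoly_eval (coeff (expand n b F) k) z = 0" by (simp add: coeff_map_poly_ring[OF ring_map_mpoly_eval])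
  qed
  \<comment> \<open>For q = 1 the single form is proportional over C(t) to the nonzero A 0 + B 0 t
    in any case, so nothing is imposed. For q >= 2 there are (q - 2) b + (b + 1) = (q - 1) b + 1
    conditions.\<close>
  define A' where "A' = (if q = 1 then {} else {2..<q} \<times> {..<b} \<union> {0 :: nat} \<times> {..b})"
  have cardA: "finite A'" "card A' \<le> Suc (m * b)"
  proof -
    show "finite A'" by (simp add: A'_def)
    show "card A' \<le> Suc (m * b)"
    proof (cases "q = 1")
      case False
      then have q2: "q \<ge> 2" using q_pos by simp
      have "A' = {2..<q} \<times> {..<b} \<union> {0} \<times> {..b}" using False by (simp add: A'_def)
      then have "card A' \<le> card ({2..<q} \<times> {..<b}) + card ({0 :: nat} \<times> {..b})"
        by (simp only: card_Un_le)
      also have "\<dots> = Suc ((q - 2) * b + b)" by (simp add: card_cartesian_product)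
      also have "(q - 2) * b + b = Suc (q - 2) * b" by simp
      also have "\<dots> \<le> m * b" using qm q2 by (intro mult_right_mono) auto
      finally show ?thesis by simp
    qed (simp add: A'_def)
  qed
  have origin: "z = (\<lambda>_. 0)"
    if z: "\<forall>f\<in>vanishing ?B. mpoly_eval f z = 0" "\<forall>a\<in>A'. mpoly_eval (line_condition n b c A B a) z = 0" for z
  proof -
    define x where "x i = to_fract (tuple n b z i)" for i
    define u where "u j = tuple_form n (c j) (tuple n b z)" for j
    have lx: "mpoly_eval (l j) x = to_fract (u j)" if "j < q" for j
      unfolding c[OF that] u_def to_fract_tuple_form x_def[abs_def] ..
    have point: "mpoly_eval f x = 0" if f: "f \<in> P" "homogeneous s f" for f s
    proof -
      \<comment> \<open>After clearing denominators, all coefficients of the expanded equation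
        vanish at \<open>z\<close>, so the equation holds for the tuple of \<open>z\<close>.\<close>
      obtain a F where F: "a \<noteq> 0" "peval (\<lambda>p. Const (to_fract p)) Var F = Const (to_fract a) * f"
        using mpoly_clear[of f] by blast
      have "Const (to_fract a) * f \<in> P" by (rule is_idealD(3)[OF idealP f(1)])
      then have "coeff (expand n b F) k \<in> vanishing ?B" for k
        using homogeneous_Const_mult[OF f(2), of "to_fract a"] unfolding F(2)[symmetric] by (rule expand_vanishing)
      then have "map_poly (\<lambda>G. mpoly_eval G z) (expand n b F) = 0"
        using z(1) by (simp add: poly_eq_iff coeff_map_poly_ring[OF ring_map_mpoly_eval])
      then have "to_fract (mpoly_eval F (tuple n b z)) = 0" by (simp add: map_poly_expand)
      then have "to_fract a * mpoly_eval f x = 0"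
        unfolding to_fract_mpoly_eval F(2) x_def[abs_def, symmetric] mpoly_eval_mult mpoly_eval_Const .
      then show ?thesis using F(1) by simp
    qed
    define L where "L j = to_fract [:A j, B j:]" for j
    have L0: "L 0 \<noteq> 0" using AB(1) by (auto simp: L_def)
    \<comment> \<open>The factor of proportionality may be any element of C(t).\<close>
    define s where "s = to_fract (u 0) / L 0"
    have s0: "to_fract (u 0) = s * L 0" using L0 by (simp add: s_def)
    have line: "to_fract (u j) = s * L j" if j: "j < q" for j
    proof (cases "j = 0")
      case False
      then have q: "q \<noteq> 1" "1 < q" using j by auto
      have zero: "mpoly_eval (line_condition n b c A B a) z = 0" if "a \<in> {2..<q} \<times> {..<b} \<union> {0} \<times> {..b}" for a
        using z(2) that q(1) by (simp add: A'_def)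
      have "to_fract ([:A 1, B 1:] * u 0) = to_fract ([:A 0, B 0:] * u 1)"
        using line_condition_zero(1)[OF zero] unfolding u_def by simp
      then have "L 1 * (s * L 0) = L 0 * to_fract (u 1)"
        unfolding to_fract_mult L_def[symmetric] s0 .
      then have s1: "to_fract (u 1) = s * L 1" using L0 by (simp add: mult.commute)
      show ?thesis
      proof (cases "j = 1")
        case False
        then have j2: "2 \<le> j" using \<open>j \<noteq> 0\<close> by simp
        \<comment> \<open>Cramer's rule: up to the factor \<open>?d\<close>, the coordinates of A j
          + B j t in the basis A 0 + B 0 t, A 1 + B 1 t are \<open>?a\<close> and
          \<open>?b\<close>.\<close>
        let ?d = "A 0 * B 1 - A 1 * B 0" and ?a = "A j * B 1 - B j * A 1" and ?b = "A 0 * B j - B 0 * A j"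
        have smult: "to_fract (smult r p) = of_complex r * to_fract p" for r p
          unfolding of_complex_def by (simp only: to_fract_mult[symmetric]) simp
        have "smult ?d (u j) = smult ?a (u 0) + smult ?b (u 1)"
          using line_condition_zero(2)[OF zero j2 j] unfolding u_def .
        then have "to_fract (smult ?d (u j)) = to_fract (smult ?a (u 0) + smult ?b (u 1))" by (rule arg_cong)
        then have "of_complex ?d * to_fract (u j) = s * (of_complex ?a * L 0 + of_complex ?b * L 1)"
          by (simp only: to_fract_add smult s0 s1) (simp add: algebra_simps)
        also have "of_complex ?a * L 0 + of_complex ?b * L 1 = of_complex ?d * L j"
          unfolding L_def smult[symmetric] to_fract_add[symmetric] by (simp add: algebra_simps)
        finally have "of_complex ?d * to_fract (u j) = of_complex ?d * (s * L j)" by (simp add: mult_ac)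
        moreover have "of_complex ?d \<noteq> 0"
          using AB(2) q(2) of_complex_eq_iff[of ?d 0] ring_mapD(1)[OF ring_map_of_complex] by simp
        ultimately show ?thesis by simp
      qed (use s1 in simp)
    qed (simp add: s0)
    have x0: "x v = 0" for v
      by (rule no_common_point[OF l AB(1) empty point, where s = s]) (simp_all add: lx line L_def)
    show ?thesis
    proof
      fix w :: "nat \<times> nat"
      show "z w = 0"
      proof (cases "w \<in> ?W")
        case True
        then obtain i j where w: "w = (i, j)" "i \<le> n" "j < b" by auto
        have "tuple n b z i = 0" using x0[of i] by (simp add: x_def)
        from arg_cong[OF this, of "\<lambda>p. coeff p j"] show ?thesis using w by (simp add: coeff_tuple)
      next
        case False
        then have "Var w \<in> vanishing ?B"
          using BW proj_space_outside[of _ ?W _ w] by (auto simp: vanishing_def mpoly_eval_Var)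
        then have "mpoly_eval (Var w) z = 0" using z(1) by blast
        then show ?thesis by (simp add: mpoly_eval_Var)
      qed
    qed
  qed
  show ?thesis
    by (rule krull_dim_le_of_linear_section[OF BW _ homogeneous_line_condition cardA origin]) simp_all
qed

end
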